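(* Let $\Omega$ be a bounded domain of $\mathbb{R}^n$, let $2\le p<\infty$ and $p-1<\sigma\le p$. Let $\bm{a}:\Omega\times\mathbb{R}^n\to\mathbb{R}^n$ be a Carathéodory function (measurable in $x$, continuous in $\xi$) such that there is $\gamma>0$ with $$(\bm{a}(x,\xi)-\bm{a}(x,\eta))\cdot(\xi-\eta)\ge\gamma\,|\xi-\eta|^p$$ for all $x\in\Omega$, $\xi,\eta\in\mathbb{R}^n$. Let $f,g:\Omega\times\mathbb{R}\to\mathbb{R}$ be continuous, with $f(x,t)$ and $g(x,t)$ non-decreasing in $t\in\mathbb{R}$ for every $x\in\Omega$. Assume the homogeneity conditions (a-h) $\bm{a}(x,\delta\xi)=\delta^{p-1}\bm{a}(x,\xi)$ for all $(x,\xi)\in\Omega\times\mathbb{R}^n$, (f-h) $f(x,\delta t)\le\delta^{p-1}f(x,t)$ for all $(x,t)\in\Omega\times\mathbb{R}$, for all $\delta\in(0,1)$. Suppose $u,v\in W^{1,p}_{loc}(\Omega)\cap L^\infty_{loc}(\Omega)$, that $u$ is essentially bounded from below in $\Omega$, and that $g(x,v(x))\ge0$ in $\Omega$. If $Q^*u\le0\le Q^*v$ in $\Omega$ and $u\le v$ on $\partial\Omega$, then $u\le v$ in $\Omega$.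
   Context: Here $Q^*u:=-\operatorname{div}(\bm{a}(x,\nabla u))+f(x,u)+g(x,u)|\nabla u|^\sigma$. The inequality $Q^*u\le0$ in $\Omega$ means $\int_\Omega\bm{a}(x,\nabla u)\cdot\nabla\varphi+\int_\Omega\big(f(x,u)+g(x,u)|\nabla u|^\sigma\big)\varphi\le0$ for all $\varphi\in C^1_c(\Omega)$ with $\varphi\ge0$, and $Q^*v\ge0$ means the reverse inequality with $v$ in place of $u$; it is understood that the consistency conditions $|\bm{a}(x,\nabla u)|,|\bm{a}(x,\nabla v)|,f(x,u),f(x,v)\in L^{p/(p-1)}_{loc}(\Omega)$ hold, so that the integrals are well defined and these inequalities may be used with non-negative test functions $\varphi\in W^{1,p}(\Omega)$ with compact support in $\Omega$. "$u\le v$ in $\Omega$" means a.e.; "$u\le v$ on $\partial\Omega$" means $\limsup_{x\to\partial\Omega}(u(x)-v(x))\le0$. *)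

theory Defs
  imports "HOL-Analysis.Analysis"
begin

definition bounded_domain :: "'a::euclidean_space set \<Rightarrow> bool" where
  "bounded_domain \<Omega> \<longleftrightarrow> open \<Omega> \<and> connected \<Omega> \<and> \<Omega> \<noteq> {} \<and> bounded \<Omega>"

definition supp_closure :: "('a::euclidean_space \<Rightarrow> real) \<Rightarrow> 'a set" where
  "supp_closure \<phi> = closure {x. \<phi> x \<noteq> 0}"

definition C1c :: "'a::euclidean_space set \<Rightarrow> ('a \<Rightarrow> real) \<Rightarrow> ('a \<Rightarrow> 'a) \<Rightarrow> bool" where
  "C1c \<Omega> \<phi> D\<phi> \<longleftrightarrow>
     (\<forall>x. (\<phi> has_derivative (\<lambda>h. D\<phi> x \<bullet> h)) (at x)) \<and> continuous_on UNIV D\<phi> \<and>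
     compact (supp_closure \<phi>) \<and> supp_closure \<phi> \<subseteq> \<Omega>"

definition Lp_loc :: "real \<Rightarrow> 'a::euclidean_space set \<Rightarrow> ('a \<Rightarrow> 'b::real_normed_vector) \<Rightarrow> bool" where
  "Lp_loc q \<Omega> h \<longleftrightarrow> h \<in> borel_measurable (lebesgue_on \<Omega>) \<and>
     (\<forall>K. compact K \<longrightarrow> K \<subseteq> \<Omega> \<longrightarrow> set_integrable lebesgue K (\<lambda>x. norm (h x) powr q))"

definition Linf_loc :: "'a::euclidean_space set \<Rightarrow> ('a \<Rightarrow> real) \<Rightarrow> bool" where
  "Linf_loc \<Omega> u \<longleftrightarrow> u \<in> borel_measurable (lebesgue_on \<Omega>) \<and>
     (\<forall>K. compact K \<longrightarrow> K \<subseteq> \<Omega> \<longrightarrow> (\<exists>C. AE x in lebesgue. x \<in> K \<longrightarrow> \<bar>u x\<bar> \<le> C))"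

definition W1p_loc :: "real \<Rightarrow> 'a::euclidean_space set \<Rightarrow> ('a \<Rightarrow> real) \<Rightarrow> ('a \<Rightarrow> 'a) \<Rightarrow> bool" where
  "W1p_loc p \<Omega> u Du \<longleftrightarrow> Lp_loc p \<Omega> u \<and> Lp_loc p \<Omega> Du \<and>
     (\<forall>\<phi> D\<phi>. C1c \<Omega> \<phi> D\<phi> \<longrightarrow>
        (LINT x:\<Omega>|lebesgue. u x *\<^sub>R D\<phi> x) = - (LINT x:\<Omega>|lebesgue. \<phi> x *\<^sub>R Du x))"

definition Qstar_form ::
  "('a::euclidean_space \<Rightarrow> 'a \<Rightarrow> 'a) \<Rightarrow> ('a \<Rightarrow> real \<Rightarrow> real) \<Rightarrow> ('a \<Rightarrow> real \<Rightarrow> real) \<Rightarrow> real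
    \<Rightarrow> 'a set \<Rightarrow> ('a \<Rightarrow> real) \<Rightarrow> ('a \<Rightarrow> 'a) \<Rightarrow> ('a \<Rightarrow> real) \<Rightarrow> ('a \<Rightarrow> 'a) \<Rightarrow> real" where
  "Qstar_form a f g \<sigma> \<Omega> u Du \<phi> D\<phi> =
     (LINT x:\<Omega>|lebesgue. a x (Du x) \<bullet> D\<phi> x) +
     (LINT x:\<Omega>|lebesgue. (f x (u x) + g x (u x) * norm (Du x) powr \<sigma>) * \<phi> x)"

definition Qstar_sub ::
  "('a::euclidean_space \<Rightarrow> 'a \<Rightarrow> 'a) \<Rightarrow> ('a \<Rightarrow> real \<Rightarrow> real) \<Rightarrow> ('a \<Rightarrow> real \<Rightarrow> real) \<Rightarrow> real
    \<Rightarrow> 'a set \<Rightarrow> ('a \<Rightarrow> real) \<Rightarrow> ('a \<Rightarrow> 'a) \<Rightarrow> bool" where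
  "Qstar_sub a f g \<sigma> \<Omega> u Du \<longleftrightarrow>
     (\<forall>\<phi> D\<phi>. C1c \<Omega> \<phi> D\<phi> \<longrightarrow> (\<forall>x. 0 \<le> \<phi> x) \<longrightarrow> Qstar_form a f g \<sigma> \<Omega> u Du \<phi> D\<phi> \<le> 0)"

definition Qstar_super ::
  "('a::euclidean_space \<Rightarrow> 'a \<Rightarrow> 'a) \<Rightarrow> ('a \<Rightarrow> real \<Rightarrow> real) \<Rightarrow> ('a \<Rightarrow> real \<Rightarrow> real) \<Rightarrow> real
    \<Rightarrow> 'a set \<Rightarrow> ('a \<Rightarrow> real) \<Rightarrow> ('a \<Rightarrow> 'a) \<Rightarrow> bool" where
  "Qstar_super a f g \<sigma> \<Omega> v Dv \<longleftrightarrow>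
     (\<forall>\<phi> D\<phi>. C1c \<Omega> \<phi> D\<phi> \<longrightarrow> (\<forall>x. 0 \<le> \<phi> x) \<longrightarrow> 0 \<le> Qstar_form a f g \<sigma> \<Omega> v Dv \<phi> D\<phi>)"

text \<open>u \<le> v on the boundary: limsup of (u - v) as x \<rightarrow> frontier Omega is \<le> 0.\<close>
definition le_on_boundary :: "'a::euclidean_space set \<Rightarrow> ('a \<Rightarrow> real) \<Rightarrow> ('a \<Rightarrow> real) \<Rightarrow> bool" where
  "le_on_boundary \<Omega> u v \<longleftrightarrow>
     (\<forall>\<epsilon>>0. \<exists>\<delta>>0. \<forall>x\<in>\<Omega>. infdist x (frontier \<Omega>) < \<delta> \<longrightarrow> u x - v x < \<epsilon>)"

end

theory Submission
  imports Defs
begin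

text \<open>
  Choose \<open>c \<ge> 0\<close> with \<open>u \<ge> - c\<close> and fix \<open>0 < \<delta> < 1\<close>. By homogeneity \<open>u\<^sub>\<delta> = \<delta> u - (1 - \<delta>) c \<le> u\<close> is again a
  subsolution, and where \<open>u\<^sub>\<delta> > v\<close> its gradient term is multiplied by \<open>\<kappa> = \<delta> powr (p - 1 - \<sigma>) > 1\<close>.
  Since \<open>|Dv|\<^sup>\<sigma> \<le> \<kappa> |Du\<^sub>\<delta>|\<^sup>\<sigma> + C |Du\<^sub>\<delta> - Dv|\<^sup>\<sigma>\<close>, testing both inequalities with \<open>z\<^sup>2\<close>, where
  \<open>z = max 0 (u\<^sub>\<delta> - v - k)\<close> and \<open>s = |Du\<^sub>\<delta> - Dv|\<close>, leaves \<open>2 \<gamma> \<integral> z s\<^sup>p \<le> C' \<integral> s\<^sup>\<sigma> z\<^sup>2\<close>.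
  If \<open>z \<le> m\<close>, then \<open>s\<^sup>\<sigma> z \<le> m powr (\<sigma> + 1 - p) (s\<^sup>p + z\<^sup>p)\<close>, so that by a Poincare inequality the right-hand side
  is absorbed for small \<open>m\<close> and \<open>z\<close> vanishes. Hence an essential upper bound of \<open>u\<^sub>\<delta> - v\<close> can be lowered in steps of
  a fixed size down to any positive level; finally let \<open>\<delta>\<close> tend to \<open>1\<close>.

  The test function \<open>z\<^sup>2\<close> is reached from \<open>C\<^sup>1\<close> test functions by mollifying \<open>\<delta> u - v\<close>. No chain rule for
  Sobolev functions is needed, since \<open>t \<mapsto> (max 0 t)\<^sup>2\<close> is itself \<open>C\<^sup>1\<close>.
\<close>

subsection \<open>Elementary inequalities and the measure on Euclidean space\<close>

text \<open>For \<sigma> > p - 1 the gradient term is not of lower order, and |Dv|^\<sigma> -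
  |Du|^\<sigma> is not controlled by a power of |Du - Dv| alone. The factor \<kappa> > 1 removes the
  part carried by |Du|, and g(x, v) >= 0 gives this gain the right sign. What is left carries the
  weight z^2, against the weight z of the coercive term. The spare factor z is the source of
  smallness, through the positive exponent \<sigma> + 1 - p. Since the coercive term is weighted,
  the Poincare inequality has to be weighted as well: z^(p+1) against z |Dh|^p with h = \<delta> u -
  v. The functions u and v are bounded only locally and the boundary inequality is a limsup, so
  levels are kept above \<open>k0 = (1 - \<delta>) * c + \<epsilon>\<close>. All truncations then
  live on one compact set \<open>K\<close>, and the admissible height \<open>m0\<close> depends on
  \<open>K\<close> and \<delta> but not on the level; this is why finitely many steps suffice. In
  the formal proof the shift (1 - \<delta>) c is not subtracted from \<delta> u; it is part of the
  level \<open>k\<close>.\<close>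

lemma powr_mult_le_weighted:
  fixes z s \<eta> p :: real
  assumes "0 \<le> z" "0 \<le> s" "0 < \<eta>" "1 \<le> p"
  shows "z powr (p - 1) * s \<le> \<eta> * z powr p + \<eta> powr (1 - p) * s powr p"
\<comment> \<open>Whichever of \<open>s\<close> and \<open>\<eta> * z\<close> is larger, one of the
  two terms on the right is a bound by itself. The free weight \<open>\<eta>\<close> is what later
  makes one of them absorbable.\<close>
proof (cases "s \<le> \<eta> * z")
  case True
  have "z powr (p - 1) * s \<le> z powr (p - 1) * (\<eta> * z)"
    using True by (intro mult_left_mono) auto
  also have "\<dots> = \<eta> * z powr p"
    using assms by (cases "z = 0") (auto simp: powr_mult_base powr_diff)
  finally show ?thesis by (smt (verit) mult_nonneg_nonneg powr_ge_zero)
next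
  case False
  then have s: "0 < s" using assms by (smt (verit) mult_nonneg_nonneg)
  have "z \<le> s / \<eta>" using False assms by (simp add: field_simps)
  then have "z powr (p - 1) * s \<le> (s / \<eta>) powr (p - 1) * s"
    using assms by (intro mult_right_mono powr_mono2) auto
  also have "\<dots> = \<eta> powr (1 - p) * s powr p"
    using assms s by (simp add: powr_divide powr_diff divide_simps)
  finally show ?thesis using assms by (smt (verit) mult_nonneg_nonneg powr_ge_zero)
qed

text \<open>The ray \<open>s = \<tau> * U\<close> separates two regimes, each governed by one of the
  terms. The constant found here blows up as \<open>\<kappa>\<close> tends to 1, so it is tied to
  one fixed scaling factor.\<close>

lemma add_powr_le_weighted:
  fixes \<kappa> \<sigma> :: real
  assumes "1 < \<kappa>" "0 < \<sigma>"
  obtains C where "0 \<le> C"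
    "\<And>U s. 0 \<le> U \<Longrightarrow> 0 \<le> s \<Longrightarrow> (U + s) powr \<sigma> \<le> \<kappa> * U powr \<sigma> + C * s powr \<sigma>"
proof
  \<comment> \<open>Solves \<open>(1 + \<tau>) powr \<sigma> = \<kappa>\<close>.\<close>
  define \<tau> where "\<tau> = \<kappa> powr (1 / \<sigma>) - 1"
  have \<tau>: "0 < \<tau>" using assms by (simp add: \<tau>_def)
  have \<tau>': "(1 + \<tau>) powr \<sigma> = \<kappa>" using assms by (simp add: \<tau>_def powr_powr)
  show "0 \<le> (1 + 1 / \<tau>) powr \<sigma>" by simp
  fix U s :: real assume Us: "0 \<le> U" "0 \<le> s"
  show "(U + s) powr \<sigma> \<le> \<kappa> * U powr \<sigma> + (1 + 1 / \<tau>) powr \<sigma> * s powr \<sigma>"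
  proof (cases "s \<le> \<tau> * U")
    case True
    have "(U + s) powr \<sigma> \<le> ((1 + \<tau>) * U) powr \<sigma>"
      using True Us assms by (intro powr_mono2) (auto simp: algebra_simps)
    also have "\<dots> = \<kappa> * U powr \<sigma>" using Us \<tau> \<tau>' by (simp add: powr_mult)
    finally show ?thesis by (smt (verit) mult_nonneg_nonneg powr_ge_zero)
  next
    case False
    then have "U \<le> s / \<tau>" using \<tau> by (simp add: field_simps)
    then have "(U + s) powr \<sigma> \<le> ((1 + 1 / \<tau>) * s) powr \<sigma>"
      using Us assms by (intro powr_mono2) (auto simp: algebra_simps)
    also have "\<dots> = (1 + 1 / \<tau>) powr \<sigma> * s powr \<sigma>" using Us \<tau> by (simp add: powr_mult)
    finally show ?thesis using assms by (smt (verit) mult_nonneg_nonneg powr_ge_zero)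
  qed
qed

text \<open>Compare \<open>z\<close> with \<open>s\<close>. If \<open>s\<close> is larger, \<sigma>
  \<le> p turns the missing power of \<open>s\<close> into a power of \<open>z\<close>; if
  \<open>z\<close> is larger, \<open>s\<close> is replaced by \<open>z\<close>. Both cases leave the
  factor \<open>z powr (\<sigma> + 1 - p)\<close>, and p - 1 < \<sigma> lets it be bounded by the
  same power of \<open>m\<close>, which is small with \<open>m\<close>.\<close>

lemma powr_mult_le_small:
  fixes z s m p \<sigma> :: real
  assumes "0 \<le> z" "z \<le> m" "0 \<le> s" "p - 1 < \<sigma>" "\<sigma> \<le> p" "0 < \<sigma>"
  shows "s powr \<sigma> * z \<le> m powr (\<sigma> + 1 - p) * (s powr p + z powr p)"
proof (cases "z = 0")
  case False
  then have z: "0 < z" using assms by auto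
  have zm: "z powr (\<sigma> + 1 - p) \<le> m powr (\<sigma> + 1 - p)" using assms by (intro powr_mono2) auto
  show ?thesis
  proof (cases "z \<le> s")
    case True
    have "s powr \<sigma> * z = s powr p * (s powr (\<sigma> - p) * z)"
      using True z by (simp add: powr_diff)
    also have "\<dots> \<le> s powr p * (z powr (\<sigma> - p) * z)"
      using True z assms by (intro mult_left_mono mult_right_mono powr_mono2') auto
    also have "z powr (\<sigma> - p) * z = z powr (\<sigma> + 1 - p)"
      using z by (simp add: powr_diff powr_add)
    also have "s powr p * z powr (\<sigma> + 1 - p) \<le> s powr p * m powr (\<sigma> + 1 - p)"
      using zm by (intro mult_left_mono) auto
    finally show ?thesis by (smt (verit) distrib_left mult.commute mult_nonneg_nonneg powr_ge_zero)
  next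
    case False
    have "s powr \<sigma> * z \<le> z powr \<sigma> * z"
      using False assms by (intro mult_right_mono powr_mono2) auto
    also have "\<dots> = z powr p * z powr (\<sigma> + 1 - p)"
      using z by (simp add: powr_diff powr_add)
    also have "\<dots> \<le> z powr p * m powr (\<sigma> + 1 - p)"
      using zm by (intro mult_left_mono) auto
    finally show ?thesis by (smt (verit) distrib_left mult.commute mult_nonneg_nonneg powr_ge_zero)
  qed
qed (use assms in auto)

lemma add_powr_le:
  fixes a b p :: real
  assumes "0 \<le> a" "0 \<le> b" "0 \<le> p"
  shows "(a + b) powr p \<le> 2 powr p * (a powr p + b powr p)"
proof -
  have "(a + b) powr p \<le> (2 * max a b) powr p"
    using assms by (intro powr_mono2) auto
  also have "\<dots> = 2 powr p * max a b powr p" using assms by (simp add: powr_mult)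
  also have "max a b powr p \<le> a powr p + b powr p" by (auto simp: max_def)
  finally show ?thesis by simp
qed

lemma le_one_plus_powr:
  fixes a p q :: real
  assumes "0 \<le> a" "0 \<le> q" "q \<le> p"
  shows "a powr q \<le> 1 + a powr p"
proof (cases "a \<le> 1")
  case True
  then have "a powr q \<le> 1" using assms by (intro powr_le1) auto
  then show ?thesis by (smt (verit) powr_ge_zero)
next
  case False
  then have "a powr q \<le> a powr p" using assms by (intro powr_mono) auto
  then show ?thesis by simp
qed

section \<open>Reflections, translations and averages under Lebesgue measure\<close>

lemma lborel_distr_reflect: "distr lborel borel (\<lambda>y. x - y) = (lborel :: 'a::euclidean_space measure)"
  using lborel_affine[of "-1" x] by (simp add: density_1)

lemma nn_integral_lborel_reflect:
  fixes f :: "'a::euclidean_space \<Rightarrow> ennreal"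
  assumes [measurable]: "f \<in> borel_measurable borel"
  shows "(\<integral>\<^sup>+ y. f (x - y) \<partial>lborel) = (\<integral>\<^sup>+ y. f y \<partial>lborel)"
  by (subst (2) lborel_distr_reflect[symmetric, of x], subst nn_integral_distr) auto

lemma integral_lborel_reflect:
  fixes f :: "'a::euclidean_space \<Rightarrow> 'b::euclidean_space"
  assumes [measurable]: "f \<in> borel_measurable borel"
  shows "(LINT y|lborel. f (x - y)) = (LINT y|lborel. f y)"
  by (subst (2) lborel_distr_reflect[symmetric, of x], subst integral_distr) auto

lemma integrable_lborel_reflect:
  fixes f :: "'a::euclidean_space \<Rightarrow> 'b::euclidean_space"
  assumes "integrable lborel f"
  shows "integrable lborel (\<lambda>y. f (x - y))"
proof -
  have [measurable]: "f \<in> borel_measurable borel" using assms by auto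
  have "integrable (distr lborel borel (\<lambda>y. x - y)) f" using assms by (simp add: lborel_distr_reflect)
  then show ?thesis by (subst (asm) integrable_distr_eq) auto
qed

lemma nn_integral_lborel_translate:
  fixes f :: "'a::euclidean_space \<Rightarrow> ennreal"
  assumes [measurable]: "f \<in> borel_measurable borel"
  shows "(\<integral>\<^sup>+ y. f (y - x) \<partial>lborel) = (\<integral>\<^sup>+ y. f y \<partial>lborel)"
  by (subst (2) lborel_distr_plus[symmetric, of "- x"], subst nn_integral_distr) auto

text \<open>Jensen's inequality for a power, obtained by integrating Young's inequality
  \<open>p * s powr (p - 1) * w \<le> w powr p + (p - 1) * s powr p\<close> at \<open>s\<close> the mean of \<open>w\<close>.\<close>

lemma powr_mean_le:
  fixes \<rho> w :: "'a \<Rightarrow> real"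
  assumes \<rho>: "integrable M \<rho>" "integral\<^sup>L M \<rho> = 1" "\<And>x. 0 \<le> \<rho> x"
    and [measurable]: "w \<in> borel_measurable M" and w: "\<And>x. 0 \<le> w x"
    and \<rho>w: "integrable M (\<lambda>x. \<rho> x * w x)" and p: "1 < p"
  shows "ennreal ((LINT x|M. \<rho> x * w x) powr p) \<le> (\<integral>\<^sup>+ x. ennreal (\<rho> x * w x powr p) \<partial>M)"
\<comment> \<open>An infinite right-hand side leaves nothing to prove; a finite one supplies the
  integrability needed to integrate Young's inequality.\<close>
proof (cases "(\<integral>\<^sup>+ x. ennreal (\<rho> x * w x powr p) \<partial>M) < \<infinity>")
  case True
  have [measurable]: "\<rho> \<in> borel_measurable M" using \<rho> by auto
  have int: "integrable M (\<lambda>x. \<rho> x * w x powr p)"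
    by (rule integrableI_nonneg) (use True \<rho> w in auto)
  define s where "s = (LINT x|M. \<rho> x * w x)"
  have s0: "0 \<le> s" unfolding s_def using \<rho> w by (intro integral_nonneg_AE) auto
  have young: "p * s powr (p - 1) * t \<le> t powr p + (p - 1) * s powr p" if "0 \<le> t" for t
  proof -
    have "t * s powr (p - 1) \<le> t powr p / p + (s powr (p - 1)) powr (p / (p - 1)) / (p / (p - 1))"
      using p that by (intro Youngs_inequality) (auto simp: field_simps)
    also have "(s powr (p - 1)) powr (p / (p - 1)) = s powr p" using p by (simp add: powr_powr)
    finally show ?thesis using p by (simp add: field_simps)
  qed
  have "(LINT x|M. p * s powr (p - 1) * (\<rho> x * w x)) \<le> (LINT x|M. \<rho> x * w x powr p + (p - 1) * s powr p * \<rho> x)"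
  proof (rule integral_mono)
    fix x
    show "p * s powr (p - 1) * (\<rho> x * w x) \<le> \<rho> x * w x powr p + (p - 1) * s powr p * \<rho> x"
      using mult_left_mono[OF young[OF w[of x]] \<rho>(3)[of x]] by (simp add: algebra_simps)
  qed (use \<rho>w int \<rho> in auto)
  then have "p * s powr (p - 1) * s \<le> (LINT x|M. \<rho> x * w x powr p) + (p - 1) * s powr p"
    using \<rho>w int \<rho> by (simp add: s_def[symmetric])
  moreover have "s powr (p - 1) * s = s powr p" using s0 p by (cases "s = 0") (auto simp: powr_diff)
  ultimately have "s powr p \<le> (LINT x|M. \<rho> x * w x powr p)" by (simp add: algebra_simps)
  then show ?thesis
    using int \<rho> w by (simp add: nn_integral_eq_integral s_def ennreal_leI)
qed (simp add: not_less top_unique)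

section \<open>Truncated powers and C1 kernels\<close>

text \<open>Away from 0 the function agrees locally with 0 or with \<open>t powr b\<close>. At 0 the
  difference quotient is at most \<open>\<bar>h\<bar> powr (b - 1)\<close>, which tends to 0 because
  \<open>b\<close> exceeds 1.\<close>

lemma max0_powr_has_derivative:
  fixes b t :: real
  assumes b: "1 < b"
  shows "((\<lambda>t. max 0 t powr b) has_real_derivative b * max 0 t powr (b - 1)) (at t)"
proof -
  consider "t < 0" | "t > 0" | "t = 0" by linarith
  then show ?thesis
  proof cases
    case 1
    have "((\<lambda>t::real. 0) has_real_derivative 0) (at t)" by simp
    then have "((\<lambda>t::real. max 0 t powr b) has_real_derivative 0) (at t)"
      by (rule DERIV_cong_ev[THEN iffD1, rotated 3])
        (use 1 b eventually_nhds_in_open[of "{..<0}" t] in \<open>auto elim: eventually_mono\<close>)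
    then show ?thesis using 1 by simp
  next
    case 2
    have "((\<lambda>t. t powr b) has_real_derivative b * t powr (b - 1)) (at t)"
      using 2 by (intro has_real_derivative_powr)
    then have "((\<lambda>t::real. max 0 t powr b) has_real_derivative b * t powr (b - 1)) (at t)"
      by (rule DERIV_cong_ev[THEN iffD1, rotated 3])
        (use 2 eventually_nhds_in_open[of "{0<..}" t] in \<open>auto elim: eventually_mono\<close>)
    then show ?thesis using 2 by simp
  next
    case 3
    have "((\<lambda>h. (max 0 (0 + h) powr b - max 0 0 powr b) / h) \<longlongrightarrow> 0) (at (0::real))"
    proof (rule tendsto_rabs_zero_cancel, rule tendsto_sandwich[of "\<lambda>_. 0" _ _ "\<lambda>h. \<bar>h\<bar> powr (b - 1)"])
      show "\<forall>\<^sub>F h in at (0::real). \<bar>(max 0 (0 + h) powr b - max 0 0 powr b) / h\<bar> \<le> \<bar>h\<bar> powr (b - 1)"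
        by (intro always_eventually allI) (auto simp: max_def powr_diff divide_nonneg_neg divide_nonneg_nonpos)
      have "((\<lambda>h::real. \<bar>h\<bar> powr (b - 1)) \<longlongrightarrow> \<bar>0\<bar> powr (b - 1)) (at 0)"
        using b by (intro tendsto_powr' tendsto_intros) auto
      then show "((\<lambda>h::real. \<bar>h\<bar> powr (b - 1)) \<longlongrightarrow> 0) (at 0)" by simp
    qed auto
    then show ?thesis using 3 by (simp add: DERIV_def)
  qed
qed

text \<open>The kernel is the square of max(0, r^2 - |x|^2), divided by its integral. Squaring
  removes the kink on the sphere of radius \<open>r\<close>, and one continuous derivative is all
  that \<open>C1c\<close> asks for.\<close>

lemma C1_mollifier_exists:
  fixes r :: real
  assumes r: "0 < r"
  obtains \<rho> :: "'a::euclidean_space \<Rightarrow> real" and D\<rho> :: "'a \<Rightarrow> 'a"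
  where "\<And>x. (\<rho> has_derivative (\<lambda>h. D\<rho> x \<bullet> h)) (at x)" "continuous_on UNIV D\<rho>"
    "\<And>x. 0 \<le> \<rho> x" "\<And>x. r \<le> norm x \<Longrightarrow> \<rho> x = 0" "\<And>x. r \<le> norm x \<Longrightarrow> D\<rho> x = 0"
    "integrable lborel \<rho>" "(LINT x|lborel. \<rho> x) = 1"
proof -
  define b :: "'a \<Rightarrow> real" where "b x = (max 0 (r\<^sup>2 - x \<bullet> x))\<^sup>2" for x
  define Db :: "'a \<Rightarrow> 'a" where "Db x = (-4 * max 0 (r\<^sup>2 - x \<bullet> x)) *\<^sub>R x" for x
  have der: "(b has_derivative (\<lambda>h. Db x \<bullet> h)) (at x)" for x
  proof -
    have 1: "((\<lambda>x. r\<^sup>2 - x \<bullet> x) has_derivative (\<lambda>h. - 2 * (x \<bullet> h))) (at x)"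
      by (auto intro!: derivative_eq_intros simp: inner_commute)
    have "((\<lambda>t. (max 0 t)\<^sup>2) has_derivative (*) (2 * max 0 (r\<^sup>2 - x \<bullet> x))) (at (r\<^sup>2 - x \<bullet> x))"
      using max0_powr_has_derivative[of 2 "r\<^sup>2 - x \<bullet> x"] by (simp add: has_field_derivative_def)
    from diff_chain_at[OF 1 this] show ?thesis
      by (simp add: b_def[abs_def] Db_def o_def mult_ac inner_commute)
  qed
  have contb: "continuous_on UNIV b" unfolding b_def by (intro continuous_intros)
  have contDb: "continuous_on UNIV Db" unfolding Db_def by (intro continuous_intros)
  have out: "r\<^sup>2 - x \<bullet> x \<le> 0" if "r \<le> norm x" for x :: 'a
    using that r by (simp add: dot_square_norm power_mono)
  have ib: "integrable lborel b"
  proof -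
    have "integrable lborel (\<lambda>x. indicator (cball 0 r) x *\<^sub>R b x)"
      using contb by (intro borel_integrable_compact) (auto intro: continuous_on_subset)
    moreover have "indicator (cball 0 r) x *\<^sub>R b x = b x" for x
      using out[of x] by (auto simp: indicator_def b_def)
    ultimately show ?thesis by (simp only: )
  qed
  define I where "I = (LINT x|lborel. b x)"
  have I: "0 < I"
  proof -
    have "0 \<le> I" unfolding I_def by (intro integral_nonneg_AE) (auto simp: b_def)
    \<comment> \<open>A vanishing integral would make \<open>b\<close> zero almost everywhere, but
      \<open>b\<close> is positive on a ball of positive volume.\<close>
    moreover have "I \<noteq> 0"
    proof
      assume "I = 0"
      then have "AE x in lborel. b x = 0"
        using ib by (subst (asm) I_def, subst (asm) integral_nonneg_eq_0_iff_AE) (auto simp: b_def)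
      then have "AE x in lborel. x \<notin> ball (0::'a) r"
      proof (rule AE_mp, intro AE_I2 impI)
        fix x :: 'a assume "b x = 0"
        then have "r\<^sup>2 \<le> x \<bullet> x" by (auto simp: b_def max_def split: if_splits)
        then have "r \<le> norm x" using r by (metis dot_square_norm norm_ge_zero power2_le_imp_le)
        then show "x \<notin> ball 0 r" by simp
      qed
      then have "emeasure lborel (ball (0::'a) r) = 0"
        by (subst (asm) AE_iff_measurable[OF _ refl]) (auto simp: ball_def)
      then show False using r content_ball_pos[OF r, of "0::'a"]
        by (simp add: measure_def)
    qed
    ultimately show ?thesis by simp
  qed
  show ?thesis
  proof (rule that[of "\<lambda>x. b x / I" "\<lambda>x. (1 / I) *\<^sub>R Db x"])
    fix x
    show "((\<lambda>x. b x / I) has_derivative (\<lambda>h. (1 / I) *\<^sub>R Db x \<bullet> h)) (at x)"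
      using has_derivative_mult_right[OF der, of "1 / I" x] by (simp add: mult_ac)
    show "continuous_on UNIV (\<lambda>x. (1 / I) *\<^sub>R Db x)" using contDb by (intro continuous_intros)
    show "0 \<le> b x / I" using I by (simp add: b_def)
    show "b x / I = 0" if "r \<le> norm x" using out[OF that] by (simp add: b_def)
    show "(1 / I) *\<^sub>R Db x = 0" if "r \<le> norm x" using out[OF that] by (simp add: Db_def)
    show "integrable lborel (\<lambda>x. b x / I)" using ib by simp
    show "(LINT x|lborel. b x / I) = 1" using I ib by (simp add: I_def)
  qed
qed

subsection \<open>Convolution with \<open>C\<^sup>1\<close> kernels\<close>

lemma uniformly_continuous_compact_support:
  fixes c :: "'a::euclidean_space \<Rightarrow> 'b::real_normed_vector"
  assumes c: "continuous_on UNIV c" and z: "\<And>x. R \<le> norm x \<Longrightarrow> c x = 0" and e: "0 < e"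
  obtains d where "0 < d" "d \<le> 1" "\<And>x y. norm (x - y) < d \<Longrightarrow> norm (c x - c y) < e"
proof -
  have "uniformly_continuous_on (cball 0 (R + 1)) c"
    using c by (intro compact_uniformly_continuous) (auto intro: continuous_on_subset)
  then obtain d where d: "0 < d"
    "\<And>x y. x \<in> cball 0 (R + 1) \<Longrightarrow> y \<in> cball 0 (R + 1) \<Longrightarrow> dist x y < d \<Longrightarrow> dist (c x) (c y) < e"
    using e unfolding uniformly_continuous_on_def by metis
  show ?thesis
  \<comment> \<open>With the distance below 1, either both points have norm at least
    \<open>R\<close> and both values vanish, or both lie in the compact ball of radius
    \<open>R + 1\<close>.\<close>
  proof (rule that[of "min d 1"])
    fix x y :: 'a assume xy: "norm (x - y) < min d 1"
    have tri: "norm x \<le> norm y + norm (x - y)" "norm y \<le> norm x + norm (x - y)"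
      using norm_triangle_sub[of x y] norm_triangle_sub[of y x] by (simp_all add: norm_minus_commute)
    show "norm (c x - c y) < e"
    proof (cases "norm x \<ge> R \<and> norm y \<ge> R")
      case True
      then show ?thesis using z e by simp
    next
      case False
      then have "x \<in> cball 0 (R + 1)" "y \<in> cball 0 (R + 1)" using xy tri by auto
      then show ?thesis using d(2)[of x y] xy by (simp add: dist_norm)
    qed
  qed (use d in auto)
qed

lemma bounded_compact_support:
  fixes c :: "'a::euclidean_space \<Rightarrow> 'b::real_normed_vector"
  assumes c: "continuous_on UNIV c" and z: "\<And>x. R \<le> norm x \<Longrightarrow> c x = 0"
  obtains B where "0 \<le> B" "\<And>x. norm (c x) \<le> B"
proof -
  have "compact (c ` cball 0 R)"
    using c by (intro compact_continuous_image) (auto intro: continuous_on_subset)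
  then obtain B where B: "\<And>x. x \<in> cball 0 R \<Longrightarrow> norm (c x) \<le> B"
    by (meson bounded_iff compact_imp_bounded image_eqI)
  have "norm (c x) \<le> max 0 B" for x
    using B[of x] z[of x] by (cases "norm x \<le> R") auto
  then show ?thesis using that[of "max 0 B"] by auto
qed

text \<open>Mean value inequality on the segment from \<open>x\<close> to \<open>x + t\<close>, with
  the modulus of continuity of \<open>D\<phi>\<close> as the bound. That modulus is uniform, so one
  \<open>d\<close> serves all base points; differentiation under the integral sign rests on
  this.\<close>

lemma uniform_linearization:
  fixes \<phi> :: "'a::euclidean_space \<Rightarrow> real"
  assumes der: "\<And>x. (\<phi> has_derivative (\<lambda>h. D\<phi> x \<bullet> h)) (at x)" and c: "continuous_on UNIV D\<phi>"
    and z: "\<And>x. R \<le> norm x \<Longrightarrow> D\<phi> x = 0" and e: "0 < e"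
  obtains d where "0 < d" "\<And>x t. norm t < d \<Longrightarrow> \<bar>\<phi> (x + t) - \<phi> x - D\<phi> x \<bullet> t\<bar> \<le> e * norm t"
proof -
  obtain d where d: "0 < d" "\<And>x y. norm (x - y) < d \<Longrightarrow> norm (D\<phi> x - D\<phi> y) < e"
    using uniformly_continuous_compact_support[OF c z e] by metis
  show ?thesis
  proof (rule that[OF d(1)])
    fix x t :: 'a assume t: "norm t < d"
    have "norm (\<phi> (x + t) - \<phi> x - D\<phi> x \<bullet> (x + t - x)) \<le> norm (x + t - x) * e"
    proof (rule differentiable_bound_linearization[where S = "closed_segment x (x + t)" and f' = "\<lambda>x h. D\<phi> x \<bullet> h"])
      fix y assume y: "y \<in> closed_segment x (x + t)"
      show "(\<phi> has_derivative (\<bullet>) (D\<phi> y)) (at y within closed_segment x (x + t))"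
        using der has_derivative_at_withinI by blast
      have "norm (y - x) \<le> norm t"
        using segment_bound(1)[OF y] by simp
      then have "norm (D\<phi> y - D\<phi> x) \<le> e" using d(2)[of y x] t by simp
      then show "onorm ((\<bullet>) (D\<phi> y) - (\<bullet>) (D\<phi> x)) \<le> e"
        using e by (intro onorm_bound)
          (auto simp: inner_diff_left[symmetric] intro!: order_trans[OF Cauchy_Schwarz_ineq2] mult_right_mono)
    qed (auto simp: closed_segment_def algebra_simps)
    then show "\<bar>\<phi> (x + t) - \<phi> x - D\<phi> x \<bullet> t\<bar> \<le> e * norm t" by (simp add: mult.commute)
  qed
qed

lemma integrable_scaleR_bounded:
  fixes f :: "'a \<Rightarrow> real" and q :: "'a \<Rightarrow> 'b::euclidean_space"
  assumes [measurable]: "f \<in> borel_measurable M" and b: "\<And>x. \<bar>f x\<bar> \<le> C" and q: "integrable M q"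
  shows "integrable M (\<lambda>x. f x *\<^sub>R q x)"
proof (rule Bochner_Integration.integrable_bound)
  show "integrable M (\<lambda>x. C * norm (q x))" using q by auto
  show "(\<lambda>x. f x *\<^sub>R q x) \<in> borel_measurable M" using q by measurable
  show "AE x in M. norm (f x *\<^sub>R q x) \<le> norm (C * norm (q x))"
  proof (rule AE_I2)
    fix x
    have "\<bar>f x\<bar> * norm (q x) \<le> C * norm (q x)" using b by (intro mult_right_mono) auto
    then show "norm (f x *\<^sub>R q x) \<le> norm (C * norm (q x))" by simp
  qed
qed

lemma integrable_bounded_scaleR:
  fixes f :: "'a \<Rightarrow> 'b::euclidean_space" and q :: "'a \<Rightarrow> real"
  assumes [measurable]: "f \<in> borel_measurable M" and b: "\<And>x. norm (f x) \<le> C" and q: "integrable M q"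
  shows "integrable M (\<lambda>x. q x *\<^sub>R f x)"
proof (rule Bochner_Integration.integrable_bound)
  show "integrable M (\<lambda>x. C * norm (q x))" using q by auto
  show "(\<lambda>x. q x *\<^sub>R f x) \<in> borel_measurable M" using q by measurable
  show "AE x in M. norm (q x *\<^sub>R f x) \<le> norm (C * norm (q x))"
  proof (rule AE_I2)
    fix x
    have "\<bar>q x\<bar> * norm (f x) \<le> \<bar>q x\<bar> * C" using b by (intro mult_left_mono) auto
    also have "\<dots> \<le> \<bar>q x\<bar> * \<bar>C\<bar>" by (intro mult_left_mono) auto
    finally show "norm (q x *\<^sub>R f x) \<le> norm (C * norm (q x))" by (simp add: abs_mult mult.commute)
  qed
qed

lemma norm_integral_le_integral:
  fixes f :: "'a \<Rightarrow> 'b::{banach, second_countable_topology}"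
  assumes "integrable M f" "integrable M g" "\<And>x. norm (f x) \<le> g x"
  shows "norm (integral\<^sup>L M f) \<le> integral\<^sup>L M g"
  using integral_norm_bound[of M f] integral_mono[OF integrable_norm[OF assms(1)] assms(2,3)]
  by (rule order_trans)

text \<open>All smoothness sits in the kernel. Its linearization error at \<open>x - y\<close> is at
  most \<open>e' * norm (w - x)\<close> for every \<open>y\<close>, so integration against
  \<open>q\<close> leaves an error of \<open>e' * N * norm (w - x)\<close>, with \<open>N\<close>
  the L1 norm of \<open>q\<close>. Dividing \<open>e\<close> by \<open>N + 1\<close> covers
  \<open>N = 0\<close>.\<close>

lemma convolution_has_derivative:
  fixes q :: "'a::euclidean_space \<Rightarrow> real"
  assumes q: "integrable lborel q"
    and der: "\<And>x. (\<phi> has_derivative (\<lambda>h. D\<phi> x \<bullet> h)) (at x)" and c: "continuous_on UNIV D\<phi>"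
    and z: "\<And>x. R \<le> norm x \<Longrightarrow> \<phi> x = 0" "\<And>x. R \<le> norm x \<Longrightarrow> D\<phi> x = 0"
  shows "((\<lambda>x. LINT y|lborel. \<phi> (x - y) * q y) has_derivative
     (\<lambda>t. (LINT y|lborel. q y *\<^sub>R D\<phi> (x - y)) \<bullet> t)) (at x)"
  unfolding has_derivative_at_alt
proof (intro conjI allI impI)
  show "bounded_linear ((\<bullet>) (LINT y|lborel. q y *\<^sub>R D\<phi> (x - y)))" by (rule bounded_linear_inner_right)
  have c\<phi>: "continuous_on UNIV \<phi>"
    by (rule has_derivative_continuous_on) (rule der)
  have [measurable]: "\<phi> \<in> borel_measurable borel" "D\<phi> \<in> borel_measurable borel"
    using c c\<phi> by (auto intro: borel_measurable_continuous_onI)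
  obtain B1 where B1: "\<And>x. norm (\<phi> x) \<le> B1" using bounded_compact_support[OF c\<phi> z(1)] by metis
  obtain B2 where B2: "\<And>x. norm (D\<phi> x) \<le> B2" using bounded_compact_support[OF c z(2)] by metis
  have i1: "integrable lborel (\<lambda>y. \<phi> (w - y) * q y)" for w
    using integrable_scaleR_bounded[of "\<lambda>y. \<phi> (w - y)" lborel B1 q] B1 q by simp
  have i2: "integrable lborel (\<lambda>y. q y *\<^sub>R D\<phi> (w - y))" for w
    using integrable_bounded_scaleR[of "\<lambda>y. D\<phi> (w - y)" lborel B2 q] B2 q by simp
  define N where "N = (LINT y|lborel. \<bar>q y\<bar>)"
  have N: "0 \<le> N" unfolding N_def by (intro integral_nonneg_AE) auto
  fix e :: real assume e: "0 < e"
  define e' where "e' = e / (N + 1)"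
  have e': "0 < e'" using e N by (simp add: e'_def)
  obtain d where d: "0 < d" "\<And>x t. norm t < d \<Longrightarrow> \<bar>\<phi> (x + t) - \<phi> x - D\<phi> x \<bullet> t\<bar> \<le> e' * norm t"
    using uniform_linearization[OF der c z(2) e'] by metis
  show "\<exists>d>0. \<forall>y. norm (y - x) < d \<longrightarrow>
    norm ((LINT ya|lborel. \<phi> (y - ya) * q ya) - (LINT y|lborel. \<phi> (x - y) * q y) -
       (LINT y|lborel. q y *\<^sub>R D\<phi> (x - y)) \<bullet> (y - x)) \<le> e * norm (y - x)"
  proof (intro exI[of _ d] conjI allI impI)
    fix w assume w: "norm (w - x) < d"
    have "(LINT y|lborel. \<phi> (w - y) * q y) - (LINT y|lborel. \<phi> (x - y) * q y) -
       (LINT y|lborel. q y *\<^sub>R D\<phi> (x - y)) \<bullet> (w - x) =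
       (LINT y|lborel. \<phi> (w - y) * q y - \<phi> (x - y) * q y - (q y *\<^sub>R D\<phi> (x - y)) \<bullet> (w - x))"
      using i1 i2 by (simp del: inner_scaleR_left)
    also have "norm \<dots> \<le> (LINT y|lborel. (e' * norm (w - x)) * \<bar>q y\<bar>)"
    proof (rule norm_integral_le_integral)
      fix y
      have eq: "\<phi> (w - y) * q y - \<phi> (x - y) * q y - (q y *\<^sub>R D\<phi> (x - y)) \<bullet> (w - x)
        = (\<phi> ((x - y) + (w - x)) - \<phi> (x - y) - D\<phi> (x - y) \<bullet> (w - x)) * q y"
        by (simp add: algebra_simps)
      show "norm (\<phi> (w - y) * q y - \<phi> (x - y) * q y - (q y *\<^sub>R D\<phi> (x - y)) \<bullet> (w - x))
        \<le> (e' * norm (w - x)) * \<bar>q y\<bar>"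
        unfolding eq real_norm_def abs_mult using d(2)[OF w, of "x - y"] by (intro mult_right_mono) auto
    qed (use i1 i2 q in \<open>auto simp del: inner_scaleR_left\<close>)
    also have "\<dots> = e' * N * norm (w - x)" using q by (simp add: N_def)
    also have "\<dots> \<le> e * norm (w - x)"
      using e N by (intro mult_right_mono) (auto simp: e'_def field_simps)
    finally show "norm ((LINT ya|lborel. \<phi> (w - ya) * q ya) - (LINT y|lborel. \<phi> (x - y) * q y) -
       (LINT y|lborel. q y *\<^sub>R D\<phi> (x - y)) \<bullet> (w - x)) \<le> e * norm (w - x)" .
  qed (rule d)
qed

lemma convolution_continuous:
  fixes q :: "'a::euclidean_space \<Rightarrow> real" and F :: "'a \<Rightarrow> 'b::euclidean_space"
  assumes q: "integrable lborel q" and c: "continuous_on UNIV F"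
    and z: "\<And>x. R \<le> norm x \<Longrightarrow> F x = 0"
  shows "continuous_on UNIV (\<lambda>x. LINT y|lborel. q y *\<^sub>R F (x - y))"
  unfolding continuous_on_iff
proof (intro ballI allI impI)
  fix x :: 'a and e :: real assume e: "0 < e"
  have [measurable]: "F \<in> borel_measurable borel"
    using c by (auto intro: borel_measurable_continuous_onI)
  obtain B where B: "\<And>x. norm (F x) \<le> B" using bounded_compact_support[OF c z] by metis
  have i: "integrable lborel (\<lambda>y. q y *\<^sub>R F (w - y))" for w
    using integrable_bounded_scaleR[of "\<lambda>y. F (w - y)" lborel B q] B q by simp
  define N where "N = (LINT y|lborel. \<bar>q y\<bar>)"
  have N: "0 \<le> N" unfolding N_def by (intro integral_nonneg_AE) auto
  define e' where "e' = e / (N + 1)"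
  have e': "0 < e'" using e N by (simp add: e'_def)
  obtain d where d: "0 < d" "\<And>x y. norm (x - y) < d \<Longrightarrow> norm (F x - F y) < e'"
    using uniformly_continuous_compact_support[OF c z e'] by metis
  show "\<exists>d>0. \<forall>x'\<in>UNIV. dist x' x < d \<longrightarrow>
      dist (LINT y|lborel. q y *\<^sub>R F (x' - y)) (LINT y|lborel. q y *\<^sub>R F (x - y)) < e"
  proof (intro exI[of _ d] conjI ballI impI)
    fix w assume w: "dist w x < d"
    have "(LINT y|lborel. q y *\<^sub>R F (w - y)) - (LINT y|lborel. q y *\<^sub>R F (x - y))
      = (LINT y|lborel. q y *\<^sub>R F (w - y) - q y *\<^sub>R F (x - y))" using i by simp
    also have "norm \<dots> \<le> (LINT y|lborel. \<bar>q y\<bar> * e')"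
    proof (rule norm_integral_le_integral)
      fix y
      have "norm (F (w - y) - F (x - y)) < e'" using d(2)[of "w - y" "x - y"] w by (simp add: dist_norm)
      then show "norm (q y *\<^sub>R F (w - y) - q y *\<^sub>R F (x - y)) \<le> \<bar>q y\<bar> * e'"
        by (simp add: scaleR_diff_right[symmetric] mult_left_mono)
    qed (use i q in auto)
    also have "\<dots> = N * e'" using q by (simp add: N_def)
    also have "\<dots> < e" using e N by (auto simp: e'_def field_simps)
    finally show "dist (LINT y|lborel. q y *\<^sub>R F (w - y)) (LINT y|lborel. q y *\<^sub>R F (x - y)) < e"
      by (simp add: dist_norm)
  qed (rule d)
qed

text \<open>Convolving with the indicator of a large ball is constant near the origin,
  hence has derivative zero there.\<close>

lemma integral_gradient_compact_support:
  fixes \<phi> :: "'a::euclidean_space \<Rightarrow> real"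
  assumes der: "\<And>x. (\<phi> has_derivative (\<lambda>h. D\<phi> x \<bullet> h)) (at x)" and c: "continuous_on UNIV D\<phi>"
    and z: "\<And>x. R \<le> norm x \<Longrightarrow> \<phi> x = 0" "\<And>x. R \<le> norm x \<Longrightarrow> D\<phi> x = 0"
  shows "(LINT x|lborel. D\<phi> x) = 0"
proof -
  define q :: "'a \<Rightarrow> real" where "q = indicator (ball 0 (R + 1))"
  have q: "integrable lborel q"
    unfolding q_def by (rule integrable_real_indicator) (auto simp: emeasure_lborel_ball_finite[unfolded infinity_ennreal_def])
  have c\<phi>: "continuous_on UNIV \<phi>"
    by (rule has_derivative_continuous_on) (rule der)
  have [measurable]: "\<phi> \<in> borel_measurable borel" "D\<phi> \<in> borel_measurable borel"
    using c c\<phi> by (auto intro: borel_measurable_continuous_onI)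
  have inside: "y \<in> ball 0 (R + 1)" if "norm (x - y) < R" "norm x < 1" for x y :: 'a
    using that norm_triangle_sub[of y x] by (simp add: norm_minus_commute)
  have const: "(LINT y|lborel. \<phi> (x - y) * q y) = (LINT y|lborel. \<phi> y)" if "norm x < 1" for x
  proof -
    have "\<phi> (x - y) * q y = \<phi> (x - y)" for y
      using inside[of x y] that z(1)[of "x - y"] by (cases "R \<le> norm (x - y)") (auto simp: q_def)
    then show ?thesis by (simp only: integral_lborel_reflect \<open>\<phi> \<in> borel_measurable borel\<close>)
  qed
  have "((\<lambda>x. LINT y|lborel. \<phi> (x - y) * q y) has_derivative
     (\<lambda>t. (LINT y|lborel. q y *\<^sub>R D\<phi> (0 - y)) \<bullet> t)) (at 0)"
    by (rule convolution_has_derivative[OF q der c z])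
  moreover have "((\<lambda>x. LINT y|lborel. \<phi> (x - y) * q y) has_derivative (\<lambda>t. 0)) (at 0)"
    by (rule has_derivative_transform_within_open[OF has_derivative_const open_ball[of 0 1]])
      (use const in auto)
  ultimately have "(\<lambda>t. (LINT y|lborel. q y *\<^sub>R D\<phi> (0 - y)) \<bullet> t) = (\<lambda>t. 0)"
    by (rule has_derivative_unique)
  then have "(LINT y|lborel. q y *\<^sub>R D\<phi> (0 - y)) = 0"
    by (metis inner_eq_zero_iff)
  moreover have "q y *\<^sub>R D\<phi> (0 - y) = D\<phi> (0 - y)" for y
    using inside[of 0 y] z(2)[of "0 - y"] by (cases "R \<le> norm (0 - y)") (auto simp: q_def)
  ultimately show ?thesis by (simp only: integral_lborel_reflect[OF \<open>D\<phi> \<in> borel_measurable borel\<close>])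
qed

subsection \<open>Mollification in \<open>L\<^sup>p\<close>\<close>

lemma lebesgue_approx_continuous:
  fixes f :: "'a::euclidean_space \<Rightarrow> 'b::euclidean_space"
  assumes "f \<in> borel_measurable lebesgue"
  obtains g where "\<And>n. continuous_on UNIV (g n)" "AE x in lborel. (\<lambda>n::nat. g n x) \<longlonglongrightarrow> f x"
proof -
  have "f measurable_on UNIV" using assms by (intro lebesgue_measurable_imp_measurable_on) auto
  then obtain N g where N: "negligible N" and g: "\<And>n. continuous_on UNIV (g n)"
    and lim: "\<And>x. x \<notin> N \<Longrightarrow> (\<lambda>n. g n x) \<longlonglongrightarrow> f x"
    unfolding measurable_on_def by auto
  have "AE x in lebesgue. x \<notin> N"
    using N by (intro AE_not_in) (simp add: negligible_iff_null_sets)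
  then have "AE x in lborel. x \<notin> N" by (simp add: AE_completion_iff)
  then have "AE x in lborel. (\<lambda>n. g n x) \<longlonglongrightarrow> f x" by eventually_elim (rule lim)
  then show ?thesis by (rule that[OF g])
qed

text \<open>Off a Borel null set the function is a pointwise limit of continuous functions; on the
  null set it is reset to 0. Reflection, translation and Fubini on \<open>lborel\<close> are applied
  to Borel functions, hence the change of representative. Keeping the zeros keeps the
  support.\<close>

lemma lebesgue_borel_representative:
  fixes f :: "'a::euclidean_space \<Rightarrow> 'b::euclidean_space"
  assumes "f \<in> borel_measurable lebesgue"
  obtains f' where "f' \<in> borel_measurable borel" "AE x in lborel. f' x = f x"
    "\<And>x. f x = 0 \<Longrightarrow> f' x = 0"
proof -
  obtain g where g: "\<And>n. continuous_on UNIV (g n)" and lim: "AE x in lborel. (\<lambda>n::nat. g n x) \<longlonglongrightarrow> f x"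
    using lebesgue_approx_continuous[OF assms] by metis
  obtain N where N: "N \<in> null_sets lborel" "{x \<in> space lborel. \<not> (\<lambda>n::nat. g n x) \<longlonglongrightarrow> f x} \<subseteq> N"
    using lim by (auto elim: AE_E simp: null_sets_def)
  have [measurable]: "N \<in> sets borel" using N by auto
  have [measurable]: "g n \<in> borel_measurable borel" for n
    using g by (auto intro: borel_measurable_continuous_onI)
  show ?thesis
  proof (rule that[of "\<lambda>x. if x \<in> N then 0 else f x"])
    show "(\<lambda>x. if x \<in> N then 0 else f x) \<in> borel_measurable borel"
    proof (rule borel_measurable_LIMSEQ_metric)
      fix x
      show "(\<lambda>n. if x \<in> N then 0 else g n x) \<longlonglongrightarrow> (if x \<in> N then 0 else f x)"
        using N by auto
    qed measurable
    show "AE x in lborel. (if x \<in> N then 0 else f x) = f x"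
      using AE_not_in[OF N(1)] by (auto elim: eventually_mono)
  qed auto
qed

text \<open>The map is the radial retraction onto the closed ball of radius \<open>N\<close>. Being
  continuous, it can be applied to continuous approximants without losing continuity; the second
  estimate provides the dominating function as \<open>N\<close> grows.\<close>

lemma ball_truncation:
  fixes y :: "'b::euclidean_space" and N :: real
  assumes N: "0 < N"
  shows "norm ((N / max N (norm y)) *\<^sub>R y) \<le> N"
    and "norm (y - (N / max N (norm y)) *\<^sub>R y) \<le> norm y"
    and "norm y \<le> N \<Longrightarrow> (N / max N (norm y)) *\<^sub>R y = y"
proof -
  have m: "0 < max N (norm y)" using N by simp
  show "norm ((N / max N (norm y)) *\<^sub>R y) \<le> N"
    using N m by (auto simp: divide_simps max_def)
  have "y - (N / max N (norm y)) *\<^sub>R y = (1 - N / max N (norm y)) *\<^sub>R y" by (simp add: algebra_simps)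
  moreover have "\<bar>1 - N / max N (norm y)\<bar> \<le> 1" using N m by (auto simp: divide_simps)
  ultimately show "norm (y - (N / max N (norm y)) *\<^sub>R y) \<le> norm y"
    by (simp add: mult_left_le_one_le)
  show "norm y \<le> N \<Longrightarrow> (N / max N (norm y)) *\<^sub>R y = y" using N by (simp add: max_def)
qed

text \<open>Continuous functions converging almost everywhere to \<open>q\<close> need not be
  dominated by anything integrable. Retracting values to the ball of radius \<open>N\<close> and
  multiplying by the cut-off \<open>\<theta>\<close> bounds both values and supports, so that
  dominated convergence applies. The remaining error, from retracting \<open>q\<close> itself, is
  small for large \<open>N\<close>.\<close>

lemma continuous_compact_support_dense_Lp:
  fixes q :: "'a::euclidean_space \<Rightarrow> 'b::euclidean_space" and e :: real
  assumes [measurable]: "q \<in> borel_measurable borel" and z: "\<And>x. R < norm x \<Longrightarrow> q x = 0"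
    and fin: "(\<integral>\<^sup>+ x. ennreal (norm (q x) powr p) \<partial>lborel) < \<infinity>" and p: "1 \<le> p" and e: "0 < e"
  obtains c where "continuous_on UNIV c" "\<And>x. R + 1 \<le> norm x \<Longrightarrow> c x = 0"
    "(\<integral>\<^sup>+ x. ennreal (norm (q x - c x) powr p) \<partial>lborel) < ennreal e"
proof -
  have "q \<in> borel_measurable lebesgue" by (simp add: borel_measurable_if_I measurable_completion)
  then obtain g where g: "\<And>n. continuous_on UNIV (g n)" and lim: "AE x in lborel. (\<lambda>n::nat. g n x) \<longlonglongrightarrow> q x"
    using lebesgue_approx_continuous by metis
  have [measurable]: "g n \<in> borel_measurable borel" for n
    using g by (auto intro: borel_measurable_continuous_onI)
  define T :: "real \<Rightarrow> 'b \<Rightarrow> 'b" where "T N y = (N / max N (norm y)) *\<^sub>R y" for N y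
  have [measurable]: "T N \<in> borel_measurable borel" for N unfolding T_def by measurable
  \<comment> \<open>Two errors of size \<open>e'\<close>, each multiplied by the constant
    \<open>2 powr p\<close> of the quasi-triangle inequality, add up to \<open>e\<close>.\<close>
  define e' where "e' = e / (2 * 2 powr p)"
  have e': "0 < e'" using e by (simp add: e'_def)
  have "(\<lambda>N. \<integral>\<^sup>+ x. ennreal (norm (q x - T (real (Suc N)) (q x)) powr p) \<partial>lborel) \<longlonglongrightarrow> (\<integral>\<^sup>+ x. 0 \<partial>(lborel::'a measure))"
  proof (rule nn_integral_dominated_convergence[where w = "\<lambda>x. ennreal (norm (q x) powr p)"])
    fix j
    show "AE x in lborel. ennreal (norm (q x - T (real (Suc j)) (q x)) powr p) \<le> ennreal (norm (q x) powr p)"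
      using p ball_truncation(2)[of "real (Suc j)"] by (intro AE_I2 ennreal_leI powr_mono2) (auto simp: T_def)
  next
    show "AE x in lborel. (\<lambda>i. ennreal (norm (q x - T (real (Suc i)) (q x)) powr p)) \<longlonglongrightarrow> 0"
    proof (rule AE_I2)
      fix x
      have "\<forall>\<^sub>F i in sequentially. ennreal (norm (q x - T (real (Suc i)) (q x)) powr p) = 0"
      proof (rule eventually_sequentiallyI[of "nat \<lceil>norm (q x)\<rceil>"])
        fix i assume "nat \<lceil>norm (q x)\<rceil> \<le> i"
        then have "norm (q x) \<le> real (Suc i)" by linarith
        then have "T (real (Suc i)) (q x) = q x"
          unfolding T_def by (intro ball_truncation(3)) auto
        then show "ennreal (norm (q x - T (real (Suc i)) (q x)) powr p) = 0" using p by simp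
      qed
      then show "(\<lambda>i. ennreal (norm (q x - T (real (Suc i)) (q x)) powr p)) \<longlonglongrightarrow> 0"
        by (rule tendsto_eventually)
    qed
  qed (use fin in auto)
  then have "\<forall>\<^sub>F N in sequentially. (\<integral>\<^sup>+ x. ennreal (norm (q x - T (real (Suc N)) (q x)) powr p) \<partial>lborel) < ennreal e'"
    using e' by (intro order_tendstoD) auto
  then obtain N0 where N0: "(\<integral>\<^sup>+ x. ennreal (norm (q x - T (real (Suc N0)) (q x)) powr p) \<partial>lborel) < ennreal e'"
    using eventually_happens'[OF sequentially_bot] by blast
  define N where "N = real (Suc N0)"
  have N: "0 < N" by (simp add: N_def)
  define \<theta> :: "'a \<Rightarrow> real" where "\<theta> x = max 0 (min 1 (R + 1 - norm x))" for x
  have \<theta>: "0 \<le> \<theta> x" "\<theta> x \<le> 1" for x by (auto simp: \<theta>_def)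
  have [measurable]: "\<theta> \<in> borel_measurable borel" unfolding \<theta>_def by measurable
  define c where "c n x = \<theta> x *\<^sub>R T N (g n x)" for n x
  have m0: "max N t \<noteq> 0" for t using N by auto
  have contc: "continuous_on UNIV (c n)" for n
    unfolding c_def \<theta>_def T_def by (intro continuous_intros g ballI m0)
  have [measurable]: "c n \<in> borel_measurable borel" for n unfolding c_def by measurable
  have Tqm: "(\<lambda>x. T N (q x)) \<in> borel_measurable borel" by measurable
  have diffm: "(\<lambda>x. ennreal (norm (T N (q x) - c n x) powr p)) \<in> borel_measurable borel" for n
    by (intro measurable_compose[OF _ measurable_ennreal] powr_real_measurable borel_measurable_const
      borel_measurable_norm borel_measurable_diff Tqm) measurable
  have c0: "c n x = 0" if "R + 1 \<le> norm x" for n x using that by (simp add: c_def \<theta>_def)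
  \<comment> \<open>The cut-off is invisible on the limit: \<open>\<theta>\<close> is 1 up to radius
    \<open>R\<close>, and \<open>q\<close> vanishes beyond it.\<close>
  have Tq: "T N (q x) = \<theta> x *\<^sub>R T N (q x)" for x
  proof (cases "R < norm x")
    case True
    then show ?thesis using z[of x] by (simp add: T_def)
  next
    case False
    then show ?thesis by (simp add: \<theta>_def)
  qed
  have "(\<lambda>n. \<integral>\<^sup>+ x. ennreal (norm (T N (q x) - c n x) powr p) \<partial>lborel) \<longlonglongrightarrow> (\<integral>\<^sup>+ x. 0 \<partial>(lborel::'a measure))"
  proof (rule nn_integral_dominated_convergence[where w = "\<lambda>x. ennreal ((2 * N) powr p) * indicator (cball 0 (R + 1)) x"])
    fix j
    show "AE x in lborel. ennreal (norm (T N (q x) - c j x) powr p) \<le> ennreal ((2 * N) powr p) * indicator (cball 0 (R + 1)) x"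
    proof (rule AE_I2)
      fix x
      show "ennreal (norm (T N (q x) - c j x) powr p) \<le> ennreal ((2 * N) powr p) * indicator (cball 0 (R + 1)) x"
      proof (cases "norm x \<le> R + 1")
        case True
        have "norm (T N (q x)) \<le> N" "norm (T N (g j x)) \<le> N"
          using ball_truncation(1)[OF N] by (auto simp: T_def)
        moreover have "norm (c j x) \<le> norm (T N (g j x))"
          using \<theta>[of x] by (simp add: c_def mult_left_le_one_le)
        ultimately have "norm (T N (q x) - c j x) \<le> 2 * N"
          using norm_triangle_ineq4[of "T N (q x)" "c j x"] by linarith
        then show ?thesis using True p by (auto intro!: ennreal_leI powr_mono2)
      next
        case False
        then show ?thesis using c0[of x j] z[of x] p by (simp add: T_def)
      qed
    qed
  next
    show "(\<integral>\<^sup>+ x. ennreal ((2 * N) powr p) * indicator (cball 0 (R + 1)) x \<partial>(lborel::'a measure)) < \<infinity>"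
      using emeasure_lborel_cball_finite[of "0::'a" "R + 1"]
      by (simp add: nn_integral_cmult_indicator ennreal_mult_less_top)
    show "AE x in lborel. (\<lambda>i. ennreal (norm (T N (q x) - c i x) powr p)) \<longlonglongrightarrow> 0"
      using lim
    proof (rule AE_mp, intro AE_I2 impI)
      fix x assume l: "(\<lambda>n. g n x) \<longlonglongrightarrow> q x"
      have "(\<lambda>i. norm (T N (q x) - c i x) powr p) \<longlonglongrightarrow> norm (T N (q x) - \<theta> x *\<^sub>R T N (q x)) powr p"
        unfolding c_def T_def using p by (intro tendsto_intros l m0) auto
      also have "norm (T N (q x) - \<theta> x *\<^sub>R T N (q x)) powr p = 0" using Tq[of x] p by simp
      finally show "(\<lambda>i. ennreal (norm (T N (q x) - c i x) powr p)) \<longlonglongrightarrow> 0"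
        by (metis ennreal_0 tendsto_ennrealI)
    qed
  next
    show "(\<lambda>x. ennreal (norm (T N (q x) - c i x) powr p)) \<in> borel_measurable lborel" for i
      using diffm[of i] by simp
    show "(\<lambda>x. ennreal ((2 * N) powr p) * indicator (cball 0 (R + 1)) x) \<in> borel_measurable (lborel::'a measure)"
      by (intro borel_measurable_times_ennreal borel_measurable_const borel_measurable_indicator) simp
  qed simp
  then have "\<forall>\<^sub>F n in sequentially. (\<integral>\<^sup>+ x. ennreal (norm (T N (q x) - c n x) powr p) \<partial>lborel) < ennreal e'"
    using e' by (intro order_tendstoD) auto
  then obtain n where n: "(\<integral>\<^sup>+ x. ennreal (norm (T N (q x) - c n x) powr p) \<partial>lborel) < ennreal e'"
    using eventually_happens'[OF sequentially_bot] by blast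
  show ?thesis
  proof (rule that[OF contc c0])
    have "(\<integral>\<^sup>+ x. ennreal (norm (q x - c n x) powr p) \<partial>lborel) \<le>
      (\<integral>\<^sup>+ x. ennreal (2 powr p) * (ennreal (norm (q x - T N (q x)) powr p) + ennreal (norm (T N (q x) - c n x) powr p)) \<partial>lborel)"
    proof (rule nn_integral_mono)
      fix x
      have "norm (q x - c n x) powr p \<le> (norm (q x - T N (q x)) + norm (T N (q x) - c n x)) powr p"
        using p norm_triangle_ineq[of "q x - T N (q x)" "T N (q x) - c n x"] by (intro powr_mono2) auto
      also have "\<dots> \<le> 2 powr p * (norm (q x - T N (q x)) powr p + norm (T N (q x) - c n x) powr p)"
        using p by (intro add_powr_le) auto
      finally show "ennreal (norm (q x - c n x) powr p) \<le>
        ennreal (2 powr p) * (ennreal (norm (q x - T N (q x)) powr p) + ennreal (norm (T N (q x) - c n x) powr p))"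
        by (simp add: ennreal_mult[symmetric] ennreal_plus[symmetric] ennreal_leI del: ennreal_plus)
    qed
    also have "\<dots> = ennreal (2 powr p) * ((\<integral>\<^sup>+ x. ennreal (norm (q x - T N (q x)) powr p) \<partial>lborel) + (\<integral>\<^sup>+ x. ennreal (norm (T N (q x) - c n x) powr p) \<partial>lborel))"
      by (subst nn_integral_cmult) (auto simp: nn_integral_add)
    also have "\<dots> < ennreal (2 powr p) * (ennreal e' + ennreal e')"
      using N0 n by (intro ennreal_mult_strict_left_mono add_strict_mono) (auto simp: N_def)
    also have "\<dots> = ennreal e"
      using e' by (simp add: ennreal_mult[symmetric] ennreal_plus[symmetric] e'_def del: ennreal_plus)
    finally show "(\<integral>\<^sup>+ x. ennreal (norm (q x - c n x) powr p) \<partial>lborel) < ennreal e" .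
  qed
qed

text \<open>A continuous function of bounded support moves uniformly little under a small shift, on
  a fixed ball. The error of replacing \<open>q\<close> by such a function is the same before and
  after the shift, since the measure is translation invariant.\<close>

lemma translation_continuous_Lp:
  fixes q :: "'a::euclidean_space \<Rightarrow> 'b::euclidean_space" and e :: real
  assumes [measurable]: "q \<in> borel_measurable borel" and z: "\<And>x. R < norm x \<Longrightarrow> q x = 0"
    and fin: "(\<integral>\<^sup>+ x. ennreal (norm (q x) powr p) \<partial>lborel) < \<infinity>" and p: "1 \<le> p" and e: "0 < e"
  obtains d where "0 < d"
    "\<And>y. norm y < d \<Longrightarrow> (\<integral>\<^sup>+ x. ennreal (norm (q (x - y) - q x) powr p) \<partial>lborel) \<le> ennreal e"
proof -
  \<comment> \<open>Three error terms; \<open>4 powr p\<close> comes from using the quasi-triangle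
    inequality twice.\<close>
  define e1 where "e1 = e / (3 * 4 powr p)"
  have e1: "0 < e1" using e by (simp add: e1_def)
  obtain c where c: "continuous_on UNIV c" "\<And>x. R + 1 \<le> norm x \<Longrightarrow> c x = 0"
    and qc: "(\<integral>\<^sup>+ x. ennreal (norm (q x - c x) powr p) \<partial>lborel) < ennreal e1"
    using continuous_compact_support_dense_Lp[OF assms(1-4) e1] by metis
  have [measurable]: "c \<in> borel_measurable borel"
    using c by (auto intro: borel_measurable_continuous_onI)
  \<comment> \<open>The approximant vanishes from radius \<open>R + 1\<close> on and shifts are
    shorter than 1, so the shifted difference lives in this ball; \<open>e2\<close> below is chosen
    with \<open>e2 powr p * m \<le> e1\<close>.\<close>
  define m where "m = measure lborel (cball (0::'a) (R + 2))"
  have m: "emeasure lborel (cball (0::'a) (R + 2)) = ennreal m" "0 \<le> m"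
    using emeasure_lborel_cball_finite[of "0::'a" "R + 2"] by (auto simp: m_def emeasure_eq_ennreal_measure)
  define e2 where "e2 = (e1 / (m + 1)) powr (1 / p)"
  have e2: "0 < e2" using e1 m by (simp add: e2_def)
  have e2': "e2 powr p * m \<le> e1"
  proof -
    have "e2 powr p * m \<le> e2 powr p * (m + 1)" by (intro mult_left_mono) auto
    also have "\<dots> = e1" using e1 m p by (simp add: e2_def powr_powr)
    finally show ?thesis .
  qed
  obtain d where d: "0 < d" "d \<le> 1" "\<And>x y. norm (x - y) < d \<Longrightarrow> norm (c x - c y) < e2"
    using uniformly_continuous_compact_support[OF c e2] by metis
  show ?thesis
  proof (rule that[OF d(1)])
    fix y :: 'a assume y: "norm y < d"
    let ?A = "\<lambda>x. ennreal (norm (q (x - y) - c (x - y)) powr p)"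
    let ?B = "\<lambda>x. ennreal (norm (c (x - y) - c x) powr p)"
    let ?C = "\<lambda>x. ennreal (norm (q x - c x) powr p)"
    have "(\<integral>\<^sup>+ x. ennreal (norm (q (x - y) - q x) powr p) \<partial>lborel) \<le> (\<integral>\<^sup>+ x. ennreal (4 powr p) * (?A x + (?B x + ?C x)) \<partial>lborel)"
    proof (rule nn_integral_mono)
      fix x
      define a b d where abd: "a = norm (q (x - y) - c (x - y))" "b = norm (c (x - y) - c x)" "d = norm (q x - c x)"
      have pos: "0 \<le> a" "0 \<le> b" "0 \<le> d" by (auto simp: abd)
      have "norm (q (x - y) - q x) \<le> a + (b + d)"
        unfolding abd using norm_triangle_ineq[of "q (x - y) - c (x - y)" "c (x - y) - c x + (c x - q x)"]
          norm_triangle_ineq[of "c (x - y) - c x" "c x - q x"] by (simp add: norm_minus_commute)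
      then have "norm (q (x - y) - q x) powr p \<le> (a + (b + d)) powr p"
        using p by (intro powr_mono2) auto
      also have "\<dots> \<le> 2 powr p * (a powr p + (b + d) powr p)"
        using p pos by (intro add_powr_le) auto
      also have "\<dots> \<le> 2 powr p * (2 powr p * a powr p + 2 powr p * (b powr p + d powr p))"
      proof (intro mult_left_mono add_mono)
        have "1 \<le> (2::real) powr p" using p by (simp add: ge_one_powr_ge_zero)
        then show "a powr p \<le> 2 powr p * a powr p" using mult_right_mono[of 1 "2 powr p" "a powr p"] by simp
        show "(b + d) powr p \<le> 2 powr p * (b powr p + d powr p)"
          using p pos by (intro add_powr_le) auto
      qed auto
      also have "\<dots> = 4 powr p * (a powr p + (b powr p + d powr p))"
        using powr_mult[of 2 2 p] by (simp add: algebra_simps)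
      finally show "ennreal (norm (q (x - y) - q x) powr p) \<le> ennreal (4 powr p) * (?A x + (?B x + ?C x))"
        unfolding abd by (simp add: ennreal_mult[symmetric] ennreal_plus[symmetric] ennreal_leI del: ennreal_plus)
    qed
    also have "\<dots> = ennreal (4 powr p) * ((\<integral>\<^sup>+ x. ?A x \<partial>lborel) + ((\<integral>\<^sup>+ x. ?B x \<partial>lborel) + (\<integral>\<^sup>+ x. ?C x \<partial>lborel)))"
      by (subst nn_integral_cmult) (auto simp: nn_integral_add)
    also have "\<dots> \<le> ennreal (4 powr p) * (ennreal e1 + (ennreal e1 + ennreal e1))"
    proof (intro mult_left_mono add_mono)
      show "(\<integral>\<^sup>+ x. ?C x \<partial>lborel) \<le> ennreal e1" using qc by simp
      show "(\<integral>\<^sup>+ x. ?A x \<partial>lborel) \<le> ennreal e1"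
        using qc by (subst nn_integral_lborel_translate[of "\<lambda>x. ennreal (norm (q x - c x) powr p)"]) auto
      have "(\<integral>\<^sup>+ x. ?B x \<partial>lborel) \<le> (\<integral>\<^sup>+ x. ennreal (e2 powr p) * indicator (cball 0 (R + 2)) x \<partial>(lborel::'a measure))"
      proof (rule nn_integral_mono)
        fix x
        show "?B x \<le> ennreal (e2 powr p) * indicator (cball 0 (R + 2)) x"
        proof (cases "norm x \<le> R + 2")
          case True
          have "norm (c (x - y) - c x) \<le> e2" using d(3)[of "x - y" x] y by simp
          then show ?thesis using True p by (auto intro!: ennreal_leI powr_mono2)
        next
          case False
          then have "c x = 0" "c (x - y) = 0"
            using y d norm_triangle_ineq2[of x y] by (auto intro!: c(2))
          then show ?thesis using p by simp
        qed
      qed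
      also have "\<dots> = ennreal (e2 powr p) * ennreal m" by (simp add: nn_integral_cmult_indicator m)
      also have "\<dots> \<le> ennreal e1" using e2' m(2) by (simp add: ennreal_mult[symmetric] ennreal_leI)
      finally show "(\<integral>\<^sup>+ x. ?B x \<partial>lborel) \<le> ennreal e1" .
    qed auto
    also have "\<dots> = ennreal e"
      using e1 by (simp add: ennreal_mult[symmetric] ennreal_plus[symmetric] e1_def del: ennreal_plus)
    finally show "(\<integral>\<^sup>+ x. ennreal (norm (q (x - y) - q x) powr p) \<partial>lborel) \<le> ennreal e" .
  qed
qed

text \<open>The mollification error at \<open>x\<close> is an average of
  \<open>q (x - y) - q x\<close> with respect to the probability density \<rho>. Jensen's inequality
  followed by an exchange of integrals bounds its p-th power integral by an average of translation
  errors, all at most \<open>e\<close>.\<close>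

lemma mollification_Lp_le:
  fixes q :: "'a::euclidean_space \<Rightarrow> 'b::euclidean_space"
  assumes q: "integrable lborel q"
    and \<rho>: "integrable lborel \<rho>" "(LINT x|lborel. \<rho> x) = 1" "\<And>x. 0 \<le> \<rho> x" "\<And>x. \<rho> x \<le> B"
      "\<And>x. r \<le> norm x \<Longrightarrow> \<rho> x = 0"
    and p: "1 < p"
    and T: "\<And>y. norm y < r \<Longrightarrow> (\<integral>\<^sup>+ x. ennreal (norm (q (x - y) - q x) powr p) \<partial>lborel) \<le> e"
  shows "(\<integral>\<^sup>+ x. ennreal (norm ((LINT y|lborel. \<rho> (x - y) *\<^sub>R q y) - q x) powr p) \<partial>lborel) \<le> e"
proof -
  have [measurable]: "q \<in> borel_measurable borel" "\<rho> \<in> borel_measurable borel"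
    using q \<rho> by auto
  have \<rho>x: "integrable lborel (\<lambda>y. \<rho> (x - y))" for x using \<rho>(1) by (rule integrable_lborel_reflect)
  have \<rho>x1: "(LINT y|lborel. \<rho> (x - y)) = 1" for x using \<rho>(2) by (simp add: integral_lborel_reflect)
  have i: "integrable lborel (\<lambda>y. \<rho> (x - y) *\<^sub>R q y)" for x
    using integrable_scaleR_bounded[of "\<lambda>y. \<rho> (x - y)" lborel B q] \<rho> q by simp
  have "ennreal (norm ((LINT y|lborel. \<rho> (x - y) *\<^sub>R q y) - q x) powr p)
    \<le> (\<integral>\<^sup>+ y. ennreal (\<rho> y * norm (q (x - y) - q x) powr p) \<partial>lborel)" for x
  proof -
    have i2: "integrable lborel (\<lambda>y. \<rho> (x - y) *\<^sub>R q y - \<rho> (x - y) *\<^sub>R q x)" using i \<rho>x by auto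
    have i3: "integrable lborel (\<lambda>y. \<rho> (x - y) * norm (q y - q x))"
      using integrable_norm[OF i2] \<rho>(3) by (simp add: scaleR_diff_right[symmetric])
    have "(LINT y|lborel. \<rho> (x - y) *\<^sub>R q y) - q x = (LINT y|lborel. \<rho> (x - y) *\<^sub>R q y - \<rho> (x - y) *\<^sub>R q x)"
      using i \<rho>x by (simp add: \<rho>x1)
    also have "norm \<dots> \<le> (LINT y|lborel. \<rho> (x - y) * norm (q y - q x))"
      using i2 i3 \<rho>(3) by (intro norm_integral_le_integral) (auto simp: scaleR_diff_right[symmetric])
    finally have "ennreal (norm ((LINT y|lborel. \<rho> (x - y) *\<^sub>R q y) - q x) powr p) \<le>
       ennreal ((LINT y|lborel. \<rho> (x - y) * norm (q y - q x)) powr p)"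
      using p by (intro ennreal_leI powr_mono2) auto
    also have "\<dots> \<le> (\<integral>\<^sup>+ y. ennreal (\<rho> (x - y) * norm (q y - q x) powr p) \<partial>lborel)"
      using \<rho>x \<rho>x1 \<rho>(3) i3 p by (intro powr_mean_le) auto
    also have "\<dots> = (\<integral>\<^sup>+ y. ennreal (\<rho> y * norm (q (x - y) - q x) powr p) \<partial>lborel)"
      using nn_integral_lborel_reflect[of "\<lambda>y. ennreal (\<rho> (x - y) * norm (q y - q x) powr p)" x] by simp
    finally show ?thesis .
  qed
  then have "(\<integral>\<^sup>+ x. ennreal (norm ((LINT y|lborel. \<rho> (x - y) *\<^sub>R q y) - q x) powr p) \<partial>lborel)
    \<le> (\<integral>\<^sup>+ x. \<integral>\<^sup>+ y. ennreal (\<rho> y * norm (q (x - y) - q x) powr p) \<partial>lborel \<partial>lborel)"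
    by (rule nn_integral_mono)
  also have "\<dots> = (\<integral>\<^sup>+ y. \<integral>\<^sup>+ x. ennreal (\<rho> y * norm (q (x - y) - q x) powr p) \<partial>lborel \<partial>lborel)"
    by (rule lborel_pair.Fubini') measurable
  also have "\<dots> \<le> (\<integral>\<^sup>+ y. ennreal (\<rho> y) * e \<partial>lborel)"
  proof (rule nn_integral_mono)
    fix y
    have "(\<integral>\<^sup>+ x. ennreal (\<rho> y * norm (q (x - y) - q x) powr p) \<partial>lborel) =
      ennreal (\<rho> y) * (\<integral>\<^sup>+ x. ennreal (norm (q (x - y) - q x) powr p) \<partial>lborel)"
      by (simp add: ennreal_mult' \<rho>(3) nn_integral_cmult)
    also have "\<dots> \<le> ennreal (\<rho> y) * e"
      using T[of y] \<rho>(5)[of y] by (cases "norm y < r") (auto intro: mult_left_mono)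
    finally show "(\<integral>\<^sup>+ x. ennreal (\<rho> y * norm (q (x - y) - q x) powr p) \<partial>lborel) \<le> ennreal (\<rho> y) * e" .
  qed
  also have "\<dots> = e"
    using \<rho> by (subst nn_integral_multc) (auto simp: nn_integral_eq_integral)
  finally show ?thesis .
qed

section \<open>Local integrability on compact subsets\<close>

lemma Lp_loc_measurable:
  fixes h :: "'a::euclidean_space \<Rightarrow> 'b::euclidean_space"
  assumes "Lp_loc p \<Omega> h" "\<Omega> \<in> sets lebesgue" "K \<in> sets lebesgue" "K \<subseteq> \<Omega>"
  shows "(\<lambda>x. indicator K x *\<^sub>R h x) \<in> borel_measurable lebesgue"
proof -
  have "h \<in> borel_measurable (lebesgue_on \<Omega>)" using assms by (simp add: Lp_loc_def)
  then have "(\<lambda>x. indicator \<Omega> x *\<^sub>R h x) \<in> borel_measurable lebesgue"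
    using assms(2) by (subst (asm) borel_measurable_restrict_space_iff) auto
  then have "(\<lambda>x. indicator K x *\<^sub>R (indicator \<Omega> x *\<^sub>R h x)) \<in> borel_measurable lebesgue"
    by (rule borel_measurable_scaleR[OF borel_measurable_indicator[OF assms(3)]])
  moreover have "indicator K x *\<^sub>R (indicator \<Omega> x *\<^sub>R h x) = indicator K x *\<^sub>R h x" for x
    using assms(4) by (auto simp: indicator_def)
  ultimately show ?thesis by (simp only:)
qed

lemma Lp_loc_set_integrable:
  fixes h :: "'a::euclidean_space \<Rightarrow> 'b::euclidean_space"
  assumes h: "Lp_loc p \<Omega> h" and p: "1 \<le> p" and \<Omega>: "\<Omega> \<in> sets lebesgue" and K: "compact K" "K \<subseteq> \<Omega>"
  shows "set_integrable lebesgue K h"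
  unfolding set_integrable_def
proof (rule Bochner_Integration.integrable_bound)
  have Kl: "K \<in> sets lebesgue" using K by (simp add: lmeasurable_compact fmeasurableD)
  have "integrable lebesgue (indicator K :: 'a \<Rightarrow> real)"
    using K lmeasurable_compact[of K] by (intro integrable_real_indicator) (auto simp: fmeasurable_def)
  moreover have "integrable lebesgue (\<lambda>x. indicator K x *\<^sub>R (norm (h x) powr p))"
    using h K by (auto simp: Lp_loc_def set_integrable_def)
  ultimately show "integrable lebesgue (\<lambda>x. indicator K x + indicator K x *\<^sub>R (norm (h x) powr p))"
    by (rule Bochner_Integration.integrable_add)
  show "(\<lambda>x. indicator K x *\<^sub>R h x) \<in> borel_measurable lebesgue"
    by (rule Lp_loc_measurable[OF h \<Omega> Kl K(2)])
  show "AE x in lebesgue. norm (indicator K x *\<^sub>R h x) \<le> norm (indicator K x + indicator K x *\<^sub>R norm (h x) powr p :: real)"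
    using le_one_plus_powr[of "norm (h x)" 1 p for x] p by (intro AE_I2) (auto simp: indicator_def)
qed

subsection \<open>Smooth approximation of Sobolev functions\<close>

lemma compact_neighbourhood:
  fixes K :: "'a::euclidean_space set"
  assumes "compact K"
  shows "compact (\<Union>x\<in>K. cball x e)"
proof -
  have "(\<Union>x\<in>K. cball x e) = {x + y |x y. x \<in> K \<and> y \<in> cball 0 e}"
  proof (intro set_eqI iffI)
    fix w assume "w \<in> (\<Union>x\<in>K. cball x e)"
    then obtain x where "x \<in> K" "dist x w \<le> e" by auto
    then show "w \<in> {x + y |x y. x \<in> K \<and> y \<in> cball 0 e}"
      by (intro CollectI exI[of _ x] exI[of _ "w - x"]) (auto simp: dist_norm norm_minus_commute)
  qed (force simp: dist_norm)
  then show ?thesis using compact_sums[OF assms compact_cball[of 0 e]] by (simp only:)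
qed

text \<open>Turns an almost-everywhere bound on \<open>q\<close> near \<open>x\<close> into a bound
  at the point \<open>x\<close> itself. The smooth approximants thereby satisfy their upper bounds
  everywhere, which is what places the supports of the truncations.\<close>

lemma convolution_le_of_AE:
  fixes q :: "'a::euclidean_space \<Rightarrow> real"
  assumes q: "integrable lborel q"
    and \<rho>: "integrable lborel \<rho>" "(LINT x|lborel. \<rho> x) = 1" "\<And>x. 0 \<le> \<rho> x" "\<And>x. \<rho> x \<le> B"
      "\<And>x. r \<le> norm x \<Longrightarrow> \<rho> x = 0"
    and t: "AE y in lborel. norm (x - y) < r \<longrightarrow> q y \<le> t"
  shows "(LINT y|lborel. \<rho> (x - y) * q y) \<le> t"
proof -
  have [measurable]: "\<rho> \<in> borel_measurable borel" using \<rho> by auto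
  have \<rho>x: "integrable lborel (\<lambda>y. \<rho> (x - y))" using \<rho>(1) by (rule integrable_lborel_reflect)
  have "(LINT y|lborel. \<rho> (x - y) * q y) \<le> (LINT y|lborel. \<rho> (x - y) * t)"
  proof (rule integral_mono_AE)
    show "integrable lborel (\<lambda>y. \<rho> (x - y) * q y)"
      using integrable_scaleR_bounded[of "\<lambda>y. \<rho> (x - y)" lborel B q] \<rho> q by simp
    show "AE y in lborel. \<rho> (x - y) * q y \<le> \<rho> (x - y) * t"
      using t
    proof eventually_elim
      case (elim y)
      then show ?case using \<rho>(3)[of "x - y"] \<rho>(5)[of "x - y"]
        by (cases "norm (x - y) < r") (auto intro: mult_left_mono)
    qed
  qed (use \<rho>x in auto)
  also have "\<dots> = t" using \<rho>x \<rho>(2) by (simp add: integral_lborel_reflect)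
  finally show ?thesis .
qed

text \<open>For fixed \<open>x\<close> the reflected kernel
  \<open>\<lambda>y. \<rho> (x - y)\<close> has gradient \<open>- D\<rho> (x - y)\<close> and
  support in \<open>cball x r\<close>, so it is an admissible test function. The weak derivative
  identity for it is the claim. As that ball lies in \<open>K\<close>, cutting off at
  \<open>K\<close> does not interfere.\<close>

lemma W1p_loc_convolution_gradient:
  fixes h :: "'a::euclidean_space \<Rightarrow> real"
  assumes \<Omega>: "open \<Omega>" and W: "W1p_loc p \<Omega> h Dh"
    and der: "\<And>x. (\<rho> has_derivative (\<lambda>h. D\<rho> x \<bullet> h)) (at x)" and c: "continuous_on UNIV D\<rho>"
    and z: "\<And>x. r \<le> norm x \<Longrightarrow> \<rho> x = 0" "\<And>x. r \<le> norm x \<Longrightarrow> D\<rho> x = 0"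
    and x: "cball x r \<subseteq> K" and K: "compact K" "K \<subseteq> \<Omega>"
    and q: "q \<in> borel_measurable borel" "AE y in lborel. q y = indicator K y *\<^sub>R h y"
    and Dq: "Dq \<in> borel_measurable borel" "AE y in lborel. Dq y = indicator K y *\<^sub>R Dh y"
  shows "(LINT y|lborel. q y *\<^sub>R D\<rho> (x - y)) = (LINT y|lborel. \<rho> (x - y) *\<^sub>R Dq y)"
proof -
  have c\<rho>: "continuous_on UNIV \<rho>"
    by (rule has_derivative_continuous_on) (rule der)
  have [measurable]: "\<rho> \<in> borel_measurable borel" "D\<rho> \<in> borel_measurable borel"
    "q \<in> borel_measurable borel" "Dq \<in> borel_measurable borel"
    using c c\<rho> q Dq by (auto intro: borel_measurable_continuous_onI)
  have \<Omega>l: "\<Omega> \<in> sets lebesgue" using \<Omega> by simp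
  have Kl: "K \<in> sets lebesgue" using K by (simp add: lmeasurable_compact fmeasurableD)
  have Lh: "Lp_loc p \<Omega> h" "Lp_loc p \<Omega> Dh" using W by (auto simp: W1p_loc_def)
  have supp: "y \<in> K" if "\<rho> (x - y) \<noteq> 0 \<or> D\<rho> (x - y) \<noteq> 0" for y
    using z[of "x - y"] that x by (force simp: dist_norm)
  have "C1c \<Omega> (\<lambda>y. \<rho> (x - y)) (\<lambda>y. - D\<rho> (x - y))"
    unfolding C1c_def
  proof (intro conjI allI)
    fix y
    have "((\<lambda>y. x - y) has_derivative (\<lambda>h. - h)) (at y)" by (auto intro!: derivative_eq_intros)
    from diff_chain_at[OF this der] show "((\<lambda>y. \<rho> (x - y)) has_derivative (\<lambda>h. - D\<rho> (x - y) \<bullet> h)) (at y)"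
      by (simp add: o_def)
    show "continuous_on UNIV (\<lambda>y. - D\<rho> (x - y))"
      by (intro continuous_intros continuous_on_compose2[OF c]) auto
    have s: "supp_closure (\<lambda>y. \<rho> (x - y)) \<subseteq> cball x r"
      unfolding supp_closure_def using z(1) by (intro closure_minimal) (force simp: dist_norm)+
    then show "compact (supp_closure (\<lambda>y. \<rho> (x - y)))"
      unfolding supp_closure_def by (meson bounded_cball bounded_subset closed_closure compact_eq_bounded_closed)
    show "supp_closure (\<lambda>y. \<rho> (x - y)) \<subseteq> \<Omega>" using s x K by blast
  qed
  then have id: "(LINT y:\<Omega>|lebesgue. h y *\<^sub>R (- D\<rho> (x - y))) = - (LINT y:\<Omega>|lebesgue. \<rho> (x - y) *\<^sub>R Dh y)"
    using W unfolding W1p_loc_def by blast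
  have "(LINT y|lborel. q y *\<^sub>R D\<rho> (x - y)) = (LINT y|lebesgue. q y *\<^sub>R D\<rho> (x - y))"
    by (subst integral_completion) auto
  also have "\<dots> = (LINT y|lebesgue. (indicator K y *\<^sub>R h y) *\<^sub>R D\<rho> (x - y))"
  proof (rule integral_cong_AE)
    show "(\<lambda>y. (indicator K y *\<^sub>R h y) *\<^sub>R D\<rho> (x - y)) \<in> borel_measurable lebesgue"
      by (intro borel_measurable_scaleR Lp_loc_measurable[OF Lh(1) \<Omega>l Kl K(2)] measurable_completion) measurable
    show "AE y in lebesgue. q y *\<^sub>R D\<rho> (x - y) = (indicator K y *\<^sub>R h y) *\<^sub>R D\<rho> (x - y)"
      using AE_completion[OF q(2)] by eventually_elim simp
  qed (auto intro: measurable_completion)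
  also have "\<dots> = - (LINT y:\<Omega>|lebesgue. h y *\<^sub>R (- D\<rho> (x - y)))"
    unfolding set_lebesgue_integral_def Bochner_Integration.integral_minus[symmetric]
    using supp K by (intro Bochner_Integration.integral_cong) (auto simp: indicator_def)
  also have "\<dots> = (LINT y:\<Omega>|lebesgue. \<rho> (x - y) *\<^sub>R Dh y)" using id by simp
  also have "\<dots> = (LINT y|lebesgue. \<rho> (x - y) *\<^sub>R (indicator K y *\<^sub>R Dh y))"
    unfolding set_lebesgue_integral_def
    using supp K by (intro Bochner_Integration.integral_cong) (auto simp: indicator_def)
  also have "\<dots> = (LINT y|lebesgue. \<rho> (x - y) *\<^sub>R Dq y)"
  proof (rule integral_cong_AE)
    show "(\<lambda>y. \<rho> (x - y) *\<^sub>R (indicator K y *\<^sub>R Dh y)) \<in> borel_measurable lebesgue"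
      by (intro borel_measurable_scaleR Lp_loc_measurable[OF Lh(2) \<Omega>l Kl K(2)] measurable_completion) measurable
    show "AE y in lebesgue. \<rho> (x - y) *\<^sub>R (indicator K y *\<^sub>R Dh y) = \<rho> (x - y) *\<^sub>R Dq y"
      using AE_completion[OF Dq(2)] by eventually_elim simp
  qed (auto intro: measurable_completion)
  also have "\<dots> = (LINT y|lborel. \<rho> (x - y) *\<^sub>R Dq y)"
    by (subst integral_completion) auto
  finally show ?thesis .
qed

lemma Lp_loc_borel_representative:
  fixes h :: "'a::euclidean_space \<Rightarrow> 'b::euclidean_space"
  assumes h: "Lp_loc p \<Omega> h" and p: "1 \<le> p" and \<Omega>: "open \<Omega>" and K: "compact K" "K \<subseteq> \<Omega>"
  obtains q where "q \<in> borel_measurable borel" "AE y in lborel. q y = indicator K y *\<^sub>R h y"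
    "\<And>y. y \<notin> K \<Longrightarrow> q y = 0" "integrable lborel q" "(\<integral>\<^sup>+ x. ennreal (norm (q x) powr p) \<partial>lborel) < \<infinity>"
proof -
  have \<Omega>l: "\<Omega> \<in> sets lebesgue" using \<Omega> by simp
  have Kl: "K \<in> sets lebesgue" using K by (simp add: lmeasurable_compact fmeasurableD)
  obtain q where q: "q \<in> borel_measurable borel" "AE y in lborel. q y = indicator K y *\<^sub>R h y"
    "\<And>y. indicator K y *\<^sub>R h y = 0 \<Longrightarrow> q y = 0"
    by (rule lebesgue_borel_representative[OF Lp_loc_measurable[OF h \<Omega>l Kl K(2)]]) (rule that)
  have qm: "q \<in> borel_measurable lebesgue" using q(1) by (auto intro: measurable_completion)
  have "integrable lebesgue q"
    using Lp_loc_set_integrable[OF h p \<Omega>l K] unfolding set_integrable_def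
    by (rule integrable_cong_AE_imp[OF _ qm]) (use AE_completion[OF q(2)] in \<open>auto elim: eventually_mono\<close>)
  then have qi: "integrable lborel q" using q(1) by (subst (asm) integrable_completion) auto
  have "integrable lebesgue (\<lambda>x. indicator K x *\<^sub>R (norm (h x) powr p))"
    using h K by (auto simp: Lp_loc_def set_integrable_def)
  then have "(\<integral>\<^sup>+ x. ennreal (norm (indicator K x *\<^sub>R (norm (h x) powr p))) \<partial>lebesgue) < \<infinity>"
    by (simp only: integrable_iff_bounded)
  also have "(\<integral>\<^sup>+ x. ennreal (norm (indicator K x *\<^sub>R (norm (h x) powr p))) \<partial>lebesgue)
    = (\<integral>\<^sup>+ x. ennreal (norm (q x) powr p) \<partial>lebesgue)"
  proof (rule nn_integral_cong_AE)
    show "AE x in lebesgue. ennreal (norm (indicator K x *\<^sub>R (norm (h x) powr p))) = ennreal (norm (q x) powr p)"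
      using AE_completion[OF q(2)] by eventually_elim (use p in \<open>auto simp: indicator_def\<close>)
  qed
  finally have "(\<integral>\<^sup>+ x. ennreal (norm (q x) powr p) \<partial>lborel) < \<infinity>"
    by (simp add: nn_integral_completion)
  then show ?thesis using that q qi by simp
qed

text \<open>\<open>K\<close> and \<open>K2\<close> are the closed neighbourhoods of
  \<open>K0\<close> of radius \<open>e0 / 2\<close> and \<open>e0\<close>, and mollification radii
  stay below \<open>e0 / 2\<close>. Around points of \<open>K\<close> the averages see only
  \<open>K2\<close>, where \<open>q\<close> and \<open>Dq\<close> are the given function and its
  weak gradient. Around points outside \<open>K\<close> they miss \<open>K0\<close>, so they see
  values at most \<open>k0\<close>, or the zero extension outside \<open>K2\<close>. This extension
  explains the conditions \<open>0 \<le> k0\<close> and \<open>0 \<le> t\<close>.\<close>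

lemma W1p_loc_smooth_approx:
  fixes h :: "'a::euclidean_space \<Rightarrow> real"
  assumes \<Omega>: "open \<Omega>" and K0: "compact K0" "K0 \<subseteq> \<Omega>" and W: "W1p_loc p \<Omega> h Dh"
    and p: "1 < p" and k0: "0 \<le> k0" and small: "AE x in lebesgue. x \<in> \<Omega> - K0 \<longrightarrow> h x \<le> k0"
  obtains K and H :: "nat \<Rightarrow> 'a \<Rightarrow> real" and DH :: "nat \<Rightarrow> 'a \<Rightarrow> 'a"
  where "compact K" "K \<subseteq> \<Omega>" "K0 \<subseteq> K"
    "\<And>j x. (H j has_derivative (\<lambda>t. DH j x \<bullet> t)) (at x)" "\<And>j. continuous_on UNIV (DH j)"
    "\<And>j x. x \<notin> K \<Longrightarrow> H j x \<le> k0"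
    "\<And>t j x. 0 \<le> t \<Longrightarrow> AE x in lebesgue. x \<in> \<Omega> \<longrightarrow> h x \<le> t \<Longrightarrow> H j x \<le> t"
    "AE x in lebesgue. x \<in> K \<longrightarrow> (\<lambda>j. H j x) \<longlonglongrightarrow> h x"
    "(\<lambda>j. \<integral>\<^sup>+ x. ennreal (indicator K x * norm (DH j x - Dh x) powr p) \<partial>lebesgue) \<longlonglongrightarrow> 0"
proof -
  obtain e0 where e0: "0 < e0" "(\<Union>x\<in>K0. cball x e0) \<subseteq> \<Omega>"
    using compact_subset_open_imp_cball_epsilon_subset[OF K0(1) \<Omega> K0(2)] by metis
  define K where "K = (\<Union>x\<in>K0. cball x (e0 / 2))"
  define K2 where "K2 = (\<Union>x\<in>K0. cball x e0)"
  have K: "compact K" and K2: "compact K2" using K0 by (auto simp: K_def K2_def intro: compact_neighbourhood)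
  have K2\<Omega>: "K2 \<subseteq> \<Omega>" using e0 by (simp add: K2_def)
  have KK2: "K \<subseteq> K2" unfolding K_def K2_def using e0 by (intro UN_mono) auto
  have K0K: "K0 \<subseteq> K" using e0 by (force simp: K_def)
  have cballK: "cball x (e0 / 2) \<subseteq> K2" if "x \<in> K" for x
  proof -
    obtain x0 where x0: "x0 \<in> K0" "dist x0 x \<le> e0 / 2" using \<open>x \<in> K\<close> by (auto simp: K_def)
    then have "cball x (e0 / 2) \<subseteq> cball x0 e0"
      using cball_subset_cball_iff[of x "e0 / 2" x0 e0] by (simp add: dist_commute)
    then show ?thesis using x0 by (auto simp: K2_def)
  qed
  have L: "Lp_loc p \<Omega> h" "Lp_loc p \<Omega> Dh" using W by (auto simp: W1p_loc_def)
  have p1: "1 \<le> p" using p by simp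
  obtain q where q: "q \<in> borel_measurable borel" "AE y in lborel. q y = indicator K2 y *\<^sub>R h y"
    "\<And>y. y \<notin> K2 \<Longrightarrow> q y = 0" "integrable lborel q" "(\<integral>\<^sup>+ x. ennreal (norm (q x) powr p) \<partial>lborel) < \<infinity>"
    by (rule Lp_loc_borel_representative[OF L(1) p1 \<Omega> K2 K2\<Omega>]) (rule that)
  obtain Dq where Dq: "Dq \<in> borel_measurable borel" "AE y in lborel. Dq y = indicator K2 y *\<^sub>R Dh y"
    "\<And>y. y \<notin> K2 \<Longrightarrow> Dq y = 0" "integrable lborel Dq" "(\<integral>\<^sup>+ x. ennreal (norm (Dq x) powr p) \<partial>lborel) < \<infinity>"
    by (rule Lp_loc_borel_representative[OF L(2) p1 \<Omega> K2 K2\<Omega>]) (rule that)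
  note [measurable] = q(1) Dq(1)
  obtain R where R: "\<And>x. x \<in> K2 \<Longrightarrow> norm x \<le> R"
    using compact_imp_bounded[OF K2] by (auto simp: bounded_iff)
  have zq: "q x = 0" "Dq x = 0" if "R < norm x" for x
    using that R[of x] q(3) Dq(3) by force+
  \<comment> \<open>One radius has to control the translation error of the function and of the
    gradient together. Packing all requirements into a predicate allows a single choice per index;
    \<open>mol\<close> below does the same for a kernel and its gradient.\<close>
  define good where "good j r \<longleftrightarrow> 0 < r \<and> r \<le> e0 / 2 \<and>
      (\<forall>y. norm y < r \<longrightarrow> (\<integral>\<^sup>+ x. ennreal (norm (q (x - y) - q x) powr p) \<partial>lborel) \<le> ennreal (1 / real (Suc j))) \<and>
      (\<forall>y. norm y < r \<longrightarrow> (\<integral>\<^sup>+ x. ennreal (norm (Dq (x - y) - Dq x) powr p) \<partial>lborel) \<le> ennreal (1 / real (Suc j)))" for j r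
  have "\<exists>r. good j r" for j
  proof -
    have e: "0 < 1 / real (Suc j)" by simp
    obtain d1 where d1: "0 < d1"
      "\<And>y. norm y < d1 \<Longrightarrow> (\<integral>\<^sup>+ x. ennreal (norm (q (x - y) - q x) powr p) \<partial>lborel) \<le> ennreal (1 / real (Suc j))"
      by (rule translation_continuous_Lp[where R = R, OF q(1) zq(1) q(5) p1 e]) (assumption, rule that)
    obtain d2 where d2: "0 < d2"
      "\<And>y. norm y < d2 \<Longrightarrow> (\<integral>\<^sup>+ x. ennreal (norm (Dq (x - y) - Dq x) powr p) \<partial>lborel) \<le> ennreal (1 / real (Suc j))"
      by (rule translation_continuous_Lp[where R = R, OF Dq(1) zq(2) Dq(5) p1 e]) (assumption, rule that)
    show ?thesis using d1 d2 e0(1) by (intro exI[of _ "min (e0 / 2) (min d1 d2)"]) (auto simp: good_def)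
  qed
  then obtain r where "\<And>j. good j (r j)" by metis
  then have r: "\<And>j. 0 < r j" "\<And>j. r j \<le> e0 / 2"
    and rq: "\<And>j y. norm y < r j \<Longrightarrow> (\<integral>\<^sup>+ x. ennreal (norm (q (x - y) - q x) powr p) \<partial>lborel) \<le> ennreal (1 / real (Suc j))"
    and rDq: "\<And>j y. norm y < r j \<Longrightarrow> (\<integral>\<^sup>+ x. ennreal (norm (Dq (x - y) - Dq x) powr p) \<partial>lborel) \<le> ennreal (1 / real (Suc j))"
    by (auto simp: good_def)
  define mol where "mol j \<rho> D\<rho> \<longleftrightarrow> (\<forall>x::'a. (\<rho> has_derivative (\<lambda>h. D\<rho> x \<bullet> h)) (at x)) \<and> continuous_on UNIV D\<rho> \<and>
    (\<forall>x. 0 \<le> \<rho> x) \<and> (\<forall>x. r j \<le> norm x \<longrightarrow> \<rho> x = 0) \<and> (\<forall>x. r j \<le> norm x \<longrightarrow> D\<rho> x = 0) \<and>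
    integrable lborel \<rho> \<and> (LINT x|lborel. \<rho> x) = 1" for j \<rho> D\<rho>
  have "\<exists>\<rho> D\<rho>. mol j \<rho> D\<rho>" for j
    unfolding mol_def by (rule C1_mollifier_exists[OF r(1)[of j]]) blast
  then obtain \<rho> D\<rho> where "\<And>j. mol j (\<rho> j) (D\<rho> j)" by metis
  then have der: "\<And>j (x::'a). (\<rho> j has_derivative (\<lambda>h. D\<rho> j x \<bullet> h)) (at x)"
    and c: "\<And>j. continuous_on UNIV (D\<rho> j)"
    and pos: "\<And>j x. 0 \<le> \<rho> j x" and z: "\<And>j x. r j \<le> norm x \<Longrightarrow> \<rho> j x = 0" "\<And>j x. r j \<le> norm x \<Longrightarrow> D\<rho> j x = 0"
    and int: "\<And>j. integrable lborel (\<rho> j)" "\<And>j. (LINT x|lborel. \<rho> j x) = 1"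
    by (auto simp: mol_def)
  have c\<rho>: "continuous_on UNIV (\<rho> j)" for j
    by (rule has_derivative_continuous_on) (rule der)
  have "\<exists>B. \<forall>x. \<rho> j x \<le> B" for j
    using bounded_compact_support[OF c\<rho> z(1)] by (metis abs_le_D1 real_norm_def)
  then obtain B where B: "\<And>j x. \<rho> j x \<le> B j" by metis
  define H where "H j x = (LINT y|lborel. \<rho> j (x - y) * q y)" for j x
  define DH where "DH j x = (LINT y|lborel. q y *\<^sub>R D\<rho> j (x - y))" for j x
  have derH: "(H j has_derivative (\<lambda>t. DH j x \<bullet> t)) (at x)" for j x
    unfolding H_def[abs_def] DH_def by (rule convolution_has_derivative[OF q(4) der c z])
  have cDH: "continuous_on UNIV (DH j)" for j
    unfolding DH_def[abs_def] by (rule convolution_continuous[OF q(4) c z(2)])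
  have cH: "continuous_on UNIV (H j)" for j
    by (rule has_derivative_continuous_on) (rule derH)
  have [measurable]: "H j \<in> borel_measurable borel" "DH j \<in> borel_measurable borel" for j
    using cH cDH by (auto intro: borel_measurable_continuous_onI)
  have outK: "H j x \<le> k0" if "x \<notin> K" for j x
    unfolding H_def
  proof (rule convolution_le_of_AE[OF q(4) int pos B z(1)])
    have "AE y in lborel. y \<in> \<Omega> - K0 \<longrightarrow> h y \<le> k0" using small by (simp add: AE_completion_iff)
    with q(2) show "AE y in lborel. norm (x - y) < r j \<longrightarrow> q y \<le> k0"
    proof eventually_elim
      case (elim y)
      show ?case
      proof
        assume "norm (x - y) < r j"
        then have "y \<notin> K0" using r(2)[of j] that by (auto simp: K_def dist_norm norm_minus_commute)
        then show "q y \<le> k0" using elim k0 K2\<Omega> by (auto simp: indicator_def)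
      qed
    qed
  qed
  have upper: "H j x \<le> t" if "0 \<le> t" "AE x in lebesgue. x \<in> \<Omega> \<longrightarrow> h x \<le> t" for t j x
    unfolding H_def
  proof (rule convolution_le_of_AE[OF q(4) int pos B z(1)])
    have "AE y in lborel. y \<in> \<Omega> \<longrightarrow> h y \<le> t" using that by (simp add: AE_completion_iff)
    with q(2) show "AE y in lborel. norm (x - y) < r j \<longrightarrow> q y \<le> t"
      by eventually_elim (use that(1) K2\<Omega> in \<open>auto simp: indicator_def\<close>)
  qed
  have LpH: "(\<integral>\<^sup>+ x. ennreal (norm (H j x - q x) powr p) \<partial>lborel) \<le> ennreal (1 / real (Suc j))" for j
    using mollification_Lp_le[OF q(4) int pos B z(1) p rq] by (simp add: H_def)
  \<comment> \<open>The derivative of the convolution falls on the kernel; only on \<open>K\<close>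
    is it known to be the mollified weak gradient, whence the indicator.\<close>
  have LpDH: "(\<integral>\<^sup>+ x. ennreal (indicator K x * norm (DH j x - Dh x) powr p) \<partial>lebesgue) \<le> ennreal (1 / real (Suc j))" for j
  proof -
    have DHK: "DH j x = (LINT y|lborel. \<rho> j (x - y) *\<^sub>R Dq y)" if "x \<in> K" for x
      unfolding DH_def
    proof (rule W1p_loc_convolution_gradient[OF \<Omega> W der c z _ K2 K2\<Omega> q(1,2) Dq(1,2)])
      show "cball x (r j) \<subseteq> K2"
        using cballK[OF that] subset_cball[OF r(2)[of j]] by blast
    qed
    have "(\<integral>\<^sup>+ x. ennreal (indicator K x * norm (DH j x - Dh x) powr p) \<partial>lebesgue) \<le>
      (\<integral>\<^sup>+ x. ennreal (norm ((LINT y|lborel. \<rho> j (x - y) *\<^sub>R Dq y) - Dq x) powr p) \<partial>lebesgue)"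
    proof (rule nn_integral_mono_AE)
      show "AE x in lebesgue. ennreal (indicator K x * norm (DH j x - Dh x) powr p) \<le>
        ennreal (norm ((LINT y|lborel. \<rho> j (x - y) *\<^sub>R Dq y) - Dq x) powr p)"
        using AE_completion[OF Dq(2)]
      proof eventually_elim
        case (elim x)
        show ?case
        proof (cases "x \<in> K")
          case True
          then have "Dq x = Dh x" using elim KK2 by auto
          then show ?thesis using True DHK by simp
        qed simp
      qed
    qed
    also have "\<dots> = (\<integral>\<^sup>+ x. ennreal (norm ((LINT y|lborel. \<rho> j (x - y) *\<^sub>R Dq y) - Dq x) powr p) \<partial>lborel)"
      by (rule nn_integral_completion)
    also have "\<dots> \<le> ennreal (1 / real (Suc j))"
      by (rule mollification_Lp_le[OF Dq(4) int pos B z(1) p rDq])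
    finally show ?thesis .
  qed
  have lim0: "(\<lambda>j. ennreal (1 / real (Suc j))) \<longlonglongrightarrow> 0"
    using tendsto_ennrealI[OF LIMSEQ_inverse_real_of_nat] by (simp add: inverse_eq_divide)
  have limDH: "(\<lambda>j. \<integral>\<^sup>+ x. ennreal (indicator K x * norm (DH j x - Dh x) powr p) \<partial>lebesgue) \<longlonglongrightarrow> 0"
    by (rule tendsto_sandwich[OF _ _ tendsto_const lim0]) (use LpDH in auto)
  have iH: "integrable lborel (\<lambda>x. norm (H j x - q x) powr p)" for j
    by (rule integrableI_nonneg) (use LpH[of j] in \<open>auto intro: le_less_trans\<close>)
  have "(LINT x|lborel. norm (norm (H j x - q x) powr p)) \<le> 1 / real (Suc j)" for j
  proof -
    have "ennreal (LINT x|lborel. norm (H j x - q x) powr p) \<le> ennreal (1 / real (Suc j))"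
      using LpH[of j] nn_integral_eq_integral[OF iH[of j]] by simp
    then show ?thesis by (simp add: ennreal_le_iff)
  qed
  then have "(\<lambda>j. LINT x|lborel. norm (norm (H j x - q x) powr p)) \<longlonglongrightarrow> 0"
    by (intro tendsto_sandwich[OF _ _ tendsto_const LIMSEQ_inverse_real_of_nat])
      (auto simp: inverse_eq_divide intro!: always_eventually integral_nonneg_AE)
  \<comment> \<open>Convergence in the mean gives pointwise convergence only along a subsequence;
    the gradients keep their limit along it.\<close>
  then obtain s :: "nat \<Rightarrow> nat" where s: "strict_mono s"
    and lims: "AE x in lborel. (\<lambda>n. norm (H (s n) x - q x) powr p) \<longlonglongrightarrow> 0"
    using tendsto_L1_AE_subseq[of lborel "\<lambda>j x. norm (H j x - q x) powr p", OF iH] by blast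
  have limH: "AE x in lebesgue. x \<in> K \<longrightarrow> (\<lambda>j. H (s j) x) \<longlonglongrightarrow> h x"
    using AE_completion[OF lims] AE_completion[OF q(2)]
  proof eventually_elim
    case (elim x)
    show ?case
    proof
      assume "x \<in> K"
      then have qh: "q x = h x" using elim KK2 by auto
      have "(\<lambda>n. (norm (H (s n) x - q x) powr p) powr (1 / p)) \<longlonglongrightarrow> 0 powr (1 / p)"
        using p by (intro tendsto_powr'[OF elim(1) tendsto_const]) auto
      then have "(\<lambda>n. norm (H (s n) x - q x)) \<longlonglongrightarrow> 0" using p by (simp add: powr_powr)
      then show "(\<lambda>j. H (s j) x) \<longlonglongrightarrow> h x"
        using qh LIM_zero_cancel tendsto_norm_zero_cancel by metis
    qed
  qed
  show ?thesis
  proof (rule that[of K "\<lambda>j. H (s j)" "\<lambda>j. DH (s j)", OF K _ K0K derH cDH])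
    show "K \<subseteq> \<Omega>" using KK2 K2\<Omega> by blast
    show "(\<lambda>j. \<integral>\<^sup>+ x. ennreal (indicator K x * norm (DH (s j) x - Dh x) powr p) \<partial>lebesgue) \<longlonglongrightarrow> 0"
      using LIMSEQ_subseq_LIMSEQ[OF limDH s] by (simp add: o_def)
  qed (use outK upper limH in auto)
qed

subsection \<open>Passing to the limit in the test functions\<close>

text \<open>Weighted Young inequality for the conjugate exponents p / (p - 1) and p, obtained by
  inserting \<open>z = norm A powr (1 / (p - 1))\<close> into the scalar inequality.\<close>

lemma pairing_le_powr:
  fixes A D :: "'b::euclidean_space"
  assumes p: "1 < p" and \<eta>: "0 < \<eta>"
  shows "norm A * norm D \<le> \<eta> * norm A powr (p / (p - 1)) + \<eta> powr (1 - p) * norm D powr p"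
proof -
  have "(norm A powr (1 / (p - 1))) powr (p - 1) * norm D \<le>
    \<eta> * (norm A powr (1 / (p - 1))) powr p + \<eta> powr (1 - p) * norm D powr p"
    using p \<eta> by (intro powr_mult_le_weighted) auto
  then show ?thesis using p by (simp add: powr_powr)
qed

text \<open>Young's inequality with weight \<eta>: first \<eta> is fixed so that the part with
  \<open>A\<close> contributes at most half of the tolerance, then \<open>j\<close> is taken large
  enough to beat the possibly huge factor \<open>\<eta> powr (1 - p)\<close>.\<close>

lemma pairing_tendsto_zero:
  fixes A :: "'a \<Rightarrow> 'b::euclidean_space" and E :: "nat \<Rightarrow> 'a \<Rightarrow> 'b"
  assumes [measurable]: "A \<in> borel_measurable M" "\<And>j. E j \<in> borel_measurable M"
    and p: "1 < p" and A: "integrable M (\<lambda>x. norm (A x) powr (p / (p - 1)))"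
    and E: "(\<lambda>j. \<integral>\<^sup>+ x. ennreal (norm (E j x) powr p) \<partial>M) \<longlonglongrightarrow> 0"
  shows "(\<lambda>j. \<integral>\<^sup>+ x. ennreal (norm (A x) * norm (E j x)) \<partial>M) \<longlonglongrightarrow> 0"
proof (rule order_tendstoI)
  fix e :: ennreal assume "0 < e"
  then obtain e1 where e1: "0 < e1" "e1 < e" using dense by blast
  then have "e1 \<noteq> top" by auto
  then obtain \<epsilon> where \<epsilon>: "e1 = ennreal \<epsilon>" "0 < \<epsilon>" using e1(1) by (cases e1) auto
  define I where "I = (LINT x|M. norm (A x) powr (p / (p - 1)))"
  have I: "0 \<le> I" unfolding I_def by (intro integral_nonneg_AE) auto
  have nI: "(\<integral>\<^sup>+ x. ennreal (norm (A x) powr (p / (p - 1))) \<partial>M) = ennreal I"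
    unfolding I_def by (rule nn_integral_eq_integral[OF A]) auto
  define \<eta> where "\<eta> = \<epsilon> / 2 / (I + 1)"
  have \<eta>: "0 < \<eta>" using \<epsilon> I by (simp add: \<eta>_def)
  have \<eta>I: "\<eta> * I \<le> \<epsilon> / 2"
  proof -
    have "\<eta> * I \<le> \<eta> * (I + 1)" using \<eta> by (intro mult_left_mono) auto
    also have "\<dots> = \<epsilon> / 2" using I by (simp add: \<eta>_def field_simps)
    finally show ?thesis .
  qed
  have "((\<lambda>j. ennreal (\<eta> powr (1 - p)) * (\<integral>\<^sup>+ x. ennreal (norm (E j x) powr p) \<partial>M)) \<longlonglongrightarrow> ennreal (\<eta> powr (1 - p)) * 0)"
    by (intro ennreal_tendsto_cmult E) auto
  then have "\<forall>\<^sub>F j in sequentially. ennreal (\<eta> powr (1 - p)) * (\<integral>\<^sup>+ x. ennreal (norm (E j x) powr p) \<partial>M) < ennreal (\<epsilon> / 2)"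
    using \<epsilon> by (intro order_tendstoD) auto
  then show "\<forall>\<^sub>F j in sequentially. (\<integral>\<^sup>+ x. ennreal (norm (A x) * norm (E j x)) \<partial>M) < e"
  proof eventually_elim
    case (elim j)
    have "(\<integral>\<^sup>+ x. ennreal (norm (A x) * norm (E j x)) \<partial>M) \<le>
      (\<integral>\<^sup>+ x. ennreal \<eta> * ennreal (norm (A x) powr (p / (p - 1))) + ennreal (\<eta> powr (1 - p)) * ennreal (norm (E j x) powr p) \<partial>M)"
      using pairing_le_powr[OF p \<eta>] \<eta>
      by (intro nn_integral_mono)
        (simp add: ennreal_mult[symmetric] ennreal_plus[symmetric] ennreal_leI del: ennreal_plus)
    also have "\<dots> = ennreal \<eta> * ennreal I + ennreal (\<eta> powr (1 - p)) * (\<integral>\<^sup>+ x. ennreal (norm (E j x) powr p) \<partial>M)"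
      by (simp add: nn_integral_add nn_integral_cmult nI)
    also have "\<dots> \<le> ennreal (\<epsilon> / 2) + ennreal (\<epsilon> / 2)"
      using elim \<eta>I \<eta> I by (intro add_mono) (auto simp: ennreal_mult[symmetric] intro: ennreal_leI)
    also have "\<dots> = e1" using \<epsilon> by (simp add: ennreal_plus[symmetric] del: ennreal_plus)
    finally show ?case using e1 by simp
  qed
qed simp

lemma integrable_weighted_pairing:
  fixes A D :: "'a \<Rightarrow> 'b::euclidean_space"
  assumes [measurable]: "A \<in> borel_measurable M" "D \<in> borel_measurable M" "w \<in> borel_measurable M"
    and p: "1 < p" and A: "integrable M (\<lambda>x. norm (A x) powr (p / (p - 1)))"
    and D: "integrable M (\<lambda>x. norm (D x) powr p)" and w: "AE x in M. \<bar>w x\<bar> \<le> C"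
  shows "integrable M (\<lambda>x. w x * (A x \<bullet> D x))"
proof (rule Bochner_Integration.integrable_bound)
  show "integrable M (\<lambda>x. C * (norm (A x) powr (p / (p - 1)) + norm (D x) powr p))"
    using A D by auto
  show "AE x in M. norm (w x * (A x \<bullet> D x)) \<le> norm (C * (norm (A x) powr (p / (p - 1)) + norm (D x) powr p))"
    using w
  proof eventually_elim
    case (elim x)
    have "norm (w x * (A x \<bullet> D x)) \<le> C * (norm (A x) * norm (D x))"
      using elim Cauchy_Schwarz_ineq2[of "A x" "D x"] unfolding real_norm_def abs_mult by (intro mult_mono) auto
    also have "\<dots> \<le> C * (norm (A x) powr (p / (p - 1)) + norm (D x) powr p)"
      using elim pairing_le_powr[OF p, of 1 "A x" "D x"] by (intro mult_left_mono) auto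
    finally show ?case by simp
  qed
qed measurable

text \<open>Weights converge only boundedly almost everywhere, gradients only in the p-th mean.
  Replacing \<open>Dj\<close> by \<open>D\<close> costs at most \<open>C\<close> times a pairing
  that tends to zero; with \<open>D\<close> fixed, dominated convergence handles the
  weights.\<close>

lemma tendsto_integral_weighted_pairing:
  fixes A D :: "'a \<Rightarrow> 'b::euclidean_space" and Dj :: "nat \<Rightarrow> 'a \<Rightarrow> 'b" and wj :: "nat \<Rightarrow> 'a \<Rightarrow> real"
  assumes [measurable]: "A \<in> borel_measurable M" "D \<in> borel_measurable M" "\<And>j. Dj j \<in> borel_measurable M"
      "\<And>j. wj j \<in> borel_measurable M" "w \<in> borel_measurable M"
    and p: "1 < p" and A: "integrable M (\<lambda>x. norm (A x) powr (p / (p - 1)))"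
    and D: "integrable M (\<lambda>x. norm (D x) powr p)"
    and ADj: "\<And>j. integrable M (\<lambda>x. wj j x * (A x \<bullet> Dj j x))"
    and wj: "\<And>j. AE x in M. \<bar>wj j x\<bar> \<le> C" and lim: "AE x in M. (\<lambda>j. wj j x) \<longlonglongrightarrow> w x"
    and Dj: "(\<lambda>j. \<integral>\<^sup>+ x. ennreal (norm (Dj j x - D x) powr p) \<partial>M) \<longlonglongrightarrow> 0"
  shows "(\<lambda>j. LINT x|M. wj j x * (A x \<bullet> Dj j x)) \<longlonglongrightarrow> (LINT x|M. w x * (A x \<bullet> D x))"
proof -
  have iw: "integrable M (\<lambda>x. wj j x * (A x \<bullet> D x))" for j
    by (rule integrable_weighted_pairing[OF _ _ _ p A D wj]) measurable
  have iC: "integrable M (\<lambda>x. C * (norm (A x) powr (p / (p - 1)) + norm (D x) powr p))"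
    using A D by auto
  have 1: "(\<lambda>j. LINT x|M. wj j x * (A x \<bullet> D x)) \<longlonglongrightarrow> (LINT x|M. w x * (A x \<bullet> D x))"
  proof (rule integral_dominated_convergence[OF _ _ iC])
    show "AE x in M. (\<lambda>j. wj j x * (A x \<bullet> D x)) \<longlonglongrightarrow> w x * (A x \<bullet> D x)"
      using lim by eventually_elim (intro tendsto_intros)
    show "AE x in M. norm (wj j x * (A x \<bullet> D x)) \<le> C * (norm (A x) powr (p / (p - 1)) + norm (D x) powr p)" for j
      using wj[of j]
    proof eventually_elim
      case (elim x)
      have "norm (wj j x * (A x \<bullet> D x)) \<le> C * (norm (A x) * norm (D x))"
        using elim Cauchy_Schwarz_ineq2[of "A x" "D x"] unfolding real_norm_def abs_mult by (intro mult_mono) auto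
      also have "\<dots> \<le> C * (norm (A x) powr (p / (p - 1)) + norm (D x) powr p)"
        using elim pairing_le_powr[OF p, of 1 "A x" "D x"] by (intro mult_left_mono) auto
      finally show ?case .
    qed
  qed measurable
  \<comment> \<open>The constant stems from an almost-everywhere bound and could be negative on a
    null space, hence \<open>max 0 C\<close>.\<close>
  have lim0: "(\<lambda>j. ennreal (max 0 C) * (\<integral>\<^sup>+ x. ennreal (norm (A x) * norm (Dj j x - D x)) \<partial>M)) \<longlonglongrightarrow> ennreal (max 0 C) * 0"
    by (intro ennreal_tendsto_cmult pairing_tendsto_zero[OF _ _ p A Dj]) auto
  have "(\<lambda>j. ennreal (norm (LINT x|M. wj j x * (A x \<bullet> Dj j x) - wj j x * (A x \<bullet> D x)))) \<longlonglongrightarrow> 0"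
  proof (rule tendsto_sandwich[OF _ _ tendsto_const])
    show "(\<lambda>j. ennreal (max 0 C) * (\<integral>\<^sup>+ x. ennreal (norm (A x) * norm (Dj j x - D x)) \<partial>M)) \<longlonglongrightarrow> 0"
      using lim0 by simp
    show "\<forall>\<^sub>F j in sequentially. ennreal (norm (LINT x|M. wj j x * (A x \<bullet> Dj j x) - wj j x * (A x \<bullet> D x)))
      \<le> ennreal (max 0 C) * (\<integral>\<^sup>+ x. ennreal (norm (A x) * norm (Dj j x - D x)) \<partial>M)"
    proof (intro always_eventually allI)
      fix j
      have "ennreal (norm (LINT x|M. wj j x * (A x \<bullet> Dj j x) - wj j x * (A x \<bullet> D x))) \<le>
        (\<integral>\<^sup>+ x. ennreal (norm (wj j x * (A x \<bullet> Dj j x) - wj j x * (A x \<bullet> D x))) \<partial>M)"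
        using ADj iw by (intro integral_norm_bound_ennreal) auto
      also have "\<dots> \<le> (\<integral>\<^sup>+ x. ennreal (max 0 C) * ennreal (norm (A x) * norm (Dj j x - D x)) \<partial>M)"
      proof (rule nn_integral_mono_AE)
        show "AE x in M. ennreal (norm (wj j x * (A x \<bullet> Dj j x) - wj j x * (A x \<bullet> D x)))
          \<le> ennreal (max 0 C) * ennreal (norm (A x) * norm (Dj j x - D x))"
          using wj[of j]
        proof eventually_elim
          case (elim x)
          have "norm (wj j x * (A x \<bullet> Dj j x) - wj j x * (A x \<bullet> D x)) = \<bar>wj j x\<bar> * \<bar>A x \<bullet> (Dj j x - D x)\<bar>"
            by (simp add: inner_diff_right abs_mult[symmetric] algebra_simps)
          also have "\<dots> \<le> max 0 C * (norm (A x) * norm (Dj j x - D x))"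
            using elim Cauchy_Schwarz_ineq2 by (intro mult_mono) auto
          finally show ?case by (simp add: ennreal_mult[symmetric] ennreal_leI)
        qed
      qed
      also have "\<dots> = ennreal (max 0 C) * (\<integral>\<^sup>+ x. ennreal (norm (A x) * norm (Dj j x - D x)) \<partial>M)"
        by (rule nn_integral_cmult) measurable
      finally show "ennreal (norm (LINT x|M. wj j x * (A x \<bullet> Dj j x) - wj j x * (A x \<bullet> D x)))
        \<le> ennreal (max 0 C) * (\<integral>\<^sup>+ x. ennreal (norm (A x) * norm (Dj j x - D x)) \<partial>M)" .
    qed
  qed auto
  then have "(\<lambda>j. norm (LINT x|M. wj j x * (A x \<bullet> Dj j x) - wj j x * (A x \<bullet> D x))) \<longlonglongrightarrow> 0"
    by (subst (asm) ennreal_0[symmetric], subst (asm) tendsto_ennreal_iff) auto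
  then have "(\<lambda>j. (LINT x|M. wj j x * (A x \<bullet> Dj j x)) - (LINT x|M. wj j x * (A x \<bullet> D x))) \<longlonglongrightarrow> 0"
    using ADj iw by (auto intro: tendsto_rabs_zero_cancel)
  from tendsto_add[OF this 1] show ?thesis by simp
qed

lemma tendsto_integral_weighted:
  fixes B :: "'a \<Rightarrow> real" and wj :: "nat \<Rightarrow> 'a \<Rightarrow> real"
  assumes [measurable]: "\<And>j. wj j \<in> borel_measurable M" "w \<in> borel_measurable M"
    and B: "integrable M B" and wj: "\<And>j. AE x in M. \<bar>wj j x\<bar> \<le> C"
    and lim: "AE x in M. (\<lambda>j. wj j x) \<longlonglongrightarrow> w x"
  shows "(\<lambda>j. LINT x|M. B x * wj j x) \<longlonglongrightarrow> (LINT x|M. B x * w x)"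
proof (rule integral_dominated_convergence)
  have [measurable]: "B \<in> borel_measurable M" using B by auto
  show "(\<lambda>x. B x * w x) \<in> borel_measurable M" "\<And>j. (\<lambda>x. B x * wj j x) \<in> borel_measurable M" by measurable
  show "integrable M (\<lambda>x. norm (B x) * C)" using B by auto
  show "AE x in M. (\<lambda>j. B x * wj j x) \<longlonglongrightarrow> B x * w x"
    using lim by eventually_elim (intro tendsto_intros)
  show "AE x in M. norm (B x * wj j x) \<le> norm (B x) * C" for j
    using wj[of j] by eventually_elim (auto simp: abs_mult intro: mult_left_mono)
qed

section \<open>Compactly supported C1 functions\<close>

lemma C1c_gradient_zero:
  assumes "C1c \<Omega> \<phi> D\<phi>" "x \<notin> supp_closure \<phi>"
  shows "\<phi> x = 0" "D\<phi> x = 0"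
proof -
  have zero: "\<phi> y = 0" if "y \<in> - supp_closure \<phi>" for y
    using that closure_subset[of "{x. \<phi> x \<noteq> 0}"] by (auto simp: supp_closure_def)
  then show "\<phi> x = 0" using assms by auto
  have "(\<phi> has_derivative (\<lambda>h. D\<phi> x \<bullet> h)) (at x)" using assms by (simp add: C1c_def)
  moreover have "(\<phi> has_derivative (\<lambda>h. 0)) (at x)"
  proof (rule has_derivative_transform_within_open[OF has_derivative_const])
    show "open (- supp_closure \<phi>)" by (simp add: supp_closure_def open_Compl)
    show "x \<in> - supp_closure \<phi>" using assms by simp
    show "0 = \<phi> y" if "y \<in> - supp_closure \<phi>" for y using zero[OF that] by simp
  qed
  ultimately have "(\<lambda>h. D\<phi> x \<bullet> h) = (\<lambda>h. 0)" by (rule has_derivative_unique)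
  then show "D\<phi> x = 0" by (metis inner_eq_zero_iff)
qed

text \<open>The gradient \<open>D\<close> of (x . e) \<phi> integrates to zero, and its component
  along the unit vector \<open>e\<close> is \<phi> + (x . e)(e . D\<phi>). The identity is written
  as a field paired with the gradient plus a coefficient times the function, exactly the shape of
  \<open>Qstar_form\<close>, so that one limit theorem covers it and the two differential
  inequalities.\<close>

lemma C1c_integration_by_parts_linear:
  fixes \<phi> :: "'a::euclidean_space \<Rightarrow> real"
  assumes \<phi>: "C1c \<Omega> \<phi> D\<phi>" and e: "norm e = 1"
  shows "(LINT x:\<Omega>|lebesgue. ((x \<bullet> e) *\<^sub>R e) \<bullet> D\<phi> x) + (LINT x:\<Omega>|lebesgue. 1 * \<phi> x) = 0"
proof -
  have supp: "compact (supp_closure \<phi>)" "supp_closure \<phi> \<subseteq> \<Omega>" and c: "continuous_on UNIV D\<phi>"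
    and der: "\<And>x. (\<phi> has_derivative (\<lambda>h. D\<phi> x \<bullet> h)) (at x)"
    using \<phi> by (auto simp: C1c_def)
  obtain R where R: "\<And>x. x \<in> supp_closure \<phi> \<Longrightarrow> norm x \<le> R"
    using compact_imp_bounded[OF supp(1)] by (auto simp: bounded_iff)
  have z: "\<phi> x = 0" "D\<phi> x = 0" if "R + 1 \<le> norm x" for x
    using C1c_gradient_zero[OF \<phi>, of x] R[of x] that by force+
  have c\<phi>: "continuous_on UNIV \<phi>"
    by (rule has_derivative_continuous_on) (rule der)
  have [measurable]: "\<phi> \<in> borel_measurable borel" "D\<phi> \<in> borel_measurable borel"
    using c c\<phi> by (auto intro: borel_measurable_continuous_onI)
  define D where "D x = \<phi> x *\<^sub>R e + (x \<bullet> e) *\<^sub>R D\<phi> x" for x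
  have cball: "integrable lborel F" if F: "continuous_on UNIV F" "\<And>x. R + 1 \<le> norm x \<Longrightarrow> F x = 0" for F :: "'a \<Rightarrow> real"
  proof -
    have "integrable lborel (\<lambda>x. indicator (cball 0 (R + 1)) x *\<^sub>R F x)"
      using F(1) by (intro borel_integrable_compact) (auto intro: continuous_on_subset)
    moreover have "indicator (cball 0 (R + 1)) x *\<^sub>R F x = F x" for x
      using F(2)[of x] by (auto simp: indicator_def)
    ultimately show ?thesis by (simp only:)
  qed
  have i1: "integrable lborel \<phi>" by (rule cball[OF c\<phi> z(1)])
  have i2: "integrable lborel (\<lambda>x. (x \<bullet> e) * (e \<bullet> D\<phi> x))"
    by (rule cball) (auto intro!: continuous_intros c simp: z(2))
  have "(LINT x|lborel. D x) = 0"
  proof (rule integral_gradient_compact_support[where \<phi> = "\<lambda>x. (x \<bullet> e) * \<phi> x" and R = "R + 1"])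
    fix x
    show "((\<lambda>x. (x \<bullet> e) * \<phi> x) has_derivative (\<lambda>h. D x \<bullet> h)) (at x)"
      unfolding D_def by (auto intro!: derivative_eq_intros der simp: inner_add_left inner_commute algebra_simps)
    show "continuous_on UNIV D" unfolding D_def by (intro continuous_intros c c\<phi>)
  qed (auto simp: z D_def)
  moreover have "integrable lborel D"
  proof -
    have "integrable lborel (\<lambda>x. D x \<bullet> b)" for b
      by (rule cball) (auto simp: D_def z intro!: continuous_intros c c\<phi>)
    then have "integrable lborel (\<lambda>x. \<Sum>b\<in>Basis. (D x \<bullet> b) *\<^sub>R b)"
      by (intro Bochner_Integration.integrable_sum integrable_scaleR_left) auto
    then show ?thesis by (simp add: euclidean_representation)
  qed
  ultimately have "(LINT x|lborel. D x \<bullet> e) = 0" by simp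
  moreover have "D x \<bullet> e = \<phi> x + (x \<bullet> e) * (e \<bullet> D\<phi> x)" for x
    using e by (simp add: D_def inner_add_left inner_add_right norm_eq_1 inner_commute)
  ultimately have sum0: "(LINT x|lborel. \<phi> x) + (LINT x|lborel. (x \<bullet> e) * (e \<bullet> D\<phi> x)) = 0"
    using i1 i2 by simp
  have out: "\<phi> x = 0" "D\<phi> x = 0" if "x \<notin> \<Omega>" for x
    using C1c_gradient_zero[OF \<phi>, of x] that supp(2) by auto
  have "(LINT x:\<Omega>|lebesgue. ((x \<bullet> e) *\<^sub>R e) \<bullet> D\<phi> x) = (LINT x|lebesgue. (x \<bullet> e) * (e \<bullet> D\<phi> x))"
    unfolding set_lebesgue_integral_def
    by (intro Bochner_Integration.integral_cong) (auto simp: indicator_def out)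
  moreover have "(LINT x:\<Omega>|lebesgue. 1 * \<phi> x) = (LINT x|lebesgue. \<phi> x)"
    unfolding set_lebesgue_integral_def
    by (intro Bochner_Integration.integral_cong) (auto simp: indicator_def out)
  ultimately show ?thesis using sum0 by (simp add: integral_completion)
qed

lemma max0_powr_bound:
  fixes x t k b :: real
  assumes "x \<le> t" "1 < b"
  shows "\<bar>max 0 (x - k) powr b\<bar> \<le> max 0 (t - k) powr b"
    "\<bar>b * max 0 (x - k) powr (b - 1)\<bar> \<le> b * max 0 (t - k) powr (b - 1)"
  using assms by (auto simp: abs_mult intro!: powr_mono2 mult_left_mono)

section \<open>Limits of truncated test functions and a weighted Poincare inequality\<close>

text \<open>Fixes one approximating sequence for all later limits. The levels \<open>k\<close>, the
  upper bounds \<open>t\<close>, the power \<open>b\<close> and the field \<open>A\<close> vary over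
  it, while \<open>K\<close> and the sequence stay the same throughout the descent.\<close>

locale smooth_approximation =
  fixes \<Omega> K :: "'a::euclidean_space set" and p k0 :: real and h :: "'a \<Rightarrow> real" and Dh :: "'a \<Rightarrow> 'a"
    and H :: "nat \<Rightarrow> 'a \<Rightarrow> real" and DH :: "nat \<Rightarrow> 'a \<Rightarrow> 'a"
  assumes open_\<Omega>: "open \<Omega>" and p: "1 < p" and W: "W1p_loc p \<Omega> h Dh"
    and K: "compact K" "K \<subseteq> \<Omega>"
    and derH: "\<And>j x. (H j has_derivative (\<lambda>t. DH j x \<bullet> t)) (at x)"
    and contDH: "\<And>j. continuous_on UNIV (DH j)"
    and outK: "\<And>j x. x \<notin> K \<Longrightarrow> H j x \<le> k0"
    and upper: "\<And>t j x. 0 \<le> t \<Longrightarrow> AE x in lebesgue. x \<in> \<Omega> \<longrightarrow> h x \<le> t \<Longrightarrow> H j x \<le> t"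
    and limH: "AE x in lebesgue. x \<in> K \<longrightarrow> (\<lambda>j. H j x) \<longlonglongrightarrow> h x"
    and limDH: "(\<lambda>j. \<integral>\<^sup>+ x. ennreal (indicator K x * norm (DH j x - Dh x) powr p) \<partial>lebesgue) \<longlonglongrightarrow> 0"
begin

lemma K_lebesgue: "K \<in> sets lebesgue"
  using K by (simp add: lmeasurable_compact fmeasurableD)

lemma AE_K_iff: "(AE x in lebesgue_on K. P x) \<longleftrightarrow> (AE x in lebesgue. x \<in> K \<longrightarrow> P x)"
  using K_lebesgue by (intro AE_restrict_space_iff) auto

lemma integrable_K_iff:
  fixes F :: "'a \<Rightarrow> 'b::euclidean_space"
  shows "integrable (lebesgue_on K) F \<longleftrightarrow> set_integrable lebesgue K F"
  using K_lebesgue by (auto simp: integrable_restrict_space set_integrable_def)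

lemma finite_measure_K: "finite_measure (lebesgue_on K)"
  using K by (intro finite_measure_lebesgue_on lmeasurable_compact)

lemma measurable_K:
  fixes F :: "'a \<Rightarrow> 'b::euclidean_space"
  assumes "F \<in> borel_measurable (lebesgue_on \<Omega>)"
  shows "F \<in> borel_measurable (lebesgue_on K)"
  using assms K(2) by (rule measurable_restrict_mono)

lemma measurable_K_borel:
  fixes F :: "'a \<Rightarrow> 'b::euclidean_space"
  assumes "F \<in> borel_measurable borel"
  shows "F \<in> borel_measurable (lebesgue_on K)"
  using assms by (intro measurable_restrict_space1 measurable_completion) auto

lemma set_integral_\<Omega>_eq_K:
  fixes F :: "'a \<Rightarrow> real"
  assumes "\<And>x. x \<notin> K \<Longrightarrow> F x = 0"
  shows "(LINT x:\<Omega>|lebesgue. F x) = (LINT x|lebesgue_on K. F x)"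
proof -
  have "(LINT x|lebesgue_on K. F x) = (LINT x|lebesgue. indicator K x *\<^sub>R F x)"
    using K_lebesgue by (intro integral_restrict_space) auto
  also have "\<dots> = (LINT x:\<Omega>|lebesgue. F x)"
    unfolding set_lebesgue_integral_def using K(2) assms
    by (intro Bochner_Integration.integral_cong) (auto simp: indicator_def)
  finally show ?thesis by simp
qed

lemma h_measurable: "h \<in> borel_measurable (lebesgue_on K)"
  and Dh_measurable: "Dh \<in> borel_measurable (lebesgue_on K)"
  using W by (auto simp: W1p_loc_def Lp_loc_def intro: measurable_K)

lemma contH: "continuous_on UNIV (H j)"
  by (rule has_derivative_continuous_on) (rule derH)

lemma H_measurable: "H j \<in> borel_measurable (lebesgue_on K)"
  and DH_measurable: "DH j \<in> borel_measurable (lebesgue_on K)"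
  using contH contDH by (auto intro: measurable_K_borel borel_measurable_continuous_onI)

lemma Dh_powr_integrable: "integrable (lebesgue_on K) (\<lambda>x. norm (Dh x) powr p)"
  using W K by (auto simp: integrable_K_iff W1p_loc_def Lp_loc_def)

text \<open>Outside \<open>K\<close> the approximants do not exceed \<open>k0\<close>, so truncating
  at a level \<open>k \<ge> k0\<close> confines the support to \<open>K\<close>;
  \<open>b > 1\<close> makes the truncated power continuously differentiable.\<close>

lemma C1c_truncation:
  assumes k: "k0 \<le> k" and b: "1 < b"
  shows "C1c \<Omega> (\<lambda>x. max 0 (H j x - k) powr b) (\<lambda>x. (b * max 0 (H j x - k) powr (b - 1)) *\<^sub>R DH j x)"
  unfolding C1c_def
proof (intro conjI allI)
  fix x
  have 1: "((\<lambda>x. H j x - k) has_derivative (\<lambda>t. DH j x \<bullet> t)) (at x)"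
    by (auto intro!: derivative_eq_intros derH)
  have "((\<lambda>t. max 0 t powr b) has_derivative (*) (b * max 0 (H j x - k) powr (b - 1))) (at (H j x - k))"
    using max0_powr_has_derivative[OF b] by (simp add: has_field_derivative_def)
  from diff_chain_at[OF 1 this]
  show "((\<lambda>x. max 0 (H j x - k) powr b) has_derivative (\<lambda>t. (b * max 0 (H j x - k) powr (b - 1)) *\<^sub>R DH j x \<bullet> t)) (at x)"
    by (simp add: o_def)
  show "continuous_on UNIV (\<lambda>x. (b * max 0 (H j x - k) powr (b - 1)) *\<^sub>R DH j x)"
    using b by (intro continuous_intros continuous_on_powr' contDH contH) auto
  have "{x. max 0 (H j x - k) powr b \<noteq> 0} \<subseteq> K"
  proof
    fix x assume "x \<in> {x. max 0 (H j x - k) powr b \<noteq> 0}"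
    then have "k0 < H j x" using k by (auto simp: max_def split: if_splits)
    then show "x \<in> K" using outK[of x j] by auto
  qed
  then have s: "supp_closure (\<lambda>x. max 0 (H j x - k) powr b) \<subseteq> K"
    unfolding supp_closure_def using K by (intro closure_minimal) (auto intro: compact_imp_closed)
  then show "supp_closure (\<lambda>x. max 0 (H j x - k) powr b) \<subseteq> \<Omega>" using K by blast
  show "compact (supp_closure (\<lambda>x. max 0 (H j x - k) powr b))"
    using s compact_imp_bounded[OF K(1)] unfolding supp_closure_def
    by (meson bounded_subset closed_closure compact_eq_bounded_closed)
qed

lemma truncation_integrable:
  assumes t: "AE x in lebesgue. x \<in> \<Omega> \<longrightarrow> h x \<le> t" and b: "1 < b"
    and A: "Lp_loc (p / (p - 1)) \<Omega> A" and B: "integrable (lebesgue_on K) B"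
  shows "integrable (lebesgue_on K) (\<lambda>x. (b * max 0 (h x - k) powr (b - 1)) * (A x \<bullet> Dh x))"
    and "integrable (lebesgue_on K) (\<lambda>x. B x * max 0 (h x - k) powr b)"
proof -
  note [measurable] = h_measurable Dh_measurable
  have [measurable]: "A \<in> borel_measurable (lebesgue_on K)" using A by (auto simp: Lp_loc_def intro: measurable_K)
  have [measurable]: "B \<in> borel_measurable (lebesgue_on K)" using B by auto
  have ht: "AE x in lebesgue_on K. h x \<le> t"
    unfolding AE_K_iff using t K(2) by (auto elim: eventually_mono)
  show "integrable (lebesgue_on K) (\<lambda>x. (b * max 0 (h x - k) powr (b - 1)) * (A x \<bullet> Dh x))"
  proof (rule integrable_weighted_pairing[OF _ _ _ p _ Dh_powr_integrable])
    show "integrable (lebesgue_on K) (\<lambda>x. norm (A x) powr (p / (p - 1)))"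
      using A K by (auto simp: integrable_K_iff Lp_loc_def)
    show "AE x in lebesgue_on K. \<bar>b * max 0 (h x - k) powr (b - 1)\<bar> \<le> b * max 0 (t - k) powr (b - 1)"
      using ht by eventually_elim (intro max0_powr_bound b)
  qed measurable
  show "integrable (lebesgue_on K) (\<lambda>x. B x * max 0 (h x - k) powr b)"
  proof (rule Bochner_Integration.integrable_bound)
    show "integrable (lebesgue_on K) (\<lambda>x. norm (B x) * max 0 (t - k) powr b)" using B by auto
    show "AE x in lebesgue_on K. norm (B x * max 0 (h x - k) powr b) \<le> norm (norm (B x) * max 0 (t - k) powr b)"
      using ht
    proof eventually_elim
      case (elim x)
      then show ?case using max0_powr_bound(1)[OF elim b, of k] by (simp add: abs_mult mult_left_mono)
    qed
  qed measurable
qed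

text \<open>On \<open>K\<close> the weights are bounded through \<open>t\<close> and converge almost
  everywhere, while the gradients converge in the p-th mean against a field of conjugate
  integrability. The value \<open>b = 2\<close> serves the two differential inequalities,
  \<open>b = p + 1\<close> the Poincare inequality.\<close>

lemma test_limit:
  assumes k: "k0 \<le> k" and t: "0 \<le> t" "AE x in lebesgue. x \<in> \<Omega> \<longrightarrow> h x \<le> t" and b: "1 < b"
    and A: "Lp_loc (p / (p - 1)) \<Omega> A" and B: "integrable (lebesgue_on K) B"
  shows "(\<lambda>j. (LINT x:\<Omega>|lebesgue. A x \<bullet> ((b * max 0 (H j x - k) powr (b - 1)) *\<^sub>R DH j x)) +
       (LINT x:\<Omega>|lebesgue. B x * max 0 (H j x - k) powr b)) \<longlonglongrightarrow>
     (LINT x|lebesgue_on K. (b * max 0 (h x - k) powr (b - 1)) * (A x \<bullet> Dh x)) +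
     (LINT x|lebesgue_on K. B x * max 0 (h x - k) powr b)"
proof (rule tendsto_add)
  note [measurable] = h_measurable Dh_measurable H_measurable DH_measurable
  have [measurable]: "A \<in> borel_measurable (lebesgue_on K)" using A by (auto simp: Lp_loc_def intro: measurable_K)
  have Hk: "max 0 (H j x - k) = 0" if "x \<notin> K" for j x
    using outK[OF that, of j] k by simp
  have lim: "AE x in lebesgue_on K. (\<lambda>j. H j x) \<longlonglongrightarrow> h x"
    unfolding AE_K_iff by (rule limH)
  have lim_powr: "AE x in lebesgue_on K. (\<lambda>j. max 0 (H j x - k) powr c) \<longlonglongrightarrow> max 0 (h x - k) powr c" if "0 < c" for c
    using lim
  proof eventually_elim
    case (elim x)
    then show ?case using that by (intro tendsto_powr' tendsto_intros) auto
  qed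
  have Ht: "H j x \<le> t" for j x using upper[OF t] .
  have DH: "(\<lambda>j. \<integral>\<^sup>+ x. ennreal (norm (DH j x - Dh x) powr p) \<partial>lebesgue_on K) \<longlonglongrightarrow> 0"
  proof -
    have "(\<integral>\<^sup>+ x. ennreal (norm (DH j x - Dh x) powr p) \<partial>lebesgue_on K) =
      (\<integral>\<^sup>+ x. ennreal (indicator K x * norm (DH j x - Dh x) powr p) \<partial>lebesgue)" for j
      using K_lebesgue by (subst nn_integral_restrict_space) (auto intro!: nn_integral_cong simp: indicator_def)
    then show ?thesis using limDH by simp
  qed
  have "(\<lambda>j. LINT x|lebesgue_on K. (b * max 0 (H j x - k) powr (b - 1)) * (A x \<bullet> DH j x)) \<longlonglongrightarrow>
    (LINT x|lebesgue_on K. (b * max 0 (h x - k) powr (b - 1)) * (A x \<bullet> Dh x))"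
  proof (rule tendsto_integral_weighted_pairing[OF _ _ _ _ _ p _ Dh_powr_integrable _ _ _ DH])
    show "integrable (lebesgue_on K) (\<lambda>x. norm (A x) powr (p / (p - 1)))"
      using A K by (auto simp: integrable_K_iff Lp_loc_def)
    show "AE x in lebesgue_on K. \<bar>b * max 0 (H j x - k) powr (b - 1)\<bar> \<le> b * max 0 (t - k) powr (b - 1)" for j
      by (intro AE_I2 max0_powr_bound b Ht)
    show "AE x in lebesgue_on K. (\<lambda>j. b * max 0 (H j x - k) powr (b - 1)) \<longlonglongrightarrow> b * max 0 (h x - k) powr (b - 1)"
      using lim_powr[of "b - 1"] b by (auto elim!: eventually_mono intro: tendsto_mult_left)
    show "integrable (lebesgue_on K) (\<lambda>x. (b * max 0 (H j x - k) powr (b - 1)) * (A x \<bullet> DH j x))" for j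
    \<comment> \<open>A continuous gradient is bounded on the compact set \<open>K\<close>, and
      \<open>A\<close> is integrable there.\<close>
    proof -
      obtain C where C: "\<And>x. x \<in> K \<Longrightarrow> norm (DH j x) \<le> C"
        using compact_imp_bounded[OF compact_continuous_image[OF continuous_on_subset[OF contDH[of j] subset_UNIV] K(1)]]
        by (auto simp: bounded_iff)
      have iA: "integrable (lebesgue_on K) A"
        unfolding integrable_K_iff
        by (rule Lp_loc_set_integrable[OF A _ _ K]) (use p open_\<Omega> in \<open>auto simp: field_simps\<close>)
      show ?thesis
      proof (rule Bochner_Integration.integrable_bound)
        show "integrable (lebesgue_on K) (\<lambda>x. b * max 0 (t - k) powr (b - 1) * (norm (A x) * C))" using iA by auto
        show "AE x in lebesgue_on K. norm (b * max 0 (H j x - k) powr (b - 1) * (A x \<bullet> DH j x)) \<le>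
          norm (b * max 0 (t - k) powr (b - 1) * (norm (A x) * C))"
        proof (rule AE_I2)
          fix x assume "x \<in> space (lebesgue_on K)"
          then have x: "x \<in> K" by simp
          have "\<bar>A x \<bullet> DH j x\<bar> \<le> norm (A x) * C"
            using Cauchy_Schwarz_ineq2[of "A x" "DH j x"] C[OF x] mult_left_mono[OF C[OF x], of "norm (A x)"] by simp
          then have "norm (b * max 0 (H j x - k) powr (b - 1) * (A x \<bullet> DH j x)) \<le>
            b * max 0 (t - k) powr (b - 1) * (norm (A x) * C)"
            unfolding real_norm_def abs_mult[of "b * _"] using b
            by (intro mult_mono max0_powr_bound b Ht) auto
          then show "norm (b * max 0 (H j x - k) powr (b - 1) * (A x \<bullet> DH j x)) \<le>
            norm (b * max 0 (t - k) powr (b - 1) * (norm (A x) * C))" by (rule order_trans) simp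
        qed
      qed measurable
    qed
  qed measurable
  moreover have "(LINT x:\<Omega>|lebesgue. A x \<bullet> ((b * max 0 (H j x - k) powr (b - 1)) *\<^sub>R DH j x)) =
    (LINT x|lebesgue_on K. (b * max 0 (H j x - k) powr (b - 1)) * (A x \<bullet> DH j x))" for j
    by (subst set_integral_\<Omega>_eq_K) (use b in \<open>auto simp: Hk\<close>)
  ultimately show "(\<lambda>j. LINT x:\<Omega>|lebesgue. A x \<bullet> ((b * max 0 (H j x - k) powr (b - 1)) *\<^sub>R DH j x)) \<longlonglongrightarrow>
     (LINT x|lebesgue_on K. (b * max 0 (h x - k) powr (b - 1)) * (A x \<bullet> Dh x))" by simp
  have "(\<lambda>j. LINT x|lebesgue_on K. B x * max 0 (H j x - k) powr b) \<longlonglongrightarrow> (LINT x|lebesgue_on K. B x * max 0 (h x - k) powr b)"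
  proof (rule tendsto_integral_weighted[OF _ _ B])
    show "AE x in lebesgue_on K. \<bar>max 0 (H j x - k) powr b\<bar> \<le> max 0 (t - k) powr b" for j
      by (intro AE_I2 max0_powr_bound b Ht)
  qed (use b lim_powr[of b] in auto)
  moreover have "(LINT x:\<Omega>|lebesgue. B x * max 0 (H j x - k) powr b) = (LINT x|lebesgue_on K. B x * max 0 (H j x - k) powr b)" for j
    by (subst set_integral_\<Omega>_eq_K) (use b in \<open>auto simp: Hk\<close>)
  ultimately show "(\<lambda>j. LINT x:\<Omega>|lebesgue. B x * max 0 (H j x - k) powr b) \<longlonglongrightarrow>
    (LINT x|lebesgue_on K. B x * max 0 (h x - k) powr b)" by simp
qed

lemma truncation_energy_integrable:
  assumes t: "AE x in lebesgue. x \<in> \<Omega> \<longrightarrow> h x \<le> t"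
  shows "integrable (lebesgue_on K) (\<lambda>x. max 0 (h x - k) * norm (Dh x) powr p)"
    and "integrable (lebesgue_on K) (\<lambda>x. max 0 (h x - k) powr (p + 1))"
proof -
  note [measurable] = h_measurable Dh_measurable
  have ht: "AE x in lebesgue_on K. h x \<le> t"
    unfolding AE_K_iff using t K(2) by (auto elim: eventually_mono)
  show "integrable (lebesgue_on K) (\<lambda>x. max 0 (h x - k) * norm (Dh x) powr p)"
  proof (rule Bochner_Integration.integrable_bound)
    show "integrable (lebesgue_on K) (\<lambda>x. max 0 (t - k) * norm (Dh x) powr p)" using Dh_powr_integrable by auto
    show "AE x in lebesgue_on K. norm (max 0 (h x - k) * norm (Dh x) powr p) \<le> norm (max 0 (t - k) * norm (Dh x) powr p)"
      using ht by eventually_elim (auto simp: abs_mult intro!: mult_right_mono)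
  qed measurable
  interpret finite_measure "lebesgue_on K" by (rule finite_measure_K)
  show "integrable (lebesgue_on K) (\<lambda>x. max 0 (h x - k) powr (p + 1))"
  proof (rule integrable_const_bound[where B = "max 0 (t - k) powr (p + 1)"])
    show "AE x in lebesgue_on K. norm (max 0 (h x - k) powr (p + 1)) \<le> max 0 (t - k) powr (p + 1)"
      using ht by eventually_elim (use p in \<open>auto intro!: powr_mono2\<close>)
  qed measurable
qed

text \<open>A Poincare inequality: integrate the divergence of \<open>max 0 (h - k) powr (p + 1)\<close>
  times the field \<open>(x \<bullet> e) e\<close>, whose divergence is \<open>1\<close>.\<close>

lemma truncation_poincare:
  assumes k: "k0 \<le> k" and t: "0 \<le> t" "AE x in lebesgue. x \<in> \<Omega> \<longrightarrow> h x \<le> t"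
    and R: "0 < R" "\<And>x. x \<in> K \<Longrightarrow> norm x \<le> R"
  shows "(LINT x|lebesgue_on K. max 0 (h x - k) powr (p + 1)) \<le>
    (2 * (p + 1) * R) powr p * (LINT x|lebesgue_on K. max 0 (h x - k) * norm (Dh x) powr p)"
proof -
  obtain e :: 'a where e: "e \<in> Basis" using nonempty_Basis by blast
  then have e1: "norm e = 1" by simp
  define A where "A x = (x \<bullet> e) *\<^sub>R e" for x :: 'a
  have cA: "continuous_on S A" for S unfolding A_def by (intro continuous_intros)
  have A: "Lp_loc (p / (p - 1)) \<Omega> A"
    unfolding Lp_loc_def
  proof (intro conjI allI impI)
    show "A \<in> borel_measurable (lebesgue_on \<Omega>)"
      using cA by (intro measurable_restrict_space1 measurable_completion) (auto intro: borel_measurable_continuous_onI)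
    fix L assume L: "compact L" "L \<subseteq> \<Omega>"
    have "integrable lborel (\<lambda>x. indicator L x *\<^sub>R (norm (A x) powr (p / (p - 1))))"
      using L p by (intro borel_integrable_compact continuous_on_powr' continuous_intros cA) auto
    then show "set_integrable lebesgue L (\<lambda>x. norm (A x) powr (p / (p - 1)))"
      unfolding set_integrable_def by (subst integrable_completion) auto
  qed
  interpret finite_measure "lebesgue_on K" by (rule finite_measure_K)
  have B: "integrable (lebesgue_on K) (\<lambda>x. 1::real)" by simp
  have b: "1 < p + 1" using p by simp
  define z where "z x = max 0 (h x - k)" for x
  define s where "s x = norm (Dh x)" for x
  have z0: "0 \<le> z x" for x by (simp add: z_def)
  have iz: "integrable (lebesgue_on K) (\<lambda>x. z x powr (p + 1))"
    and izs: "integrable (lebesgue_on K) (\<lambda>x. z x * s x powr p)"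
    using truncation_energy_integrable[OF t(2), of k] by (auto simp: z_def s_def)
  \<comment> \<open>Every smooth truncation satisfies the identity exactly, so the limit is that of
    the constant sequence 0.\<close>
  have "(LINT x:\<Omega>|lebesgue. A x \<bullet> (((p + 1) * max 0 (H j x - k) powr (p + 1 - 1)) *\<^sub>R DH j x)) +
       (LINT x:\<Omega>|lebesgue. 1 * max 0 (H j x - k) powr (p + 1)) = 0" for j
    using C1c_integration_by_parts_linear[OF C1c_truncation[OF k b] e1] by (simp add: A_def)
  then have "(\<lambda>j. 0) \<longlonglongrightarrow> (LINT x|lebesgue_on K. ((p + 1) * z x powr (p + 1 - 1)) * (A x \<bullet> Dh x)) +
     (LINT x|lebesgue_on K. 1 * z x powr (p + 1))"
    using test_limit[OF k t b A B] unfolding z_def by (simp only:)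
  then have eq: "(LINT x|lebesgue_on K. z x powr (p + 1)) = - (LINT x|lebesgue_on K. ((p + 1) * z x powr p) * (A x \<bullet> Dh x))"
    by (simp add: LIMSEQ_const_iff)
  \<comment> \<open>Makes the coefficient of \<open>z x powr (p + 1)\<close> equal to 1/2, so that
    it is absorbed on the left.\<close>
  define \<eta> where "\<eta> = 1 / (2 * (p + 1) * R)"
  have \<eta>: "0 < \<eta>" using p R by (simp add: \<eta>_def)
  have iA: "integrable (lebesgue_on K) (\<lambda>x. ((p + 1) * z x powr p) * (A x \<bullet> Dh x))"
    using truncation_integrable(1)[OF t(2) b A B, of k] by (simp add: z_def)
  have "(LINT x|lebesgue_on K. z x powr (p + 1)) = (LINT x|lebesgue_on K. - (((p + 1) * z x powr p) * (A x \<bullet> Dh x)))"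
    using eq by simp
  also have "\<dots> \<le> (LINT x|lebesgue_on K. 1 / 2 * z x powr (p + 1) + (p + 1) * R * \<eta> powr (1 - p) * (z x * s x powr p))"
  proof (rule integral_mono)
    fix x assume "x \<in> space (lebesgue_on K)"
    then have x: "x \<in> K" by simp
    have "\<bar>A x \<bullet> Dh x\<bar> \<le> norm (A x) * norm (Dh x)" by (rule Cauchy_Schwarz_ineq2)
    also have "norm (A x) \<le> R"
      using Cauchy_Schwarz_ineq2[of x e] R(2)[OF x] e1 by (simp add: A_def)
    finally have "\<bar>A x \<bullet> Dh x\<bar> \<le> R * s x" by (simp add: s_def mult_right_mono)
    then have "- (((p + 1) * z x powr p) * (A x \<bullet> Dh x)) \<le> ((p + 1) * z x powr p) * (R * s x)"
      using p mult_left_mono[of "- (A x \<bullet> Dh x)" "R * s x" "(p + 1) * z x powr p"] by simp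
    \<comment> \<open>One factor \<open>z x\<close> is set aside before Young's inequality; it
      becomes the weight of the energy.\<close>
    also have "\<dots> = (p + 1) * R * z x * (z x powr (p - 1) * s x)"
      using z0[of x] p by (cases "z x = 0") (auto simp: powr_diff)
    also have "\<dots> \<le> (p + 1) * R * z x * (\<eta> * z x powr p + \<eta> powr (1 - p) * s x powr p)"
      using p R z0[of x] \<eta> by (intro mult_left_mono powr_mult_le_weighted) (auto simp: s_def)
    also have "\<dots> = ((p + 1) * R * \<eta>) * (z x * z x powr p) + (p + 1) * R * \<eta> powr (1 - p) * (z x * s x powr p)"
      by (simp add: algebra_simps)
    also have "(p + 1) * R * \<eta> = 1 / 2" using p R by (simp add: \<eta>_def)
    also have "z x * z x powr p = z x powr (p + 1)" using z0[of x] by (cases "z x = 0") (auto simp: powr_add)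
    finally show "- (((p + 1) * z x powr p) * (A x \<bullet> Dh x)) \<le>
      1 / 2 * z x powr (p + 1) + (p + 1) * R * \<eta> powr (1 - p) * (z x * s x powr p)" .
  qed (use iA iz izs in auto)
  also have "\<dots> = 1 / 2 * (LINT x|lebesgue_on K. z x powr (p + 1)) +
    (p + 1) * R * \<eta> powr (1 - p) * (LINT x|lebesgue_on K. z x * s x powr p)"
    using iz izs by simp
  finally have "(LINT x|lebesgue_on K. z x powr (p + 1)) \<le>
    (2 * (p + 1) * R) * \<eta> powr (1 - p) * (LINT x|lebesgue_on K. z x * s x powr p)" by (simp add: algebra_simps)
  also have "(2 * (p + 1) * R) * \<eta> powr (1 - p) = (2 * (p + 1) * R) powr p"
  proof -
    define q where "q = 2 * (p + 1) * R"
    have q: "0 < q" using p R by (simp add: q_def)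
    have "\<eta> powr (1 - p) = q powr (p - 1)"
      using q unfolding \<eta>_def q_def[symmetric] by (simp add: powr_divide powr_diff)
    then show ?thesis using q unfolding q_def[symmetric] by (simp add: powr_diff)
  qed
  finally show ?thesis by (simp add: z_def s_def)
qed

end

subsection \<open>Superposition operators and the comparison argument\<close>

lemma Lp_loc_scale_diff:
  fixes u v :: "'a::euclidean_space \<Rightarrow> 'b::euclidean_space"
  assumes u: "Lp_loc p \<Omega> u" and v: "Lp_loc p \<Omega> v" and p: "0 \<le> p"
  shows "Lp_loc p \<Omega> (\<lambda>x. \<delta> *\<^sub>R u x - v x)"
  unfolding Lp_loc_def
proof (intro conjI allI impI)
  have um: "u \<in> borel_measurable (lebesgue_on \<Omega>)" and vm: "v \<in> borel_measurable (lebesgue_on \<Omega>)"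
    using u v by (auto simp: Lp_loc_def)
  then show m: "(\<lambda>x. \<delta> *\<^sub>R u x - v x) \<in> borel_measurable (lebesgue_on \<Omega>)" by measurable
  fix K assume K: "compact K" "K \<subseteq> \<Omega>"
  have Kl: "K \<in> sets lebesgue" using K by (simp add: lmeasurable_compact fmeasurableD)
  have "integrable (lebesgue_on K) (\<lambda>x. norm (\<delta> *\<^sub>R u x - v x) powr p)"
  proof (rule Bochner_Integration.integrable_bound)
    have "integrable (lebesgue_on K) (\<lambda>x. norm (u x) powr p)" "integrable (lebesgue_on K) (\<lambda>x. norm (v x) powr p)"
      using u v K Kl by (auto simp: Lp_loc_def integrable_restrict_space set_integrable_def)
    then show "integrable (lebesgue_on K) (\<lambda>x. 2 powr p * (\<bar>\<delta>\<bar> powr p * norm (u x) powr p + norm (v x) powr p))" by auto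
    show "(\<lambda>x. norm (\<delta> *\<^sub>R u x - v x) powr p) \<in> borel_measurable (lebesgue_on K)"
      using measurable_restrict_mono[OF m K(2)] by measurable
    show "AE x in lebesgue_on K. norm (norm (\<delta> *\<^sub>R u x - v x) powr p) \<le>
      norm (2 powr p * (\<bar>\<delta>\<bar> powr p * norm (u x) powr p + norm (v x) powr p))"
    proof (rule AE_I2)
      fix x
      have "norm (\<delta> *\<^sub>R u x - v x) powr p \<le> (\<bar>\<delta>\<bar> * norm (u x) + norm (v x)) powr p"
        using p norm_triangle_ineq4[of "\<delta> *\<^sub>R u x" "v x"] by (intro powr_mono2) auto
      also have "\<dots> \<le> 2 powr p * ((\<bar>\<delta>\<bar> * norm (u x)) powr p + norm (v x) powr p)"
        using p by (intro add_powr_le) auto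
      finally show "norm (norm (\<delta> *\<^sub>R u x - v x) powr p) \<le>
        norm (2 powr p * (\<bar>\<delta>\<bar> powr p * norm (u x) powr p + norm (v x) powr p))"
        by (simp add: powr_mult)
    qed
  qed
  then show "set_integrable lebesgue K (\<lambda>x. norm (\<delta> *\<^sub>R u x - v x) powr p)"
    using Kl by (auto simp: integrable_restrict_space set_integrable_def)
qed

lemma C1c_bounded:
  assumes "C1c \<Omega> \<phi> D\<phi>"
  obtains B where "\<And>x. \<bar>\<phi> x\<bar> \<le> B" "\<And>x. norm (D\<phi> x) \<le> B"
proof -
  have supp: "compact (supp_closure \<phi>)" and c: "continuous_on UNIV D\<phi>"
    and der: "\<And>x. (\<phi> has_derivative (\<lambda>h. D\<phi> x \<bullet> h)) (at x)"
    using assms by (auto simp: C1c_def)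
  obtain R where R: "\<And>x. x \<in> supp_closure \<phi> \<Longrightarrow> norm x \<le> R"
    using compact_imp_bounded[OF supp(1)] by (auto simp: bounded_iff)
  have z: "\<phi> x = 0" "D\<phi> x = 0" if "R + 1 \<le> norm x" for x
    using C1c_gradient_zero[OF assms, of x] R[of x] that by force+
  have c\<phi>: "continuous_on UNIV \<phi>"
    by (rule has_derivative_continuous_on) (rule der)
  obtain B1 where B1: "\<And>x. norm (\<phi> x) \<le> B1" by (rule bounded_compact_support[OF c\<phi> z(1)]) auto
  obtain B2 where B2: "\<And>x. norm (D\<phi> x) \<le> B2" by (rule bounded_compact_support[OF c z(2)]) auto
  show ?thesis
  proof (rule that[of "max B1 B2"])
    show "\<bar>\<phi> x\<bar> \<le> max B1 B2" "norm (D\<phi> x) \<le> max B1 B2" for x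
      using B1[of x] B2[of x] by auto
  qed
qed

lemma W1p_loc_scale_diff:
  fixes u v :: "'a::euclidean_space \<Rightarrow> real"
  assumes u: "W1p_loc p \<Omega> u Du" and v: "W1p_loc p \<Omega> v Dv" and p: "1 \<le> p" and \<Omega>: "open \<Omega>"
  shows "W1p_loc p \<Omega> (\<lambda>x. \<delta> * u x - v x) (\<lambda>x. \<delta> *\<^sub>R Du x - Dv x)"
  unfolding W1p_loc_def
proof (intro conjI allI impI)
  have L: "Lp_loc p \<Omega> u" "Lp_loc p \<Omega> v" "Lp_loc p \<Omega> Du" "Lp_loc p \<Omega> Dv"
    using u v by (auto simp: W1p_loc_def)
  show "Lp_loc p \<Omega> (\<lambda>x. \<delta> * u x - v x)" using Lp_loc_scale_diff[OF L(1,2), of \<delta>] p by simp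
  show "Lp_loc p \<Omega> (\<lambda>x. \<delta> *\<^sub>R Du x - Dv x)" using Lp_loc_scale_diff[OF L(3,4), of \<delta>] p by simp
  fix \<phi> D\<phi> assume \<phi>: "C1c \<Omega> \<phi> D\<phi>"
  define K where "K = supp_closure \<phi>"
  have K: "compact K" "K \<subseteq> \<Omega>" and c: "continuous_on UNIV D\<phi>"
    and der: "\<And>x. (\<phi> has_derivative (\<lambda>h. D\<phi> x \<bullet> h)) (at x)"
    using \<phi> by (auto simp: C1c_def K_def)
  have z: "\<phi> x = 0" "D\<phi> x = 0" if "x \<notin> K" for x
    using C1c_gradient_zero[OF \<phi>] that by (auto simp: K_def)
  have c\<phi>: "continuous_on UNIV \<phi>"
    by (rule has_derivative_continuous_on) (rule der)
  have [measurable]: "\<phi> \<in> borel_measurable lebesgue" "D\<phi> \<in> borel_measurable lebesgue"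
    using c c\<phi> by (auto intro!: measurable_completion intro: borel_measurable_continuous_onI)
  obtain B where B: "\<And>x. \<bar>\<phi> x\<bar> \<le> B" "\<And>x. norm (D\<phi> x) \<le> B" using C1c_bounded[OF \<phi>] by blast
  have i1: "set_integrable lebesgue \<Omega> (\<lambda>x. w x *\<^sub>R D\<phi> x)" if "Lp_loc p \<Omega> w" for w :: "'a \<Rightarrow> real"
  proof -
    have "integrable lebesgue (\<lambda>x. indicator K x *\<^sub>R w x)"
      using Lp_loc_set_integrable[OF that p _ K] \<Omega> by (simp add: set_integrable_def)
    from integrable_bounded_scaleR[OF \<open>D\<phi> \<in> borel_measurable lebesgue\<close> B(2) this]
    have "integrable lebesgue (\<lambda>x. (indicator K x *\<^sub>R w x) *\<^sub>R D\<phi> x)" .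
    moreover have "(indicator K x *\<^sub>R w x) *\<^sub>R D\<phi> x = indicator \<Omega> x *\<^sub>R w x *\<^sub>R D\<phi> x" for x
      using z[of x] K(2) by (auto simp: indicator_def)
    ultimately show ?thesis by (simp only: set_integrable_def)
  qed
  have i2: "set_integrable lebesgue \<Omega> (\<lambda>x. \<phi> x *\<^sub>R w x)" if "Lp_loc p \<Omega> w" for w :: "'a \<Rightarrow> 'a"
  proof -
    have "integrable lebesgue (\<lambda>x. indicator K x *\<^sub>R w x)"
      using Lp_loc_set_integrable[OF that p _ K] \<Omega> by (simp add: set_integrable_def)
    from integrable_scaleR_bounded[OF \<open>\<phi> \<in> borel_measurable lebesgue\<close> B(1) this]
    have "integrable lebesgue (\<lambda>x. \<phi> x *\<^sub>R (indicator K x *\<^sub>R w x))" .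
    moreover have "\<phi> x *\<^sub>R (indicator K x *\<^sub>R w x) = indicator \<Omega> x *\<^sub>R \<phi> x *\<^sub>R w x" for x
      using z[of x] K(2) by (auto simp: indicator_def)
    ultimately show ?thesis by (simp only: set_integrable_def)
  qed
  have weak: "(LINT x:\<Omega>|lebesgue. u x *\<^sub>R D\<phi> x) = - (LINT x:\<Omega>|lebesgue. \<phi> x *\<^sub>R Du x)"
    "(LINT x:\<Omega>|lebesgue. v x *\<^sub>R D\<phi> x) = - (LINT x:\<Omega>|lebesgue. \<phi> x *\<^sub>R Dv x)"
    using u v \<phi> unfolding W1p_loc_def by blast+
  have lin: "(LINT x:\<Omega>|lebesgue. \<delta> *\<^sub>R F x - G x) = \<delta> *\<^sub>R (LINT x:\<Omega>|lebesgue. F x) - (LINT x:\<Omega>|lebesgue. G x)"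
    if "set_integrable lebesgue \<Omega> F" "set_integrable lebesgue \<Omega> G" for F G :: "'a \<Rightarrow> 'a"
  proof -
    have "indicator \<Omega> x *\<^sub>R (\<delta> *\<^sub>R F x - G x) = \<delta> *\<^sub>R (indicator \<Omega> x *\<^sub>R F x) - indicator \<Omega> x *\<^sub>R G x" for x
      by (simp add: algebra_simps)
    moreover have "(LINT x|lebesgue. \<delta> *\<^sub>R (indicator \<Omega> x *\<^sub>R F x) - indicator \<Omega> x *\<^sub>R G x) =
      (LINT x|lebesgue. \<delta> *\<^sub>R (indicator \<Omega> x *\<^sub>R F x)) - (LINT x|lebesgue. indicator \<Omega> x *\<^sub>R G x)"
      using that unfolding set_integrable_def
      by (intro Bochner_Integration.integral_diff integrable_scaleR_right) auto
    ultimately show ?thesis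
      unfolding set_lebesgue_integral_def by (simp only: integral_scaleR_right)
  qed
  have "(LINT x:\<Omega>|lebesgue. (\<delta> * u x - v x) *\<^sub>R D\<phi> x) =
    (LINT x:\<Omega>|lebesgue. \<delta> *\<^sub>R (u x *\<^sub>R D\<phi> x) - v x *\<^sub>R D\<phi> x)" by (simp add: algebra_simps)
  also have "\<dots> = \<delta> *\<^sub>R (LINT x:\<Omega>|lebesgue. u x *\<^sub>R D\<phi> x) - (LINT x:\<Omega>|lebesgue. v x *\<^sub>R D\<phi> x)"
    by (rule lin[OF i1[OF L(1)] i1[OF L(2)]])
  also have "\<dots> = \<delta> *\<^sub>R (- (LINT x:\<Omega>|lebesgue. \<phi> x *\<^sub>R Du x)) - (- (LINT x:\<Omega>|lebesgue. \<phi> x *\<^sub>R Dv x))"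
    by (simp only: weak)
  also have "\<dots> = - (LINT x:\<Omega>|lebesgue. \<delta> *\<^sub>R (\<phi> x *\<^sub>R Du x) - \<phi> x *\<^sub>R Dv x)"
    by (simp only: lin[OF i2[OF L(3)] i2[OF L(4)]]) simp
  also have "(LINT x:\<Omega>|lebesgue. \<delta> *\<^sub>R (\<phi> x *\<^sub>R Du x) - \<phi> x *\<^sub>R Dv x) = (LINT x:\<Omega>|lebesgue. \<phi> x *\<^sub>R (\<delta> *\<^sub>R Du x - Dv x))"
    by (simp add: algebra_simps)
  finally show "(LINT x:\<Omega>|lebesgue. (\<delta> * u x - v x) *\<^sub>R D\<phi> x) = - (LINT x:\<Omega>|lebesgue. \<phi> x *\<^sub>R (\<delta> *\<^sub>R Du x - Dv x))" .
qed

section \<open>Superposition operators and integrability of the lower order terms\<close>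

lemma superposition_measurable:
  fixes g :: "'a::euclidean_space \<Rightarrow> real \<Rightarrow> real"
  assumes g: "continuous_on (\<Omega> \<times> UNIV) (\<lambda>(x, t). g x t)" and u: "u \<in> borel_measurable (lebesgue_on \<Omega>)"
  shows "(\<lambda>x. g x (u x)) \<in> borel_measurable (lebesgue_on \<Omega>)"
proof -
  have "(\<lambda>x. x) \<in> borel_measurable (lebesgue_on \<Omega>)"
    by (intro measurable_restrict_space1 measurable_completion) auto
  then have "(\<lambda>x. (x, u x)) \<in> borel_measurable (lebesgue_on \<Omega>)"
    using u by (rule borel_measurable_Pair)
  then have "(\<lambda>x. (x, u x)) \<in> lebesgue_on \<Omega> \<rightarrow>\<^sub>M restrict_space borel (\<Omega> \<times> UNIV)"
    by (intro measurable_restrict_space2) auto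
  from measurable_compose[OF this borel_measurable_continuous_on_restrict[OF g]] show ?thesis by simp
qed

lemma superposition_bounded:
  fixes g :: "'a::euclidean_space \<Rightarrow> real \<Rightarrow> real"
  assumes g: "continuous_on (\<Omega> \<times> UNIV) (\<lambda>(x, t). g x t)" and u: "Linf_loc \<Omega> u" and K: "compact K" "K \<subseteq> \<Omega>"
  obtains G where "0 \<le> G" "AE x in lebesgue. x \<in> K \<longrightarrow> \<bar>g x (u x)\<bar> \<le> G"
proof -
  obtain C where C: "AE x in lebesgue. x \<in> K \<longrightarrow> \<bar>u x\<bar> \<le> C" using u K by (auto simp: Linf_loc_def)
  have "compact ((\<lambda>(x, t). g x t) ` (K \<times> {-C..C}))"
    using K by (intro compact_continuous_image compact_Times continuous_on_subset[OF g]) auto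
  then obtain G where G: "\<And>y. y \<in> (\<lambda>(x, t). g x t) ` (K \<times> {-C..C}) \<Longrightarrow> norm y \<le> G"
    using compact_imp_bounded by (metis bounded_iff)
  show ?thesis
  proof (rule that[of "max 0 G"])
    show "AE x in lebesgue. x \<in> K \<longrightarrow> \<bar>g x (u x)\<bar> \<le> max 0 G"
      using C
    proof eventually_elim
      case (elim x)
      show ?case
      proof
        assume x: "x \<in> K"
        then have "(x, u x) \<in> K \<times> {-C..C}" using elim by auto
        then have "g x (u x) \<in> (\<lambda>(x, t). g x t) ` (K \<times> {-C..C})" by force
        from G[OF this] show "\<bar>g x (u x)\<bar> \<le> max 0 G" by simp
      qed
    qed
  qed simp
qed

text \<open>The part with \<open>f\<close> is integrable by the consistency condition. In the other
  part \<open>g x (u x)\<close> is bounded on \<open>K\<close> because \<open>u\<close> is, and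
  \<sigma> \<le> p gives |Du|^\<sigma> \<le> 1 + |Du|^p.\<close>

lemma lower_order_integrable:
  fixes g :: "'a::euclidean_space \<Rightarrow> real \<Rightarrow> real"
  assumes g: "continuous_on (\<Omega> \<times> UNIV) (\<lambda>(x, t). g x t)" and u: "Linf_loc \<Omega> u"
    and Du: "Lp_loc p \<Omega> Du" and f: "Lp_loc q \<Omega> (\<lambda>x. f x (u x))" and q: "1 \<le> q"
    and \<sigma>: "0 \<le> \<sigma>" "\<sigma> \<le> p" and \<Omega>: "open \<Omega>" and K: "compact K" "K \<subseteq> \<Omega>"
  shows "integrable (lebesgue_on K) (\<lambda>x. f x (u x) + g x (u x) * norm (Du x) powr \<sigma>)"
proof (rule Bochner_Integration.integrable_add)
  have Kl: "K \<in> sets lebesgue" using K by (simp add: lmeasurable_compact fmeasurableD)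
  show "integrable (lebesgue_on K) (\<lambda>x. f x (u x))"
    using Lp_loc_set_integrable[OF f q _ K] \<Omega> Kl by (simp add: integrable_restrict_space set_integrable_def)
  obtain G where G: "0 \<le> G" "AE x in lebesgue. x \<in> K \<longrightarrow> \<bar>g x (u x)\<bar> \<le> G"
    using superposition_bounded[OF g u K] by blast
  have [measurable]: "Du \<in> borel_measurable (lebesgue_on K)" "(\<lambda>x. g x (u x)) \<in> borel_measurable (lebesgue_on K)"
    using Du u superposition_measurable[OF g] K(2)
    by (auto simp: Lp_loc_def Linf_loc_def intro: measurable_restrict_mono)
  interpret finite_measure "lebesgue_on K" using K by (intro finite_measure_lebesgue_on lmeasurable_compact)
  show "integrable (lebesgue_on K) (\<lambda>x. g x (u x) * norm (Du x) powr \<sigma>)"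
  proof (rule Bochner_Integration.integrable_bound)
    have "integrable (lebesgue_on K) (\<lambda>x. norm (Du x) powr p)"
      using Du K Kl by (auto simp: Lp_loc_def integrable_restrict_space set_integrable_def)
    then show "integrable (lebesgue_on K) (\<lambda>x. G * (1 + norm (Du x) powr p))" by auto
    have "AE x in lebesgue_on K. \<bar>g x (u x)\<bar> \<le> G" using G(2) Kl by (subst AE_restrict_space_iff) auto
    then show "AE x in lebesgue_on K. norm (g x (u x) * norm (Du x) powr \<sigma>) \<le> norm (G * (1 + norm (Du x) powr p))"
    proof eventually_elim
      case (elim x)
      have "norm (g x (u x) * norm (Du x) powr \<sigma>) \<le> G * (1 + norm (Du x) powr p)"
        unfolding real_norm_def abs_mult using elim G(1) \<sigma> le_one_plus_powr[of "norm (Du x)" \<sigma> p]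
        by (intro mult_mono) auto
      then show ?case by (rule order_trans) simp
    qed
  qed measurable
qed

section \<open>Comparison for a fixed scaling factor\<close>

text \<open>A point of the closure at distance at least \<open>d > 0\<close> from the frontier is
  not on the frontier, hence lies in the open set. The complement of this compact set is the
  boundary strip in which the boundary inequality is effective.\<close>

lemma compact_away_from_frontier:
  fixes \<Omega> :: "'a::euclidean_space set"
  assumes "open \<Omega>" "bounded \<Omega>" "0 < d"
  shows "compact {x \<in> \<Omega>. d \<le> infdist x (frontier \<Omega>)}"
proof -
  have "{x \<in> \<Omega>. d \<le> infdist x (frontier \<Omega>)} = closure \<Omega> \<inter> {x. d \<le> infdist x (frontier \<Omega>)}"
  proof (intro set_eqI iffI)
    fix x assume x: "x \<in> closure \<Omega> \<inter> {x. d \<le> infdist x (frontier \<Omega>)}"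
    then have "x \<notin> frontier \<Omega>" using assms(3) by auto
    then show "x \<in> {x \<in> \<Omega>. d \<le> infdist x (frontier \<Omega>)}"
      using x assms(1) by (auto simp: frontier_def interior_open)
  qed (use closure_subset in auto)
  moreover have "closed {x. d \<le> infdist x (frontier \<Omega>)}"
    by (intro closed_Collect_le continuous_intros)
  moreover have "compact (closure \<Omega>)" using assms(2) by (simp add: compact_closure)
  ultimately show ?thesis by (simp add: compact_Int_closed)
qed

text \<open>Where \<open>\<delta> * U - V > k\<close> one has \<open>V < \<delta> * U - (1 - \<delta>) * c \<le> U\<close>, so monotonicity compares the
  lower order terms, and the factor \<open>\<delta> powr (p - 1 - \<sigma>) > 1\<close> pays for replacing \<open>DV\<close> by \<open>\<delta> DU\<close>.\<close>

lemma comparison_integrand_lower_bound: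
  fixes \<a> :: "'a::euclidean_space \<Rightarrow> 'a" and f g :: "real \<Rightarrow> real"
    and p \<sigma> \<gamma> \<delta> c k m C G U V :: real and DU DV :: 'a
  defines "z \<equiv> max 0 (\<delta> * U - V - k)" and "D \<equiv> \<delta> *\<^sub>R DU - DV"
  assumes p: "1 < p" and \<sigma>: "p - 1 < \<sigma>" "\<sigma> \<le> p" and \<delta>: "0 < \<delta>" "\<delta> < 1"
    and a_mono: "\<And>\<xi> \<eta>. \<gamma> * norm (\<xi> - \<eta>) powr p \<le> (\<a> \<xi> - \<a> \<eta>) \<bullet> (\<xi> - \<eta>)"
    and a_hom: "\<a> (\<delta> *\<^sub>R DU) = \<delta> powr (p - 1) *\<^sub>R \<a> DU"
    and f: "mono f" "f (\<delta> * U) \<le> \<delta> powr (p - 1) * f U" and g: "mono g" "0 \<le> g V" "g V \<le> G"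
    and C: "0 \<le> C" "\<And>U s. 0 \<le> U \<Longrightarrow> 0 \<le> s \<Longrightarrow> (U + s) powr \<sigma> \<le> \<delta> powr (p - 1 - \<sigma>) * U powr \<sigma> + C * s powr \<sigma>"
    and U: "- c \<le> U" "0 \<le> c" "(1 - \<delta>) * c \<le> k" and m: "z \<le> m"
  shows "(2 * \<gamma> - C * G * m powr (\<sigma> + 1 - p)) * (z * norm D powr p) - C * G * m powr (\<sigma> + 1 - p) * z powr (p + 1)
    \<le> \<delta> powr (p - 1) * ((2 * z powr (2 - 1)) * (\<a> DU \<bullet> D)) - (2 * z powr (2 - 1)) * (\<a> DV \<bullet> D) +
      (\<delta> powr (p - 1) * ((f U + g U * norm DU powr \<sigma>) * z powr 2) - (f V + g V * norm DV powr \<sigma>) * z powr 2)"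
proof (cases "z = 0")
  case False
  then have z: "0 < z" by (simp add: z_def max_def split: if_splits)
  then have big: "V + k < \<delta> * U" by (simp add: z_def max_def split: if_splits)
  have k0: "0 \<le> k" using U \<delta> by (smt (verit) mult_nonneg_nonneg)
  \<comment> \<open>From \<open>U \<ge> - c\<close> follows \<delta> U \<le> U + (1 - \<delta>) c
    \<le> U + k, and V < \<delta> U - k.\<close>
  have UV: "V \<le> U"
  proof -
    have "0 \<le> (1 - \<delta>) * (U + c)" using U \<delta> by (intro mult_nonneg_nonneg) auto
    then show ?thesis using big U by (simp add: algebra_simps)
  qed
  define s where "s = norm D"
  have s: "0 \<le> s" by (simp add: s_def)
  have main: "\<gamma> * s powr p \<le> \<delta> powr (p - 1) * (\<a> DU \<bullet> D) - \<a> DV \<bullet> D"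
    using a_mono[of "\<delta> *\<^sub>R DU" DV] by (simp add: a_hom D_def s_def inner_diff_left)
  have fUV: "f V \<le> \<delta> powr (p - 1) * f U"
    using f big k0 monoD[OF f(1), of V "\<delta> * U"] by linarith
  \<comment> \<open>Rewriting in terms of |DU| turns \<delta>^(p-1-\<sigma>) |\<delta> DU|^\<sigma>
    into \<delta>^(p-1) |DU|^\<sigma>, precisely the factor by which the inequality for
    \<open>u\<close> is multiplied. The sign of \<open>g V\<close> permits multiplying the gradient
    estimate by it; afterwards \<open>g V\<close> is raised to \<open>g U\<close> in the main term
    and to \<open>G\<close> in the error term.\<close>
  have gUV: "g V * norm DV powr \<sigma> - C * G * s powr \<sigma> \<le> \<delta> powr (p - 1) * (g U * norm DU powr \<sigma>)"
  proof -
    have "norm DV powr \<sigma> \<le> (norm (\<delta> *\<^sub>R DU) + s) powr \<sigma>"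
      using p \<sigma> norm_triangle_ineq4[of "\<delta> *\<^sub>R DU" D] by (intro powr_mono2) (auto simp: s_def D_def)
    also have "\<dots> \<le> \<delta> powr (p - 1 - \<sigma>) * norm (\<delta> *\<^sub>R DU) powr \<sigma> + C * s powr \<sigma>" using s by (intro C) auto
    also have "\<delta> powr (p - 1 - \<sigma>) * norm (\<delta> *\<^sub>R DU) powr \<sigma> = \<delta> powr (p - 1) * norm DU powr \<sigma>"
      using \<delta> by (simp add: powr_mult powr_diff)
    finally have "g V * norm DV powr \<sigma> \<le> g V * (\<delta> powr (p - 1) * norm DU powr \<sigma> + C * s powr \<sigma>)"
      using g by (intro mult_left_mono) auto
    also have "\<dots> \<le> g U * (\<delta> powr (p - 1) * norm DU powr \<sigma>) + G * (C * s powr \<sigma>)"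
      unfolding distrib_left using g C monoD[OF g(1) UV] by (intro add_mono mult_right_mono) auto
    finally show ?thesis by (simp add: algebra_simps)
  qed
  have zz: "z powr (2 - 1) = z" "z powr 2 = z * z" using z by (auto simp: powr_numeral power2_eq_square)
  have small: "s powr \<sigma> * z \<le> m powr (\<sigma> + 1 - p) * (s powr p + z powr p)"
    using z m s \<sigma> p by (intro powr_mult_le_small) auto
  have "(2 * \<gamma> - C * G * m powr (\<sigma> + 1 - p)) * (z * s powr p) - C * G * m powr (\<sigma> + 1 - p) * z powr (p + 1)
    = 2 * z * (\<gamma> * s powr p) - C * G * z * (m powr (\<sigma> + 1 - p) * (s powr p + z powr p))"
    using z by (simp add: powr_add algebra_simps)
  also have "\<dots> \<le> 2 * z * (\<delta> powr (p - 1) * (\<a> DU \<bullet> D) - \<a> DV \<bullet> D) - C * G * z * (s powr \<sigma> * z)"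
    using z main small C g by (intro diff_mono mult_left_mono) auto
  \<comment> \<open>The inserted \<open>f V - f V\<close> lets the next step apply
    \<open>fUV\<close> and \<open>gUV\<close> at once: the first \<open>f V\<close> is raised, the
    second stays with the terms of \<open>V\<close>.\<close>
  also have "\<dots> = 2 * z * (\<delta> powr (p - 1) * (\<a> DU \<bullet> D) - \<a> DV \<bullet> D) + (f V - f V - C * G * s powr \<sigma>) * (z * z)"
    by (simp add: algebra_simps)
  also have "\<dots> \<le> 2 * z * (\<delta> powr (p - 1) * (\<a> DU \<bullet> D) - \<a> DV \<bullet> D) +
     (\<delta> powr (p - 1) * f U + \<delta> powr (p - 1) * (g U * norm DU powr \<sigma>) - (f V + g V * norm DV powr \<sigma>)) * (z * z)"
    using fUV gUV z by (intro add_left_mono mult_right_mono) auto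
  finally show ?thesis unfolding zz s_def by (simp add: algebra_simps)
qed simp

text \<open>The margin \<epsilon> compensates for the boundary condition, which yields only u - v <
  \<epsilon> near the frontier. The bounds \<open>G\<close>, \<open>R\<close>, \<open>C\<close>,
  \<open>P\<close> and the height \<open>m0\<close> are all chosen before any level, so that the
  lowering step can be iterated.\<close>

lemma scaled_comparison:
  fixes \<Omega> :: "'n::euclidean_space set"
    and a :: "'n \<Rightarrow> 'n \<Rightarrow> 'n"
    and f g :: "'n \<Rightarrow> real \<Rightarrow> real"
    and p \<sigma> \<gamma> \<delta> c \<epsilon> :: real
    and u v :: "'n \<Rightarrow> real"
    and Du Dv :: "'n \<Rightarrow> 'n"
  assumes \<Omega>: "open \<Omega>" "bounded \<Omega>"
    and p: "1 < p"
    and sigma: "p - 1 < \<sigma>" "\<sigma> \<le> p"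
    and gamma: "\<gamma> > 0"
    and a_mono: "\<And>x \<xi> \<eta>. x \<in> \<Omega> \<Longrightarrow> (a x \<xi> - a x \<eta>) \<bullet> (\<xi> - \<eta>) \<ge> \<gamma> * norm (\<xi> - \<eta>) powr p"
    and g_cont: "continuous_on (\<Omega> \<times> UNIV) (\<lambda>(x, t). g x t)"
    and f_mono: "\<And>x. x \<in> \<Omega> \<Longrightarrow> mono (f x)"
    and g_mono: "\<And>x. x \<in> \<Omega> \<Longrightarrow> mono (g x)"
    and \<delta>: "0 < \<delta>" "\<delta> < 1"
    and a_hom: "\<And>x \<xi>. x \<in> \<Omega> \<Longrightarrow> a x (\<delta> *\<^sub>R \<xi>) = (\<delta> powr (p - 1)) *\<^sub>R a x \<xi>"
    and f_hom: "\<And>x t. x \<in> \<Omega> \<Longrightarrow> f x (\<delta> * t) \<le> \<delta> powr (p - 1) * f x t"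
    and u_W: "W1p_loc p \<Omega> u Du" and v_W: "W1p_loc p \<Omega> v Dv"
    and u_Linf: "Linf_loc \<Omega> u" and v_Linf: "Linf_loc \<Omega> v"
    and c: "0 \<le> c" "AE x in lebesgue. x \<in> \<Omega> \<longrightarrow> - c \<le> u x"
    and g_v: "AE x in lebesgue. x \<in> \<Omega> \<longrightarrow> 0 \<le> g x (v x)"
    and cons_au: "Lp_loc (p / (p - 1)) \<Omega> (\<lambda>x. a x (Du x))"
    and cons_av: "Lp_loc (p / (p - 1)) \<Omega> (\<lambda>x. a x (Dv x))"
    and cons_fu: "Lp_loc (p / (p - 1)) \<Omega> (\<lambda>x. f x (u x))"
    and cons_fv: "Lp_loc (p / (p - 1)) \<Omega> (\<lambda>x. f x (v x))"
    and sub: "Qstar_sub a f g \<sigma> \<Omega> u Du"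
    and super: "Qstar_super a f g \<sigma> \<Omega> v Dv"
    and bdry: "le_on_boundary \<Omega> u v"
    and \<epsilon>: "0 < \<epsilon>"
  shows "AE x in lebesgue. x \<in> \<Omega> \<longrightarrow> \<delta> * u x - v x \<le> (1 - \<delta>) * c + \<epsilon>"
proof -
  define h where "h x = \<delta> * u x - v x" for x
  define Dh where "Dh x = \<delta> *\<^sub>R Du x - Dv x" for x
  \<comment> \<open>In the boundary strip \<delta> u - v = (u - v) - (1 - \<delta>) u < \<epsilon> +
    (1 - \<delta>) c.\<close>
  define k0 where "k0 = (1 - \<delta>) * c + \<epsilon>"
  have ck0: "(1 - \<delta>) * c \<le> k0" "0 < k0" using \<epsilon> \<delta> c(1) by (auto simp: k0_def add_nonneg_pos)
  have W: "W1p_loc p \<Omega> h Dh"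
    using W1p_loc_scale_diff[OF u_W v_W _ \<Omega>(1), of \<delta>] p by (simp add: h_def[abs_def] Dh_def[abs_def])
  obtain d where d: "0 < d" "\<And>x. x \<in> \<Omega> \<Longrightarrow> infdist x (frontier \<Omega>) < d \<Longrightarrow> u x - v x < \<epsilon>"
    using bdry \<epsilon> unfolding le_on_boundary_def by blast
  define K0 where "K0 = {x \<in> \<Omega>. d \<le> infdist x (frontier \<Omega>)}"
  have K0: "compact K0" "K0 \<subseteq> \<Omega>"
    unfolding K0_def by (rule compact_away_from_frontier[OF \<Omega> d(1)]) auto
  have small: "AE x in lebesgue. x \<in> \<Omega> - K0 \<longrightarrow> h x \<le> k0"
    using c(2)
  proof eventually_elim
    case (elim x)
    show ?case
    proof
      assume x: "x \<in> \<Omega> - K0"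
      then have "u x - v x < \<epsilon>" using d(2)[of x] by (auto simp: K0_def)
      moreover have "0 \<le> (1 - \<delta>) * (u x + c)" using elim x \<delta> by (intro mult_nonneg_nonneg) auto
      ultimately show "h x \<le> k0" by (simp add: h_def k0_def algebra_simps)
    qed
  qed
  obtain K H DH where approx: "compact K" "K \<subseteq> \<Omega>" "K0 \<subseteq> K"
    "\<And>j x. (H j has_derivative (\<lambda>t. DH j x \<bullet> t)) (at x)" "\<And>j::nat. continuous_on UNIV (DH j)"
    "\<And>j x. x \<notin> K \<Longrightarrow> H j x \<le> k0"
    "\<And>t j x. 0 \<le> t \<Longrightarrow> AE x in lebesgue. x \<in> \<Omega> \<longrightarrow> h x \<le> t \<Longrightarrow> H j x \<le> t"
    "AE x in lebesgue. x \<in> K \<longrightarrow> (\<lambda>j. H j x) \<longlonglongrightarrow> h x"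
    "(\<lambda>j. \<integral>\<^sup>+ x. ennreal (indicator K x * norm (DH j x - Dh x) powr p) \<partial>lebesgue) \<longlonglongrightarrow> 0"
    by (rule W1p_loc_smooth_approx[OF \<Omega>(1) K0 W p less_imp_le[OF ck0(2)] small]) (rule that)
  interpret smooth_approximation \<Omega> K p k0 h Dh H DH
    by unfold_locales (fact \<Omega>(1) p W approx)+
  obtain Cu where Cu: "AE x in lebesgue. x \<in> K \<longrightarrow> \<bar>u x\<bar> \<le> Cu" using u_Linf K by (auto simp: Linf_loc_def)
  obtain Cv where Cv: "AE x in lebesgue. x \<in> K \<longrightarrow> \<bar>v x\<bar> \<le> Cv" using v_Linf K by (auto simp: Linf_loc_def)
  \<comment> \<open>A global upper bound from local ones: on \<open>K\<close> from the bounds of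
    \<open>u\<close> and \<open>v\<close>, elsewhere from \<open>small\<close>, because
    \<open>K\<close> contains \<open>K0\<close>.\<close>
  have t0: "AE x in lebesgue. x \<in> \<Omega> \<longrightarrow> h x \<le> max k0 (\<bar>Cu\<bar> + Cv)"
    using Cu Cv small
  proof eventually_elim
    case (elim x)
    show ?case
    proof
      assume x: "x \<in> \<Omega>"
      show "h x \<le> max k0 (\<bar>Cu\<bar> + Cv)"
      proof (cases "x \<in> K")
        case True
        have "\<delta> * u x \<le> \<delta> * \<bar>u x\<bar>" using \<delta> by (intro mult_left_mono) auto
        also have "\<dots> \<le> 1 * \<bar>u x\<bar>" using \<delta> by (intro mult_right_mono) auto
        finally show ?thesis using elim True by (auto simp: h_def)
      next
        case False
        then show ?thesis using elim x approx(3) by auto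
      qed
    qed
  qed
  obtain G where G: "0 \<le> G" "AE x in lebesgue. x \<in> K \<longrightarrow> \<bar>g x (v x)\<bar> \<le> G"
    using superposition_bounded[OF g_cont v_Linf K] by blast
  obtain R where R: "0 < R" "\<And>x. x \<in> K \<Longrightarrow> norm x \<le> R"
    using compact_imp_bounded[OF K(1)] by (auto simp: bounded_pos)
  have \<kappa>: "1 < \<delta> powr (p - 1 - \<sigma>)" using \<delta> sigma by (simp add: powr_def mult_neg_neg)
  have \<sigma>0: "0 < \<sigma>" using p sigma by simp
  obtain C where C: "0 \<le> C"
    "\<And>U s. 0 \<le> U \<Longrightarrow> 0 \<le> s \<Longrightarrow> (U + s) powr \<sigma> \<le> \<delta> powr (p - 1 - \<sigma>) * U powr \<sigma> + C * s powr \<sigma>"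
    using add_powr_le_weighted[OF \<kappa> \<sigma>0] by blast
  define P where "P = (2 * (p + 1) * R) powr p"
  define X where "X = C * G * (1 + P)"
  have PX: "0 \<le> P" "0 \<le> X" using C G by (auto simp: P_def X_def)
  \<comment> \<open>The largest height at which error and Poincare constants together cost at most
    \<gamma>, half of the coercivity 2 \<gamma>, up to the 1 that guards against
    \<open>X = 0\<close>.\<close>
  define m0 where "m0 = (\<gamma> / (X + 1)) powr (1 / (\<sigma> + 1 - p))"
  have m0: "0 < m0" using gamma PX by (simp add: m0_def)
  define Y where "Y = C * G * m0 powr (\<sigma> + 1 - p)"
  have Y: "0 \<le> Y" "Y * (1 + P) \<le> \<gamma>"
  proof -
    show "0 \<le> Y" using C G by (simp add: Y_def)
    have "m0 powr (\<sigma> + 1 - p) = \<gamma> / (X + 1)" using gamma PX sigma by (simp add: m0_def powr_powr)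
    then have "Y * (1 + P) = X * (\<gamma> / (X + 1))" by (simp add: Y_def X_def)
    also have "\<dots> \<le> (X + 1) * (\<gamma> / (X + 1))" using gamma PX by (intro mult_right_mono) auto
    also have "\<dots> = \<gamma>" using PX by simp
    finally show "Y * (1 + P) \<le> \<gamma>" .
  qed
  have q1: "1 \<le> p / (p - 1)" using p by (simp add: field_simps)
  have LDu: "Lp_loc p \<Omega> Du" and LDv: "Lp_loc p \<Omega> Dv" using u_W v_W by (auto simp: W1p_loc_def)
  define Bu where "Bu x = f x (u x) + g x (u x) * norm (Du x) powr \<sigma>" for x
  define Bv where "Bv x = f x (v x) + g x (v x) * norm (Dv x) powr \<sigma>" for x
  have Bu: "integrable (lebesgue_on K) Bu"
    unfolding Bu_def[abs_def]
    using \<sigma>0 sigma by (intro lower_order_integrable[where f = f, OF g_cont u_Linf LDu cons_fu q1 _ _ \<Omega>(1) K]) auto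
  have Bv: "integrable (lebesgue_on K) Bv"
    unfolding Bv_def[abs_def]
    using \<sigma>0 sigma by (intro lower_order_integrable[where f = f, OF g_cont v_Linf LDv cons_fv q1 _ _ \<Omega>(1) K]) auto
  have lin: "(LINT x|M. r * F1 x - F2 x + (r * F3 x - F4 x)) =
      r * (integral\<^sup>L M F1 + integral\<^sup>L M F3) - (integral\<^sup>L M F2 + integral\<^sup>L M F4)"
    if "integrable M F1" "integrable M F2" "integrable M F3" "integrable M F4"
    for M :: "'n measure" and r :: real and F1 F2 F3 F4
    using that by (simp add: distrib_left)
  \<comment> \<open>One lowering step: an upper bound \<open>t\<close> at most \<open>m0\<close>
    above \<open>k\<close> forces the truncation at \<open>k\<close> to vanish, because its values
    do not exceed \<open>m0\<close>.\<close>
  have step: "AE x in lebesgue. x \<in> \<Omega> \<longrightarrow> h x \<le> k"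
    if k: "k0 \<le> k" and tk: "t - k \<le> m0" and t: "0 \<le> t" "AE x in lebesgue. x \<in> \<Omega> \<longrightarrow> h x \<le> t" for k t
  proof -
    have b: "(1::real) < 2" by simp
    define z where "z x = max 0 (h x - k)" for x
    let ?w = "\<lambda>x. 2 * z x powr (2 - 1)"
    have "Qstar_form a f g \<sigma> \<Omega> u Du (\<lambda>x. max 0 (H j x - k) powr 2) (\<lambda>x. (2 * max 0 (H j x - k) powr (2 - 1)) *\<^sub>R DH j x) \<le> 0" for j
      using sub C1c_truncation[OF k b, of j] unfolding Qstar_sub_def by simp
    then have Lu: "(LINT x|lebesgue_on K. ?w x * (a x (Du x) \<bullet> Dh x)) + (LINT x|lebesgue_on K. Bu x * z x powr 2) \<le> 0"
      using test_limit[OF k t b cons_au Bu] unfolding Qstar_form_def Bu_def z_def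
      by (intro LIMSEQ_le_const2) auto
    have "0 \<le> Qstar_form a f g \<sigma> \<Omega> v Dv (\<lambda>x. max 0 (H j x - k) powr 2) (\<lambda>x. (2 * max 0 (H j x - k) powr (2 - 1)) *\<^sub>R DH j x)" for j
      using super C1c_truncation[OF k b, of j] unfolding Qstar_super_def by simp
    then have Lv: "0 \<le> (LINT x|lebesgue_on K. ?w x * (a x (Dv x) \<bullet> Dh x)) + (LINT x|lebesgue_on K. Bv x * z x powr 2)"
      using test_limit[OF k t b cons_av Bv] unfolding Qstar_form_def Bv_def z_def
      by (intro LIMSEQ_le_const) auto
    note iu = truncation_integrable[OF t(2) b cons_au Bu, of k, folded z_def]
    note iv = truncation_integrable[OF t(2) b cons_av Bv, of k, folded z_def]
    note ie = truncation_energy_integrable[OF t(2), of k, folded z_def]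
    define I where "I = (LINT x|lebesgue_on K. z x * norm (Dh x) powr p)"
    define J where "J = (LINT x|lebesgue_on K. z x powr (p + 1))"
    have I0: "0 \<le> I" unfolding I_def by (intro integral_nonneg_AE) (auto simp: z_def)
    have J0: "0 \<le> J" unfolding J_def by (intro integral_nonneg_AE) auto
    have JI: "J \<le> P * I"
      using truncation_poincare[OF k t R] by (simp add: I_def J_def P_def z_def)
    have "(2 * \<gamma> - Y) * I - Y * J = (LINT x|lebesgue_on K. (2 * \<gamma> - Y) * (z x * norm (Dh x) powr p) - Y * z x powr (p + 1))"
      using ie by (simp add: I_def J_def)
    also have "\<dots> \<le> (LINT x|lebesgue_on K.
      \<delta> powr (p - 1) * (?w x * (a x (Du x) \<bullet> Dh x)) - ?w x * (a x (Dv x) \<bullet> Dh x) +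
      (\<delta> powr (p - 1) * (Bu x * z x powr 2) - Bv x * z x powr 2))"
    proof (rule integral_mono_AE)
      have cK: "AE x in lebesgue_on K. x \<in> K \<and> - c \<le> u x \<and> 0 \<le> g x (v x) \<and> g x (v x) \<le> G \<and> h x \<le> t"
        unfolding AE_K_iff using c(2) g_v G(2) t(2) by eventually_elim (use K(2) in auto)
      then show "AE x in lebesgue_on K. (2 * \<gamma> - Y) * (z x * norm (Dh x) powr p) - Y * z x powr (p + 1) \<le>
        \<delta> powr (p - 1) * (?w x * (a x (Du x) \<bullet> Dh x)) - ?w x * (a x (Dv x) \<bullet> Dh x) +
        (\<delta> powr (p - 1) * (Bu x * z x powr 2) - Bv x * z x powr 2)"
      proof eventually_elim
        case (elim x)
        then have x: "x \<in> \<Omega>" using K(2) by auto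
        have zm: "max 0 (\<delta> * u x - v x - k) \<le> m0" using elim tk m0 by (simp add: h_def)
        show ?case
          unfolding Y_def Bu_def Bv_def z_def h_def Dh_def
          by (rule comparison_integrand_lower_bound[where c = c])
            (use x elim zm p sigma \<delta> a_mono a_hom f_mono f_hom g_mono C c(1) k ck0 in auto)
      qed
    qed (use iu iv ie in auto)
    also have "\<dots> = \<delta> powr (p - 1) * ((LINT x|lebesgue_on K. ?w x * (a x (Du x) \<bullet> Dh x)) + (LINT x|lebesgue_on K. Bu x * z x powr 2))
      - ((LINT x|lebesgue_on K. ?w x * (a x (Dv x) \<bullet> Dh x)) + (LINT x|lebesgue_on K. Bv x * z x powr 2))"
      by (rule lin[OF iu(1) iv(1) iu(2) iv(2)])
    also have "\<dots> \<le> 0" using Lu Lv by (smt (verit) mult_nonneg_nonpos powr_ge_zero)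
    finally have "(2 * \<gamma> - Y) * I - Y * J \<le> 0" .
    \<comment> \<open>With J \<le> P I the energy inequality reads (2 \<gamma> - Y (1 + P)) I \<le>
      0, and Y (1 + P) \<le> \<gamma> leaves \<gamma> I \<le> 0. Then \<open>J = 0\<close>, which
      says that \<open>z\<close> vanishes.\<close>
    moreover have "Y * J \<le> Y * (P * I)" using Y(1) JI by (intro mult_left_mono)
    moreover have "(Y * (1 + P)) * I \<le> \<gamma> * I" using Y(2) I0 by (intro mult_right_mono)
    ultimately have "\<gamma> * I \<le> 0" by (simp add: algebra_simps)
    then have "I \<le> 0" using gamma by (simp add: mult_le_0_iff)
    then have "J = 0" using JI J0 PX I0 by simp
    then have "AE x in lebesgue_on K. z x powr (p + 1) = 0"
      unfolding J_def using ie(2) by (subst (asm) integral_nonneg_eq_0_iff_AE) auto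
    then have "AE x in lebesgue. x \<in> K \<longrightarrow> z x powr (p + 1) = 0" by (simp only: AE_K_iff)
    with small show "AE x in lebesgue. x \<in> \<Omega> \<longrightarrow> h x \<le> k"
      by eventually_elim (use approx(3) k in \<open>auto simp: z_def max_def split: if_splits\<close>)
  qed
  define t0 where "t0 = max k0 (\<bar>Cu\<bar> + Cv)"
  have iter: "AE x in lebesgue. x \<in> \<Omega> \<longrightarrow> h x \<le> max k0 (t0 - real n * m0)" for n
  proof (induction n)
    case 0
    then show ?case using t0 by (simp add: t0_def)
  next
    case (Suc n)
    show ?case
      \<comment> \<open>Consecutive bounds \<open>max k0 (t0 - real n * m0)\<close> differ by at
        most \<open>m0\<close>.\<close>
      by (rule step[OF _ _ _ Suc]) (use ck0 m0 in \<open>auto simp: algebra_simps\<close>)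
  qed
  obtain n where "(t0 - k0) / m0 \<le> real n" using real_arch_simple by blast
  then have "max k0 (t0 - real n * m0) = k0" using m0 by (simp add: field_simps)
  with iter[of n] show ?thesis by (simp add: h_def k0_def)
qed

section \<open>Removal of the scaling factor\<close>

theorem theorem3p1:
  fixes \<Omega> :: "'n::euclidean_space set"
    and a :: "'n \<Rightarrow> 'n \<Rightarrow> 'n"
    and f g :: "'n \<Rightarrow> real \<Rightarrow> real"
    and p \<sigma> \<gamma> :: real
    and u v :: "'n \<Rightarrow> real"
    and Du Dv :: "'n \<Rightarrow> 'n"
  assumes dom: "bounded_domain \<Omega>"
    and p: "2 \<le> p"
    and sigma: "p - 1 < \<sigma>" "\<sigma> \<le> p"
    and a_meas: "\<And>\<xi>. (\<lambda>x. a x \<xi>) \<in> borel_measurable (lebesgue_on \<Omega>)"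
    and a_cont: "\<And>x. x \<in> \<Omega> \<Longrightarrow> continuous_on UNIV (a x)"
    and gamma: "\<gamma> > 0"
    and a_mono: "\<And>x \<xi> \<eta>. x \<in> \<Omega> \<Longrightarrow> (a x \<xi> - a x \<eta>) \<bullet> (\<xi> - \<eta>) \<ge> \<gamma> * norm (\<xi> - \<eta>) powr p"
    and f_cont: "continuous_on (\<Omega> \<times> UNIV) (\<lambda>(x, t). f x t)"
    and g_cont: "continuous_on (\<Omega> \<times> UNIV) (\<lambda>(x, t). g x t)"
    and f_mono: "\<And>x. x \<in> \<Omega> \<Longrightarrow> mono (f x)"
    and g_mono: "\<And>x. x \<in> \<Omega> \<Longrightarrow> mono (g x)"
    and a_hom: "\<And>x \<xi> \<delta>. x \<in> \<Omega> \<Longrightarrow> 0 < \<delta> \<Longrightarrow> \<delta> < 1 \<Longrightarrow> a x (\<delta> *\<^sub>R \<xi>) = (\<delta> powr (p - 1)) *\<^sub>R a x \<xi>"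
    and f_hom: "\<And>x t \<delta>. x \<in> \<Omega> \<Longrightarrow> 0 < \<delta> \<Longrightarrow> \<delta> < 1 \<Longrightarrow> f x (\<delta> * t) \<le> \<delta> powr (p - 1) * f x t"
    and u_W: "W1p_loc p \<Omega> u Du" and v_W: "W1p_loc p \<Omega> v Dv"
    and u_Linf: "Linf_loc \<Omega> u" and v_Linf: "Linf_loc \<Omega> v"
    and u_below: "\<exists>c. AE x in lebesgue. x \<in> \<Omega> \<longrightarrow> c \<le> u x"
    and g_v: "AE x in lebesgue. x \<in> \<Omega> \<longrightarrow> 0 \<le> g x (v x)"
    and cons_au: "Lp_loc (p / (p - 1)) \<Omega> (\<lambda>x. a x (Du x))"
    and cons_av: "Lp_loc (p / (p - 1)) \<Omega> (\<lambda>x. a x (Dv x))"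
    and cons_fu: "Lp_loc (p / (p - 1)) \<Omega> (\<lambda>x. f x (u x))"
    and cons_fv: "Lp_loc (p / (p - 1)) \<Omega> (\<lambda>x. f x (v x))"
    and sub: "Qstar_sub a f g \<sigma> \<Omega> u Du"
    and super: "Qstar_super a f g \<sigma> \<Omega> v Dv"
    and bdry: "le_on_boundary \<Omega> u v"
  shows "AE x in lebesgue. x \<in> \<Omega> \<longrightarrow> u x \<le> v x"
proof -
  have \<Omega>: "open \<Omega>" "bounded \<Omega>" using dom by (auto simp: bounded_domain_def)
  have p1: "1 < p" using p by simp
  obtain c0 where c0: "AE x in lebesgue. x \<in> \<Omega> \<longrightarrow> c0 \<le> u x" using u_below by blast
  define c where "c = max 0 (- c0)"
  have c: "0 \<le> c" "AE x in lebesgue. x \<in> \<Omega> \<longrightarrow> - c \<le> u x"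
    using c0 by (auto simp: c_def elim!: eventually_mono)
  \<comment> \<open>Serves both as 1 - \<delta> and as the margin \<epsilon>. The second
    \<open>Suc\<close> keeps \<delta> = 1 - e n positive at n = 0.\<close>
  define e where "e n = 1 / real (Suc (Suc n))" for n
  have "AE x in lebesgue. x \<in> \<Omega> \<longrightarrow> (1 - e n) * u x - v x \<le> (1 - (1 - e n)) * c + e n" for n
    by (rule scaled_comparison[OF \<Omega> p1 sigma gamma a_mono g_cont f_mono g_mono _ _ a_hom f_hom u_W v_W u_Linf v_Linf
        c g_v cons_au cons_av cons_fu cons_fv sub super bdry]) (auto simp: e_def)
  \<comment> \<open>The exceptional null set depends on \<open>n\<close>; a countable family of
    scaling factors leaves one null set for all of them.\<close>
  then have "AE x in lebesgue. \<forall>n. x \<in> \<Omega> \<longrightarrow> (1 - e n) * u x - v x \<le> (1 - (1 - e n)) * c + e n"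
    unfolding AE_all_countable by blast
  then show ?thesis
  proof eventually_elim
    case (elim x)
    show ?case
    proof
      assume x: "x \<in> \<Omega>"
      have e: "e \<longlonglongrightarrow> 0" unfolding e_def using LIMSEQ_ignore_initial_segment[OF lim_1_over_n, of 2] by simp
      have "(\<lambda>n. (1 - e n) * u x - v x) \<longlonglongrightarrow> (1 - 0) * u x - v x" by (intro tendsto_intros e)
      moreover have "(\<lambda>n. (1 - (1 - e n)) * c + e n) \<longlonglongrightarrow> (1 - (1 - 0)) * c + 0" by (intro tendsto_intros e)
      ultimately have "(1 - 0) * u x - v x \<le> (1 - (1 - 0)) * c + 0"
        by (rule LIMSEQ_le) (use elim x in auto)
      then show "u x \<le> v x" by simp
    qed
  qed
qed

end
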